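(* Let $\phi^*$ be a (non-degenerate) index-1 saddle point of the functional $F$ in the mass-constrained class $\mathcal{A}_m=\{\phi:\int_\Omega\phi\,dx=m\}$, where the second order variational derivative $\mathbf{H}(\phi)=\delta_\phi^2F(\phi)$ is continuous in $\phi$. For each $\phi$ let $v(\phi)$ be the normalized eigenvector corresponding to the smallest eigenvalue of $\widehat{\mathbf{H}}(\phi)=\mathbf{P}\,\mathbf{H}(\phi)\,\mathbf{P}$ on the mean-zero subspace $H_0$, i.e. $$v(\phi)=\operatorname*{argmin}_{u\in H_0,\ \|u\|_{L^2}=1}\langle u,\widehat{\mathbf{H}}(\phi)u\rangle_{L^2}.$$ For $\phi,\psi\in\mathcal{A}_m$ let $$L(\psi;\phi,v(\phi))=F(\psi)-2F(\hat\psi),\qquad \hat\psi=\phi+\langle v(\phi),\psi-\phi\rangle_{L^2}\,v(\phi).$$ Then: (1) $\phi^*$ is a local minimizer of $\psi\mapsto L(\psi;\phi^*,v(\phi^* ))$ in $\mathcal{A}_m$. (2) There exists a neighbourhood $\mathcal{U}$ of $\phi^*$ in $\mathcal{A}_m$ such that for every $\phi\in\mathcal{U}$ the functional $\psi\mapsto L(\psi;\phi,v(\phi))$ is strictly convex in $\psi\in\mathcal{U}$ and thus has a unique minimizer in $\mathcal{U}$. (3) Define $\Phi:\mathcal{U}\to\mathcal{U}$ by letting $\Phi(\phi)$ be the unique minimizer of $\psi\mapsto L(\psi;\phi,v(\phi))$ in $\mathcal{U}$. Assume further that $\mathcal{U}$ contains no stationary points of $F$ (in the mass-constrained sense) other than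 $\phi^*$. Then $\Phi$ has only one fixed point, namely $\phi^*$. (4) $\Phi$ is differentiable in $\mathcal{U}$ and $\mathbf{P}\,\Phi'(\phi^* )\,\mathbf{P}=0$. Thus the iteration $\phi\mapsto\Phi(\phi)$ has a local quadratic convergence rate, i.e. the iterates $\phi^{(k+1)}=\Phi(\phi^{(k)})$ started sufficiently close to $\phi^*$ converge to $\phi^*$ with $\|\phi^{(k+1)}-\phi^*\|\le C\|\phi^{(k)}-\phi^*\|^2$ for some constant $C$.
   Context: $\Omega$ is a bounded domain (with periodic boundary conditions), and $F$ is an energy functional of functions $\phi$ on $\Omega$. $\delta_\phi F$ and $\mathbf{H}=\delta_\phi^2F$ denote the first and second order variational derivatives of $F$ in the $L^2(\Omega)$ sense. $H_0=\{u\in L^2(\Omega):\int_\Omega u\,dx=0\}$ is the mean-zero subspace and $\mathbf{P}:L^2(\Omega)\to H_0$ is the orthogonal projection $$\mathbf{P}u=u-\frac{1}{|\Omega|}\int_\Omega u(x)\,dx.$$ The mass $m\in\mathbb{R}$ is fixed, and minimization of $L$ is subject to the mass constraint $\int_\Omega\phi\,dx=m$, i.e. $\phi\in\mathcal{A}_m$. The first and second order variations of $F$ relative to the constrained subspace are $\mathbf{P}\,\delta_\phi F$ and $\widehat{\mathbf{H}}=\mathbf{P}\mathbf{H}\mathbf{P}$. A stationary point of $F$ in the mass-constrained sense is $\phi\in\mathcal{A}_m$ with $\mathbf{P}\,\delta_\phi F(\phi)=0$. A (non-degenerate) index-1 saddle point in this sense is a stationary point $\phi^*$ with exactly one unstable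 direction: $\widehat{\mathbf{H}}(\phi^* )$ on $H_0$ has exactly one negative eigenvalue, which is simple, and all its other eigenvalues are positive. The functional $L$ is the choice $\alpha=0$, $\beta=2$ in the general auxiliary functional $$L(\psi;\phi,v)=(1-\alpha)F(\psi)+\alpha F\big(\psi-\langle v,\psi-\phi\rangle_{L^2}v\big)-\beta F\big(\phi+\langle v,\psi-\phi\rangle_{L^2}v\big).$$
   Formalization: Differentiability of Φ on U (beyond φ* ) and the quadratic rate are proved assuming H is differentiable on U, since continuity of H alone does not suffice; and at the saddle the whole remaining spectrum of PHP, not only the eigenvalues, is required to be positive. *)

theory Defs
  imports "HOL-Analysis.Analysis"
begin

definition square_integrable :: "('d::euclidean_space \<Rightarrow> real) \<Rightarrow> bool" where
  "square_integrable f \<longleftrightarrow>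
     f \<in> borel_measurable lborel \<and> integrable lborel (\<lambda>x. (f x)\<^sup>2)"

lemma square_integrable_zero: "square_integrable (\<lambda>_. 0)"
  by (simp add: square_integrable_def)

lemma square_integrable_scale: "square_integrable f \<Longrightarrow> square_integrable (\<lambda>x. c * f x)"
  by (auto simp: square_integrable_def power_mult_distrib)

lemma square_integrable_mult:
  assumes "square_integrable f" "square_integrable g"
  shows "integrable lborel (\<lambda>x. f x * g x)"
proof (rule Bochner_Integration.integrable_bound)
  show "integrable lborel (\<lambda>x. (f x)\<^sup>2 + (g x)\<^sup>2)"
    using assms by (simp add: square_integrable_def)
  show "(\<lambda>x. f x * g x) \<in> borel_measurable lborel"
    using assms by (auto simp: square_integrable_def)
  have "\<bar>a * b\<bar> \<le> a\<^sup>2 + b\<^sup>2" for a b :: real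
  proof -
    have "0 \<le> (\<bar>a\<bar> - \<bar>b\<bar>)\<^sup>2" and ab: "0 \<le> \<bar>a\<bar> * \<bar>b\<bar>" by simp_all
    then have "2 * (\<bar>a\<bar> * \<bar>b\<bar>) \<le> a\<^sup>2 + b\<^sup>2" by (simp add: power2_diff)
    with ab show ?thesis unfolding abs_mult by linarith
  qed
  then show "AE x in lborel. norm (f x * g x) \<le> norm ((f x)\<^sup>2 + (g x)\<^sup>2)"
    by (intro AE_I2) (auto intro: order_trans)
qed

lemma square_integrable_add:
  assumes "square_integrable f" "square_integrable g"
  shows "square_integrable (\<lambda>x. f x + g x)"
  using assms square_integrable_mult[OF assms]
  by (auto simp: square_integrable_def power2_sum mult.assoc)

lemma square_integrable_uminus: "square_integrable f \<Longrightarrow> square_integrable (\<lambda>x. - f x)"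
  using square_integrable_scale[of f "-1"] by simp

lemma square_integrable_diff:
  assumes "square_integrable f" "square_integrable g"
  shows "square_integrable (\<lambda>x. f x - g x)"
  using square_integrable_add[OF assms(1) square_integrable_uminus[OF assms(2)]] by simp

lemma square_integrable_indicator:
  assumes "A \<in> fmeasurable lborel"
  shows "square_integrable (indicat_real A)"
proof -
  have "(\<lambda>x. (indicat_real A x)\<^sup>2) = indicat_real A"
    by (auto simp: indicator_def)
  moreover have "integrable lborel (indicat_real A)"
    using assms by (auto simp: fmeasurable_def)
  ultimately show ?thesis
    using assms by (auto simp: square_integrable_def fmeasurable_def)
qed

definition ae_eq :: "('d::euclidean_space \<Rightarrow> real) \<Rightarrow> ('d \<Rightarrow> real) \<Rightarrow> bool" where
  "ae_eq f g \<longleftrightarrow>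
     square_integrable f \<and> square_integrable g \<and> (AE x in lborel. f x = g x)"

lemma part_equivp_ae_eq: "part_equivp (ae_eq :: ('d::euclidean_space \<Rightarrow> real) \<Rightarrow> _)"
proof (rule part_equivpI)
  show "\<exists>f :: 'd \<Rightarrow> real. ae_eq f f"
    using square_integrable_zero by (auto simp: ae_eq_def)
  show "symp (ae_eq :: ('d \<Rightarrow> real) \<Rightarrow> _)"
    by (rule sympI) (auto simp: ae_eq_def elim: AE_mp)
  show "transp (ae_eq :: ('d \<Rightarrow> real) \<Rightarrow> _)"
  proof (rule transpI)
    fix f g h :: "'d \<Rightarrow> real"
    assume "ae_eq f g" "ae_eq g h"
    then show "ae_eq f h"
      by (auto simp: ae_eq_def elim: eventually_elim2)
  qed
qed

quotient_type (overloaded) 'd l2 = "'d::euclidean_space \<Rightarrow> real" / partial: ae_eq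
  by (rule part_equivp_ae_eq)

instantiation l2 :: (euclidean_space) real_vector
begin

lift_definition zero_l2 :: "'a l2" is "\<lambda>_. 0"
  by (simp add: ae_eq_def square_integrable_zero)

lift_definition plus_l2 :: "'a l2 \<Rightarrow> 'a l2 \<Rightarrow> 'a l2" is "\<lambda>f g x. f x + g x"
  by (auto simp: ae_eq_def square_integrable_add)

lift_definition uminus_l2 :: "'a l2 \<Rightarrow> 'a l2" is "\<lambda>f x. - f x"
  by (auto simp: ae_eq_def square_integrable_uminus)

lift_definition minus_l2 :: "'a l2 \<Rightarrow> 'a l2 \<Rightarrow> 'a l2" is "\<lambda>f g x. f x - g x"
  by (auto simp: ae_eq_def square_integrable_diff)

lift_definition scaleR_l2 :: "real \<Rightarrow> 'a l2 \<Rightarrow> 'a l2" is "\<lambda>c f x. c * f x"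
  by (auto simp: ae_eq_def square_integrable_scale)

instance
proof
  fix u v w :: "'a l2" and a b :: real
  show "u + v + w = u + (v + w)"
    by transfer (auto simp: ae_eq_def square_integrable_add add.assoc)
  show "u + v = v + u"
    by transfer (auto simp: ae_eq_def square_integrable_add add.commute)
  show "0 + u = u"
    by transfer (auto simp: ae_eq_def)
  show "- u + u = 0"
    by transfer (auto simp: ae_eq_def square_integrable_zero)
  show "u - v = u + - v"
    by transfer (auto simp: ae_eq_def square_integrable_diff)
  show "a *\<^sub>R (u + v) = a *\<^sub>R u + a *\<^sub>R v"
    by transfer (auto simp: ae_eq_def distrib_left
        intro!: square_integrable_add square_integrable_scale)
  show "(a + b) *\<^sub>R u = a *\<^sub>R u + b *\<^sub>R u"
    by transfer (auto simp: ae_eq_def distrib_right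
        intro!: square_integrable_add square_integrable_scale)
  show "a *\<^sub>R b *\<^sub>R u = (a * b) *\<^sub>R u"
    by transfer (auto simp: ae_eq_def mult.assoc intro!: square_integrable_scale)
  show "1 *\<^sub>R u = u"
    by transfer (auto simp: ae_eq_def)
qed

end

instantiation l2 :: (euclidean_space) real_inner
begin

lift_definition inner_l2 :: "'a l2 \<Rightarrow> 'a l2 \<Rightarrow> real"
  is "\<lambda>f g. LINT x|lborel. f x * g x"
  by (rule integral_cong_AE) (auto simp: ae_eq_def square_integrable_def)

definition norm_l2 :: "'a l2 \<Rightarrow> real" where
  "norm_l2 u = sqrt (inner u u)"

definition sgn_l2 :: "'a l2 \<Rightarrow> 'a l2" where
  "sgn_l2 u = u /\<^sub>R norm u"

definition dist_l2 :: "'a l2 \<Rightarrow> 'a l2 \<Rightarrow> real" where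
  "dist_l2 u v = norm (u - v)"

definition uniformity_l2 :: "('a l2 \<times> 'a l2) filter" where
  "uniformity_l2 = (INF e\<in>{0 <..}. principal {(x, y). dist x y < e})"

definition open_l2 :: "'a l2 set \<Rightarrow> bool" where
  "open_l2 U \<longleftrightarrow> (\<forall>x\<in>U. \<forall>\<^sub>F (x', y) in uniformity. x' = x \<longrightarrow> y \<in> U)"

instance
proof
  fix u v w :: "'a l2" and r :: real and U :: "'a l2 set"
  show "dist u v = norm (u - v)" by (rule dist_l2_def)
  show "sgn u = u /\<^sub>R norm u" by (rule sgn_l2_def)
  show "(uniformity :: ('a l2 \<times> 'a l2) filter) = (INF e\<in>{0 <..}. principal {(x, y). dist x y < e})"
    by (rule uniformity_l2_def)
  show "open U \<longleftrightarrow> (\<forall>x\<in>U. \<forall>\<^sub>F (x', y) in uniformity. x' = x \<longrightarrow> y \<in> U)"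
    by (rule open_l2_def)
  show "inner u v = inner v u"
    by transfer (simp add: mult.commute)
  show "inner (u + v) w = inner u w + inner v w"
    by transfer (simp add: ae_eq_def distrib_right square_integrable_mult)
  show "inner (r *\<^sub>R u) v = r * inner u v"
    by transfer (simp add: ae_eq_def mult.assoc)
  show "0 \<le> inner u u"
    by transfer simp
  show "inner u u = 0 \<longleftrightarrow> u = 0"
  proof transfer
    fix f :: "'a \<Rightarrow> real"
    assume "ae_eq f f"
    then have f: "square_integrable f" by (simp add: ae_eq_def)
    have "(LINT x|lborel. f x * f x) = 0 \<longleftrightarrow> (AE x in lborel. f x * f x = 0)"
      by (rule integral_nonneg_eq_0_iff_AE) (auto intro: square_integrable_mult f)
    then show "(LINT x|lborel. f x * f x) = 0 \<longleftrightarrow> ae_eq f (\<lambda>_. 0)"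
      using f by (simp add: ae_eq_def square_integrable_zero)
  qed
  show "norm u = sqrt (inner u u)" by (rule norm_l2_def)
qed

end

definition bounded_domain :: "'d::euclidean_space set \<Rightarrow> bool" where
  "bounded_domain \<Omega> \<longleftrightarrow> open \<Omega> \<and> connected \<Omega> \<and> bounded \<Omega> \<and> \<Omega> \<noteq> {}"

lift_definition vanishes_outside :: "'d::euclidean_space set \<Rightarrow> 'd l2 \<Rightarrow> bool"
  is "\<lambda>\<Omega> f. AE x in lborel. x \<notin> \<Omega> \<longrightarrow> f x = 0"
  unfolding ae_eq_def by (auto elim: AE_mp)

text \<open>L2 over \<open>\<Omega>\<close> is the closed subspace of classes extended by zero; types cannot depend on \<open>\<Omega>\<close>.\<close>

definition L2 :: "'d::euclidean_space set \<Rightarrow> 'd l2 set" where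
  "L2 \<Omega> = {u. vanishes_outside \<Omega> u}"

text \<open>The guards below only make the two operations total; every bounded domain satisfies them.\<close>

lift_definition l2_one :: "'d::euclidean_space set \<Rightarrow> 'd l2"
  is "\<lambda>\<Omega>. if \<Omega> \<in> fmeasurable lborel then indicat_real \<Omega> else (\<lambda>_. 0)"
  by (auto simp: ae_eq_def square_integrable_indicator square_integrable_zero)

lift_definition l2_integral :: "'d::euclidean_space set \<Rightarrow> 'd l2 \<Rightarrow> real"
  is "\<lambda>\<Omega> f. if \<Omega> \<in> fmeasurable lborel then LINT x:\<Omega>|lborel. f x else 0"
  unfolding ae_eq_def set_lebesgue_integral_def
  by (auto simp: square_integrable_def fmeasurable_def intro!: integral_cong_AE elim: AE_mp)

lemma bounded_domain_fmeasurable: "bounded_domain \<Omega> \<Longrightarrow> \<Omega> \<in> fmeasurable lborel"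
  using emeasure_bounded_finite
  by (auto simp: bounded_domain_def fmeasurable_def)

definition l2_proj :: "'d::euclidean_space set \<Rightarrow> 'd l2 \<Rightarrow> 'd l2" where
  "l2_proj \<Omega> u = u - (l2_integral \<Omega> u / measure lborel \<Omega>) *\<^sub>R l2_one \<Omega>"

definition mean_zero :: "'d::euclidean_space set \<Rightarrow> 'd l2 set" where
  "mean_zero \<Omega> = {u \<in> L2 \<Omega>. l2_integral \<Omega> u = 0}"

text \<open>
  The functional is defined on a Banach space \<open>'x\<close> of functions on \<open>\<Omega>\<close> (this is where periodic
  boundary conditions enter), given with its embedding \<open>\<iota>\<close> into \<open>L2 \<Omega>\<close>.  Examples are \<open>L2 \<Omega>\<close> itself,
  with bounded Hessians, and the periodic Sobolev space of order two, with Hessians that are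
  elliptic differential operators, i.e. unbounded operators in \<open>L2 \<Omega>\<close> with domain \<open>'x\<close>.
\<close>

definition function_space ::
  "'d::euclidean_space set \<Rightarrow> ('x::real_normed_vector \<Rightarrow> 'd l2) \<Rightarrow> bool" where
  "function_space \<Omega> \<iota> \<longleftrightarrow>
     bounded_linear \<iota> \<and> inj \<iota> \<and> range \<iota> \<subseteq> L2 \<Omega> \<and> l2_one \<Omega> \<in> range \<iota>"

definition mass_class ::
  "'d::euclidean_space set \<Rightarrow> ('x::real_normed_vector \<Rightarrow> 'd l2) \<Rightarrow> real \<Rightarrow> 'x set" where
  "mass_class \<Omega> \<iota> m = {\<phi>. l2_integral \<Omega> (\<iota> \<phi>) = m}"

definition proj ::
  "'d::euclidean_space set \<Rightarrow> ('x::real_normed_vector \<Rightarrow> 'd l2) \<Rightarrow> 'x \<Rightarrow> 'x" where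
  "proj \<Omega> \<iota> u = u - (l2_integral \<Omega> (\<iota> u) / measure lborel \<Omega>) *\<^sub>R inv \<iota> (l2_one \<Omega>)"

lemma embed_proj:
  assumes "function_space \<Omega> \<iota>"
  shows "\<iota> (proj \<Omega> \<iota> u) = l2_proj \<Omega> (\<iota> u)"
  using assms
  by (simp add: function_space_def proj_def l2_proj_def f_inv_into_f
      bounded_linear.linear linear_diff linear_scale)

text \<open>
  First and second variational derivatives in the L2 sense: \<open>G \<phi>\<close> is the L2 gradient of \<open>F\<close>,
  and \<open>H \<phi>\<close> is the derivative of \<open>G\<close>, an operator from \<open>'x\<close> to L2.
\<close>

definition variational_derivatives ::
  "'d::euclidean_space set \<Rightarrow> ('x::real_normed_vector \<Rightarrow> 'd l2) \<Rightarrow> ('x \<Rightarrow> real) \<Rightarrow>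
     ('x \<Rightarrow> 'd l2) \<Rightarrow> ('x \<Rightarrow> 'x \<Rightarrow>\<^sub>L 'd l2) \<Rightarrow> bool" where
  "variational_derivatives \<Omega> \<iota> F G H \<longleftrightarrow>
     range G \<subseteq> L2 \<Omega> \<and>
     (\<forall>\<phi>. (F has_derivative (\<lambda>h. inner (G \<phi>) (\<iota> h))) (at \<phi>)) \<and>
     (\<forall>\<phi>. (G has_derivative blinfun_apply (H \<phi>)) (at \<phi>))"

definition proj_hessian ::
  "'d::euclidean_space set \<Rightarrow> ('x::real_normed_vector \<Rightarrow> 'd l2) \<Rightarrow>
     ('x \<Rightarrow> 'x \<Rightarrow>\<^sub>L 'd l2) \<Rightarrow> 'x \<Rightarrow> 'x \<Rightarrow> 'd l2" where
  "proj_hessian \<Omega> \<iota> H \<phi> u = l2_proj \<Omega> (blinfun_apply (H \<phi>) (proj \<Omega> \<iota> u))"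

definition eigenspace ::
  "'d::euclidean_space set \<Rightarrow> ('x::real_normed_vector \<Rightarrow> 'd l2) \<Rightarrow> ('x \<Rightarrow> 'd l2) \<Rightarrow> real \<Rightarrow> 'x set" where
  "eigenspace \<Omega> \<iota> A \<mu> = {u \<in> mass_class \<Omega> \<iota> 0. A u = \<mu> *\<^sub>R \<iota> u}"

text \<open>
  The spectrum of \<open>A\<close>, as an operator in \<open>mean_zero \<Omega>\<close> with domain \<open>mass_class \<Omega> \<iota> 0\<close>, is the
  complement of this set; real parameters suffice because projected Hessians are symmetric.  The
  second clause, boundedness of the inverse, is automatic when \<open>'x\<close> is complete and \<open>A\<close> bounded
  from \<open>'x\<close> to L2.
\<close>

definition resolvent_set ::
  "'d::euclidean_space set \<Rightarrow> ('x::real_normed_vector \<Rightarrow> 'd l2) \<Rightarrow> ('x \<Rightarrow> 'd l2) \<Rightarrow> real set" where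
  "resolvent_set \<Omega> \<iota> A =
     {\<mu>. bij_betw (\<lambda>u. A u - \<mu> *\<^sub>R \<iota> u) (mass_class \<Omega> \<iota> 0) (mean_zero \<Omega>) \<and>
         (\<exists>C. \<forall>u\<in>mass_class \<Omega> \<iota> 0. norm u \<le> C * norm (A u - \<mu> *\<^sub>R \<iota> u))}"

definition stationary ::
  "'d::euclidean_space set \<Rightarrow> ('x::real_normed_vector \<Rightarrow> 'd l2) \<Rightarrow> ('x \<Rightarrow> 'd l2) \<Rightarrow>
     real \<Rightarrow> 'x \<Rightarrow> bool" where
  "stationary \<Omega> \<iota> G m \<phi> \<longleftrightarrow> \<phi> \<in> mass_class \<Omega> \<iota> m \<and> l2_proj \<Omega> (G \<phi>) = 0"

text \<open>
  Positivity is required of all remaining points of the spectrum.  If the spectrum is discrete,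
  as for elliptic operators on a bounded domain, these are the remaining eigenvalues; in general
  a condition on eigenvalues alone would say nothing about a continuous spectrum and would not
  exclude degeneracy.
\<close>

definition index1_saddle ::
  "'d::euclidean_space set \<Rightarrow> ('x::real_normed_vector \<Rightarrow> 'd l2) \<Rightarrow> ('x \<Rightarrow> 'd l2) \<Rightarrow>
     ('x \<Rightarrow> 'x \<Rightarrow>\<^sub>L 'd l2) \<Rightarrow> real \<Rightarrow> 'x \<Rightarrow> bool" where
  "index1_saddle \<Omega> \<iota> G H m \<phi> \<longleftrightarrow>
     stationary \<Omega> \<iota> G m \<phi> \<and>
     (\<exists>\<nu><0. dim (eigenspace \<Omega> \<iota> (proj_hessian \<Omega> \<iota> H \<phi>) \<nu>) = 1 \<and>
        (\<forall>\<mu>. \<mu> \<notin> resolvent_set \<Omega> \<iota> (proj_hessian \<Omega> \<iota> H \<phi>) \<and> \<mu> \<noteq> \<nu> \<longrightarrow> 0 < \<mu>))"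

definition is_min_direction ::
  "'d::euclidean_space set \<Rightarrow> ('x::real_normed_vector \<Rightarrow> 'd l2) \<Rightarrow>
     ('x \<Rightarrow> 'x \<Rightarrow>\<^sub>L 'd l2) \<Rightarrow> 'x \<Rightarrow> 'x \<Rightarrow> bool" where
  "is_min_direction \<Omega> \<iota> H \<phi> =
     is_arg_min (\<lambda>u. inner (\<iota> u) (proj_hessian \<Omega> \<iota> H \<phi> u))
       (\<lambda>u. u \<in> mass_class \<Omega> \<iota> 0 \<and> norm (\<iota> u) = 1)"

definition aux_functional ::
  "('x::real_normed_vector \<Rightarrow> 'd::euclidean_space l2) \<Rightarrow> ('x \<Rightarrow> real) \<Rightarrow> 'x \<Rightarrow> 'x \<Rightarrow> 'x \<Rightarrow> real" where
  "aux_functional \<iota> F \<phi> v \<psi> = F \<psi> - 2 * F (\<phi> + inner (\<iota> v) (\<iota> (\<psi> - \<phi>)) *\<^sub>R v)"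

definition strictly_convex_on :: "'x::real_vector set \<Rightarrow> ('x \<Rightarrow> real) \<Rightarrow> bool" where
  "strictly_convex_on S f \<longleftrightarrow> convex S \<and>
     (\<forall>x\<in>S. \<forall>y\<in>S. \<forall>t. x \<noteq> y \<and> 0 < t \<and> t < 1 \<longrightarrow>
        f ((1 - t) *\<^sub>R x + t *\<^sub>R y) < (1 - t) * f x + t * f y)"

end

theory Submission
  imports Defs
begin

text \<open>
  Fix a base point \<open>\<phi>\<close> near the saddle \<open>\<phi>s\<close>.  A minimizer \<open>\<psi>\<close> of the auxiliary functional solves
  \<open>P \<nabla>L = P (G \<psi> - 2 \<langle>G (\<phi> + \<langle>v, \<psi> - \<phi>\<rangle> v), v\<rangle> v) = 0\<close> with \<open>v\<close> the minimal direction at \<open>\<phi>\<close>.  At the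
  saddle the linearization of this equation in \<open>\<psi>\<close> is the projected Hessian with its negative
  eigenvalue \<open>\<nu>\<close> replaced by \<open>- \<nu>\<close>, a positive invertible operator.  Everything follows from the
  implicit function theorem, provided that the minimal direction exists near \<open>\<phi>s\<close> and depends well on \<open>\<phi>\<close>, and
  that positivity of the Hessian persists near \<open>\<phi>s\<close>.

  Positivity at the saddle has to be extracted from the assumptions on the spectrum
  (\<open>simple_negative_eigenvalue_nonneg_complement\<close>, \<open>flip_negative_eigenvalue\<close>).  The inverse of the
  projected Hessian is a bounded symmetric operator; the infimum of its numerical range is a
  spectral value, and the spectral gap around the simple negative eigenvalue separates it from the rest.

  Persistence is delicate because the Hessian may be an unbounded operator in L2: it depends continuously
  on \<open>\<phi>\<close> as an operator from the function space \<open>'x\<close> to L2, and there the quadratic form does not control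
  the norm of \<open>'x\<close>.  Krein's argument (\<open>form_bound_of_operator_bound\<close>) closes this gap: a symmetric
  perturbation that is small relative to a positive symmetric operator \<open>B\<close> as an operator is also small relative to
  \<open>B\<close> as a quadratic form.  The same fact shows that the eigenvector produced by the implicit function theorem
  (\<open>eigen_branch\<close>) is the minimal direction, unique up to sign (\<open>min_dir_eigenvector\<close>).

  The derivative of the minimizer map \<open>\<Phi>\<close> vanishes at the saddle because \<open>P \<nabla>L\<close> at \<open>\<psi> = \<phi>s\<close> is
  \<open>- 2 \<langle>G (\<phi>s + w), v\<rangle> v\<close> with \<open>w\<close> orthogonal to \<open>v\<close>, whose first-order term \<open>\<langle>H \<phi> w, v\<rangle>\<close> is zero as \<open>v\<close>
  is an eigenvector (\<open>newton_eq_at_saddle\<close>).  Therefore \<open>|\<Phi> \<phi> - \<phi>s|\<close> is bounded by the oscillation of \<open>H\<close> times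
  \<open>|\<phi> - \<phi>s|\<close>, which gives the derivative zero, lets a ball be mapped into itself, and is quadratic once \<open>H\<close> is
  differentiable.  At a fixed point, \<open>P \<nabla>L\<close> is the projected gradient of \<open>F\<close> reflected in the hyperplane
  orthogonal to \<open>v\<close>, so fixed points are stationary.
\<close>

section \<open>Symmetric operators and semidefinite forms\<close>

text \<open>
  Log-convexity makes the ratios \<open>a (n + 1) / a n\<close> increase, so a first ratio above \<open>r\<close> would force
  growth faster than \<open>r ^ n\<close>.
\<close>

lemma log_convex_geometric_bound:
  fixes a :: "nat \<Rightarrow> real"
  assumes nonneg: "\<And>n. 0 \<le> a n"
    and log_convex: "\<And>n. (a (Suc n))\<^sup>2 \<le> a n * a (Suc (Suc n))"
    and bound: "\<And>n. a n \<le> M * r ^ n" and "0 < r"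
  shows "a 1 \<le> r * a 0"
proof (rule ccontr)
  assume "\<not> a 1 \<le> r * a 0"
  then have less: "r * a 0 < a 1" by simp
  have pos0: "0 < a 0"
  proof (rule ccontr)
    assume "\<not> 0 < a 0"
    then have "a 0 = 0" using nonneg[of 0] by simp
    then show False using log_convex[of 0] less by simp
  qed
  define s where "s = a 1 / a 0"
  have s: "r < s" using less pos0 by (simp add: s_def field_simps)
  have "0 < s" using s \<open>0 < r\<close> by simp
  have step: "0 < a n \<and> s * a n \<le> a (Suc n)" for n
  proof (induction n)
    case 0
    show ?case using pos0 by (simp add: s_def)
  next
    case (Suc n)
    then have pos: "0 < a (Suc n)" using \<open>0 < s\<close> mult_pos_pos[of s "a n"] by linarith
    have "(s * a n) * a (Suc n) \<le> (a (Suc n))\<^sup>2"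
      using Suc pos by (simp add: power2_eq_square)
    also have "\<dots> \<le> a n * a (Suc (Suc n))" by (rule log_convex)
    finally have "a n * (s * a (Suc n)) \<le> a n * a (Suc (Suc n))" by (simp add: algebra_simps)
    then show ?case using Suc pos by simp
  qed
  have grow: "a 0 * s ^ n \<le> a n" for n
  proof (induction n)
    case (Suc n)
    have "a 0 * s ^ Suc n = s * (a 0 * s ^ n)" by simp
    also have "\<dots> \<le> s * a n" using Suc \<open>0 < s\<close> by (intro mult_left_mono) auto
    also have "\<dots> \<le> a (Suc n)" using step by blast
    finally show ?case .
  qed simp
  obtain n where n: "M / a 0 < (s / r) ^ n"
    using real_arch_pow[of "s / r" "M / a 0"] s \<open>0 < r\<close> by auto
  then have "M * r ^ n < a 0 * s ^ n"
    using pos0 \<open>0 < r\<close> by (simp add: field_simps)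
  then show False using grow[of n] bound[of n] by simp
qed

lemma discriminant_bound:
  fixes a b c :: real
  assumes "\<And>t. 0 \<le> a + 2 * t * b + t\<^sup>2 * c"
  shows "b\<^sup>2 \<le> a * c"
proof (cases "c = 0")
  case True
  have "b = 0"
  proof (rule ccontr)
    assume "b \<noteq> 0"
    then show False using assms[of "- (a + 1) / (2 * b)"] True by (simp add: field_simps)
  qed
  then show ?thesis using True by simp
next
  case False
  have "0 \<le> c"
  proof (rule ccontr)
    assume "\<not> 0 \<le> c"
    define t where "t = (1 + \<bar>a\<bar> + 2 * \<bar>b\<bar>) / \<bar>c\<bar> + 1"
    have c: "c = - \<bar>c\<bar>" "\<bar>c\<bar> > 0" using \<open>\<not> 0 \<le> c\<close> by auto
    have t1: "t \<ge> 1" "t * \<bar>c\<bar> \<ge> 1 + \<bar>a\<bar> + 2 * \<bar>b\<bar>"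
      using c by (auto simp: t_def field_simps)
    have "t * (t * \<bar>c\<bar>) \<ge> t * (1 + \<bar>a\<bar> + 2 * \<bar>b\<bar>)" using t1 by (intro mult_left_mono) auto
    then have "t * (t * \<bar>c\<bar>) \<ge> t + t * \<bar>a\<bar> + 2 * (t * \<bar>b\<bar>)" by (simp add: algebra_simps)
    moreover have "t * \<bar>a\<bar> \<ge> \<bar>a\<bar>" using t1 mult_right_mono[of 1 t "\<bar>a\<bar>"] by simp
    moreover have "t * b \<le> t * \<bar>b\<bar>" using t1 by (intro mult_left_mono) auto
    moreover have "t\<^sup>2 * c = - (t * (t * \<bar>c\<bar>))" using c(1) by (simp add: power2_eq_square)
    moreover have "0 \<le> a + 2 * (t * b) + t\<^sup>2 * c" using assms[of t] by (simp add: mult.assoc)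
    moreover have "a \<le> \<bar>a\<bar>" by simp
    ultimately show False using t1(1) by linarith
  qed
  then have "c > 0" using False by simp
  then show ?thesis using assms[of "- b / c"] by (simp add: field_simps power2_eq_square)
qed

lemma cauchy_schwarz_semidefinite:
  fixes B j :: "'v::real_vector \<Rightarrow> 'e::real_inner"
  assumes "linear B" "linear j" "subspace V"
    and sym: "\<And>u w. u \<in> V \<Longrightarrow> w \<in> V \<Longrightarrow> inner (B u) (j w) = inner (j u) (B w)"
    and nonneg: "\<And>u. u \<in> V \<Longrightarrow> 0 \<le> inner (B u) (j u)"
    and "u \<in> V" "w \<in> V"
  shows "(inner (B u) (j w))\<^sup>2 \<le> inner (B u) (j u) * inner (B w) (j w)"
proof (rule discriminant_bound)
  fix t :: real
  have "u + t *\<^sub>R w \<in> V" using assms by (auto simp: subspace_def)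
  from nonneg[OF this]
  have "0 \<le> inner (B u) (j u) + t * inner (B u) (j w) + t * inner (B w) (j u) + t * t * inner (B w) (j w)"
    using assms(1,2) by (simp add: linear_add linear_scale inner_add algebra_simps)
  moreover have "inner (B w) (j u) = inner (B u) (j w)"
    using sym[OF \<open>w \<in> V\<close> \<open>u \<in> V\<close>] by (simp add: inner_commute)
  ultimately show "0 \<le> inner (B u) (j u) + 2 * t * inner (B u) (j w) + t\<^sup>2 * inner (B w) (j w)"
    by (simp add: power2_eq_square)
qed

lemma power2_norm_add_scaleR:
  fixes x y :: "'e::real_inner"
  shows "(norm (x + t *\<^sub>R y))\<^sup>2 = (norm x)\<^sup>2 + 2 * t * inner x y + t\<^sup>2 * (norm y)\<^sup>2"
  unfolding power2_norm_eq_inner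
  by (simp add: inner_add inner_commute algebra_simps power2_eq_square)

text \<open>
  The infimum of the numerical range of a symmetric operator is an approximate eigenvalue.  So a
  lower bound for the form follows once \<open>T - s\<close> is bounded below for every smaller \<open>s\<close>.
\<close>

lemma numerical_range_bound:
  fixes T :: "'e::real_inner \<Rightarrow> 'e"
  assumes T: "bounded_linear T" and Y: "subspace Y" and TY: "\<And>y. y \<in> Y \<Longrightarrow> T y \<in> Y"
    and sym: "\<And>y z. y \<in> Y \<Longrightarrow> z \<in> Y \<Longrightarrow> inner (T y) z = inner y (T z)"
    and below: "\<And>s. s < b \<Longrightarrow> \<exists>c>0. \<forall>y\<in>Y. c * norm y \<le> norm (T y - s *\<^sub>R y)"
    and y: "y \<in> Y"
  shows "b * (norm y)\<^sup>2 \<le> inner (T y) y"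
proof (rule ccontr)
  assume neg: "\<not> b * (norm y)\<^sup>2 \<le> inner (T y) y"
  interpret T: bounded_linear T by fact
  have y0: "y \<noteq> 0" using neg by (auto simp: T.zero)
  obtain K where K: "0 < K" "\<And>y. norm (T y) \<le> norm y * K" using T.pos_bounded by blast
  define R where "R = {inner (T y) y |y. y \<in> Y \<and> norm y = 1}"
  define m where "m = Inf R"
  have normalize: "inner (T x) x / (norm x)\<^sup>2 \<in> R" if "x \<in> Y" "x \<noteq> 0" for x
    unfolding R_def
    by (rule CollectI, rule exI[of _ "x /\<^sub>R norm x"])
       (use that Y in \<open>auto simp: T.scaleR subspace_def power2_eq_square field_simps\<close>)
  have bdd: "bdd_below R"
  proof (rule bdd_belowI[of _ "- K"])
    fix r assume "r \<in> R"
    then obtain x where x: "r = inner (T x) x" "norm x = 1" by (auto simp: R_def)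
    have "\<bar>inner (T x) x\<bar> \<le> K"
      using Cauchy_Schwarz_ineq2[of "T x" x] K(2)[of x] x by simp
    then show "- K \<le> r" using x by simp
  qed
  have m_le: "m * (norm x)\<^sup>2 \<le> inner (T x) x" if "x \<in> Y" for x
  proof (cases "x = 0")
    case False
    then have "m \<le> inner (T x) x / (norm x)\<^sup>2"
      unfolding m_def using bdd normalize that by (intro cInf_lower)
    then show ?thesis using False by (simp add: field_simps)
  qed (simp add: T.zero)
  have "m \<le> inner (T y) y / (norm y)\<^sup>2"
    using m_le[OF y] y0 by (simp add: field_simps)
  also have "\<dots> < b" using neg y0 by (simp add: field_simps)
  finally have "m < b" .
  then obtain c where c: "0 < c" "\<And>y. y \<in> Y \<Longrightarrow> c * norm y \<le> norm (T y - m *\<^sub>R y)"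
    using below by blast
  \<comment> \<open>\<open>N\<close> is positive semidefinite, so Cauchy-Schwarz for its form makes \<open>N x\<close> small at an almost
    minimizing \<open>x\<close>, although \<open>N\<close> is bounded below by \<open>c\<close>.\<close>
  define N where "N = (\<lambda>x. T x - m *\<^sub>R x)"
  have N_lin: "linear N" unfolding N_def
    by (rule linearI) (auto simp: T.add T.scaleR algebra_simps)
  have NY: "N x \<in> Y" if "x \<in> Y" for x
    using that Y TY by (auto simp: N_def subspace_diff subspace_scale)
  define K' where "K' = K + \<bar>m\<bar>"
  have K': "0 < K'" using K by (simp add: K'_def)
  have N_bd: "norm (N x) \<le> K' * norm x" for x
    using norm_triangle_ineq4[of "T x" "m *\<^sub>R x"] K(2)[of x] by (simp add: N_def K'_def algebra_simps)
  have "R \<noteq> {}" using normalize[OF y y0] by blast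
  moreover have "m < m + c\<^sup>2 / (2 * K')" using c K' by simp
  ultimately obtain r where "r \<in> R" "r < m + c\<^sup>2 / (2 * K')"
    unfolding m_def by (meson cInf_lessD)
  then obtain x where x: "x \<in> Y" "norm x = 1" "inner (T x) x < m + c\<^sup>2 / (2 * K')"
    by (auto simp: R_def)
  have Nx: "inner (N x) x < c\<^sup>2 / (2 * K')"
    using x by (simp add: N_def inner_diff_left power2_norm_eq_inner[symmetric])
  have z: "c \<le> norm (N x)" using c(2)[OF x(1)] x by (simp add: N_def)
  have "(inner (N x) (N x))\<^sup>2 \<le> inner (N x) x * inner (N (N x)) (N x)"
  proof (rule cauchy_schwarz_semidefinite[OF N_lin linear_id Y, unfolded id_def])
    show "inner (N u) w = inner u (N w)" if "u \<in> Y" "w \<in> Y" for u w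
      using sym[OF that] by (simp add: N_def inner_diff)
    show "0 \<le> inner (N u) u" if "u \<in> Y" for u
      using m_le[OF that] by (simp add: N_def inner_diff_left power2_norm_eq_inner)
  qed (use x NY in auto)
  also have "\<dots> \<le> c\<^sup>2 / (2 * K') * (K' * (norm (N x))\<^sup>2)"
  proof (rule mult_mono)
    show "inner (N (N x)) (N x) \<le> K' * (norm (N x))\<^sup>2"
      using order_trans[OF norm_cauchy_schwarz mult_right_mono[OF N_bd[of "N x"], of "norm (N x)"]]
      by (simp add: power2_eq_square mult.assoc)
    show "0 \<le> inner (N (N x)) (N x)"
      using m_le[OF NY[OF x(1)]] by (simp add: N_def inner_diff_left power2_norm_eq_inner)
  qed (use Nx c K' in auto)
  also have "\<dots> = c\<^sup>2 / 2 * (norm (N x))\<^sup>2" using K' by simp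
  finally have "(norm (N x))\<^sup>2 * (norm (N x))\<^sup>2 \<le> c\<^sup>2 / 2 * (norm (N x))\<^sup>2"
    by (simp add: dot_square_norm power2_eq_square mult.assoc)
  moreover have "0 < (norm (N x))\<^sup>2" using z c by auto
  ultimately have "(norm (N x))\<^sup>2 \<le> c\<^sup>2 / 2" by (metis mult_le_cancel_right_pos)
  moreover have "c\<^sup>2 \<le> (norm (N x))\<^sup>2" using z c by (intro power_mono) auto
  ultimately have "c\<^sup>2 \<le> c\<^sup>2 / 2" by linarith
  then show False using c(1) by (simp add: power2_eq_square)
qed

text \<open>
  The inequality \<open>|S y|\<^sup>2 \<ge> d \<langle>S y, y\<rangle>\<close> says that the spectrum of \<open>S\<close> avoids the interval between
  \<open>0\<close> and \<open>d\<close>.  On the range of \<open>S\<close> it gives coercivity directly.  The orthogonal complement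
  of the kernel is reached by iterating \<open>1 - S / M\<close>, which fixes the kernel and contracts the range: the
  iterates of \<open>y\<close> converge to a kernel element orthogonal to the kernel, hence to zero, and \<open>y\<close> minus an
  iterate lies in the range.
\<close>

lemma coercive_off_kernel:
  fixes S :: "'e::real_inner \<Rightarrow> 'e"
  assumes S: "bounded_linear S" and Y: "subspace Y" and complete: "complete Y"
    and SY: "\<And>y. y \<in> Y \<Longrightarrow> S y \<in> Y"
    and sym: "\<And>y z. y \<in> Y \<Longrightarrow> z \<in> Y \<Longrightarrow> inner (S y) z = inner y (S z)"
    and nonneg: "\<And>y. y \<in> Y \<Longrightarrow> 0 \<le> inner (S y) y"
    and "0 < d" and gap: "\<And>y. y \<in> Y \<Longrightarrow> d * inner (S y) y \<le> (norm (S y))\<^sup>2"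
    and y: "y \<in> Y" and kernel: "\<And>w. w \<in> Y \<Longrightarrow> S w = 0 \<Longrightarrow> inner w y = 0"
  shows "d * (norm y)\<^sup>2 \<le> inner (S y) y"
proof -
  interpret S: bounded_linear S by fact
  obtain K where K: "0 < K" "\<And>y. norm (S y) \<le> norm y * K" using S.pos_bounded by blast
  define M where "M = K + d"
  have M: "0 < M" "d < M" "\<And>y. norm (S y) \<le> M * norm y"
    using K \<open>0 < d\<close> by (auto simp: M_def algebra_simps intro: order_trans[OF K(2)])
  have cs: "(inner (S u) w)\<^sup>2 \<le> inner (S u) u * inner (S w) w" if "u \<in> Y" "w \<in> Y" for u w
    by (rule cauchy_schwarz_semidefinite[OF S.linear_axioms linear_id Y, unfolded id_def])
       (use sym nonneg that in auto)
  have upper: "(norm (S z))\<^sup>2 \<le> M * inner (S z) z" if z: "z \<in> Y" for z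
  proof (cases "S z = 0")
    case False
    have "(inner (S z) (S z))\<^sup>2 \<le> inner (S z) z * inner (S (S z)) (S z)"
      using cs z SY by blast
    also have "\<dots> \<le> inner (S z) z * (M * (norm (S z))\<^sup>2)"
      using order_trans[OF norm_cauchy_schwarz mult_right_mono[OF M(3)[of "S z"], of "norm (S z)"]] nonneg[OF z]
      by (intro mult_left_mono) (auto simp: power2_eq_square mult.assoc)
    finally have "(norm (S z))\<^sup>2 * (norm (S z))\<^sup>2 \<le> (M * inner (S z) z) * (norm (S z))\<^sup>2"
      by (simp add: dot_square_norm power2_eq_square mult.assoc mult.left_commute)
    moreover have "0 < (norm (S z))\<^sup>2" using False by simp
    ultimately show ?thesis by (metis mult_le_cancel_right_pos)
  qed (simp add: nonneg z M less_imp_le)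
  have lower: "d * (norm (S x))\<^sup>2 \<le> inner (S (S x)) (S x)" if x: "x \<in> Y" for x
  proof (cases "S x = 0")
    case False
    have "(inner (S x) (S x))\<^sup>2 \<le> inner (S x) x * inner (S (S x)) (S x)"
      using cs x SY by blast
    then have sq: "(norm (S x))\<^sup>2 * (norm (S x))\<^sup>2 \<le> inner (S x) x * inner (S (S x)) (S x)"
      by (simp add: dot_square_norm power2_eq_square)
    have "d * ((norm (S x))\<^sup>2 * (norm (S x))\<^sup>2) \<le> d * (inner (S x) x * inner (S (S x)) (S x))"
      using sq \<open>0 < d\<close> by (intro mult_left_mono) auto
    also have "\<dots> \<le> (norm (S x))\<^sup>2 * inner (S (S x)) (S x)"
      using gap[OF x] nonneg[OF SY[OF x]] by (metis mult.assoc mult_right_mono)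
    finally have "(norm (S x))\<^sup>2 * (d * (norm (S x))\<^sup>2) \<le> (norm (S x))\<^sup>2 * inner (S (S x)) (S x)"
      by (simp add: mult.left_commute)
    moreover have "0 < (norm (S x))\<^sup>2" using False by simp
    ultimately show ?thesis by (metis mult_le_cancel_left_pos)
  qed (simp add: S.zero)
  define R where "R = (\<lambda>z. z - (1 / M) *\<^sub>R S z)"
  define \<rho> where "\<rho> = sqrt (1 - d / M)"
  have \<rho>: "0 \<le> \<rho>" "\<rho> < 1" using M \<open>0 < d\<close> by (auto simp: \<rho>_def field_simps)
  have contr: "norm (R (S x)) \<le> \<rho> * norm (S x)" if x: "x \<in> Y" for x
  proof (rule power2_le_imp_le)
    let ?z = "S x"
    have "(norm (R ?z))\<^sup>2 = (norm ?z)\<^sup>2 - 2 / M * inner (S ?z) ?z + (norm (S ?z))\<^sup>2 / M\<^sup>2"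
      using power2_norm_add_scaleR[of ?z "- (1 / M)" "S ?z"]
      by (simp add: R_def inner_commute power_divide)
    also have "(norm (S ?z))\<^sup>2 / M\<^sup>2 \<le> 1 / M * inner (S ?z) ?z"
      using upper[OF SY[OF x]] M by (simp add: field_simps power2_eq_square)
    also have "(norm ?z)\<^sup>2 - 2 / M * inner (S ?z) ?z + 1 / M * inner (S ?z) ?z
        = (norm ?z)\<^sup>2 - 1 / M * inner (S ?z) ?z" by (simp add: algebra_simps)
    also have "\<dots> \<le> (norm ?z)\<^sup>2 - d / M * (norm ?z)\<^sup>2"
      using lower[OF x] M by (simp add: divide_right_mono)
    also have "\<dots> = (\<rho> * norm ?z)\<^sup>2"
      using M by (simp add: \<rho>_def power_mult_distrib algebra_simps)
    finally show "(norm (R ?z))\<^sup>2 \<le> (\<rho> * norm ?z)\<^sup>2" by simp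
  qed (use \<rho> in auto)
  have RY: "R z \<in> Y" if "z \<in> Y" for z
    using that Y SY by (auto simp: R_def subspace_diff subspace_scale)
  have SR: "S (R z) = R (S z)" for z by (simp add: R_def S.diff S.scaleR)
  define z where "z n = (R ^^ n) y" for n
  have zY: "z n \<in> Y" for n
    by (induction n) (use y RY in \<open>auto simp: z_def\<close>)
  have z_Suc: "z (Suc n) = z n - (1 / M) *\<^sub>R S (z n)" for n
    by (simp add: z_def R_def)
  have Sz: "norm (S (z n)) \<le> \<rho> ^ n * norm (S y)" for n
  proof (induction n)
    case (Suc n)
    have "norm (S (z (Suc n))) \<le> \<rho> * norm (S (z n))"
      using contr[OF zY[of n]] SR[of "z n"] by (simp add: z_def)
    also have "\<dots> \<le> \<rho> * (\<rho> ^ n * norm (S y))" using Suc \<rho> by (intro mult_left_mono) auto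
    finally show ?case by (simp add: mult.assoc)
  qed (simp add: z_def)
  define q where "q = norm (S y) / (M * (1 - \<rho>))"
  have q: "0 \<le> q" "norm (S y) / M = q * (1 - \<rho>)" using M \<rho> by (auto simp: q_def)
  have tail: "norm (z (n + k) - z n) \<le> \<rho> ^ n * q * (1 - \<rho> ^ k)" for n k
  proof (induction k)
    case (Suc k)
    have "norm (z (n + Suc k) - z n) \<le> norm (z (n + k) - z n) + norm ((1 / M) *\<^sub>R S (z (n + k)))"
      using norm_triangle_ineq4[of "z (n + k) - z n" "(1 / M) *\<^sub>R S (z (n + k))"]
      by (simp add: z_Suc algebra_simps)
    also have "norm ((1 / M) *\<^sub>R S (z (n + k))) \<le> \<rho> ^ (n + k) * (norm (S y) / M)"
      using Sz[of "n + k"] M by (simp add: divide_right_mono)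
    also have "\<dots> = \<rho> ^ n * q * (\<rho> ^ k - \<rho> ^ Suc k)"
      by (simp add: q power_add algebra_simps)
    finally show ?case using Suc by (simp add: algebra_simps)
  qed simp
  have "Cauchy z"
  proof (rule metric_CauchyI)
    fix e :: real assume "0 < e"
    have "(\<lambda>n. \<rho> ^ n * (2 * q)) \<longlonglongrightarrow> 0 * (2 * q)"
      using \<rho> by (intro tendsto_intros LIMSEQ_power_zero) auto
    then have "eventually (\<lambda>n. \<rho> ^ n * (2 * q) < e) sequentially"
      using \<open>0 < e\<close> by (auto intro: order_tendstoD)
    then obtain N where N: "\<rho> ^ N * (2 * q) < e" by (auto simp: eventually_sequentially)
    have near: "norm (z n - z N) \<le> \<rho> ^ N * q" if "N \<le> n" for n
    proof -
      have "\<rho> ^ N * q * (1 - \<rho> ^ (n - N)) \<le> \<rho> ^ N * q * 1"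
        using \<rho> q by (intro mult_left_mono) auto
      then show ?thesis using tail[of N "n - N"] that by simp
    qed
    have "dist (z a) (z b) < e" if "N \<le> a" "N \<le> b" for a b
    proof -
      have "dist (z a) (z b) \<le> norm (z a - z N) + norm (z b - z N)"
        by (metis dist_norm dist_triangle2 dist_commute)
      then show ?thesis using near[OF that(1)] near[OF that(2)] N by simp
    qed
    then show "\<exists>N. \<forall>a\<ge>N. \<forall>b\<ge>N. dist (z a) (z b) < e" by blast
  qed
  then obtain w where w: "w \<in> Y" "z \<longlonglongrightarrow> w"
    using complete zY by (auto simp: complete_def)
  have Sz0: "(\<lambda>n. S (z n)) \<longlonglongrightarrow> 0"
  proof (rule tendsto_norm_zero_cancel, rule tendsto_sandwich[of "\<lambda>_. 0"])
    show "(\<lambda>n. \<rho> ^ n * norm (S y)) \<longlonglongrightarrow> 0"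
      using \<rho> by (intro tendsto_mult_left_zero LIMSEQ_power_zero) auto
  qed (use Sz in auto)
  moreover have Szw: "(\<lambda>n. S (z n)) \<longlonglongrightarrow> S w" using w(2) by (rule S.tendsto)
  ultimately have Sw: "S w = 0" by (rule LIMSEQ_unique[symmetric])
  have wz: "inner w (z n) = 0" for n
  proof (induction n)
    case 0
    show ?case using kernel[OF w(1) Sw] by (simp add: z_def)
  next
    case (Suc n)
    have "inner w (S (z n)) = 0" using sym[OF w(1) zY[of n]] Sw by simp
    then show ?case using Suc by (simp add: z_Suc inner_diff_right)
  qed
  have "(\<lambda>n. inner w (z n)) \<longlonglongrightarrow> inner w w" using w(2) by (intro tendsto_intros)
  then have "(\<lambda>_::nat. 0) \<longlonglongrightarrow> inner w w" by (simp only: wz)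
  then have "inner w w = 0" by (metis LIMSEQ_unique tendsto_const)
  then have z0: "z \<longlonglongrightarrow> 0" using w by simp
  have range: "\<exists>x\<in>Y. y - z n = S x" for n
  proof (induction n)
    case 0
    show ?case using Y by (auto simp: z_def S.zero subspace_0 intro!: bexI[of _ 0])
  next
    case (Suc n)
    then obtain x where x: "x \<in> Y" "y - z n = S x" by blast
    have "y - z (Suc n) = S (x + (1 / M) *\<^sub>R z n)"
      using x by (simp add: z_Suc S.add S.scaleR algebra_simps)
    moreover have "x + (1 / M) *\<^sub>R z n \<in> Y" using Y x zY by (intro subspace_add subspace_scale)
    ultimately show ?case by blast
  qed
  have ineq: "d * (norm (y - z n))\<^sup>2 \<le> inner (S (y - z n)) (y - z n)" for n
    using range[of n] lower by auto
  have "(\<lambda>n. d * (norm (y - z n))\<^sup>2) \<longlonglongrightarrow> d * (norm (y - 0))\<^sup>2"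
    by (intro tendsto_intros z0)
  moreover have "(\<lambda>n. inner (S (y - z n)) (y - z n)) \<longlonglongrightarrow> inner (S (y - 0)) (y - 0)"
    by (intro tendsto_inner S.tendsto tendsto_diff tendsto_const z0)
  ultimately show ?thesis using ineq by (auto intro: LIMSEQ_le)
qed

section \<open>Isomorphisms between the constrained subspaces\<close>

text \<open>
  The abstract setting: \<open>X0\<close> and \<open>Y\<close> below stand for the mean-zero functions in \<open>'x\<close> and in L2, and
  \<open>p\<close> and \<open>Q\<close> for the projections onto them.  Operators such as the projected Hessian map \<open>X0\<close> to \<open>Y\<close>;
  they are bounded from \<open>'x\<close> to L2, but as operators in L2 they may be unbounded.
\<close>

locale constrained_embedding =
  fixes \<iota> :: "'x::banach \<Rightarrow> 'e::real_inner" and p :: "'x \<Rightarrow> 'x" and Q :: "'e \<Rightarrow> 'e"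
  assumes bounded_linear_embed: "bounded_linear \<iota>" and inj_embed: "inj \<iota>"
    and bounded_linear_p: "bounded_linear p" and p_idem: "p (p u) = p u"
    and bounded_linear_Q: "bounded_linear Q" and Q_idem: "Q (Q y) = Q y"
    and Q_sym: "inner (Q a) b = inner a (Q b)"
    and embed_p: "\<iota> (p u) = Q (\<iota> u)"
begin

sublocale embed: bounded_linear \<iota> by (rule bounded_linear_embed)
sublocale p: bounded_linear p by (rule bounded_linear_p)
sublocale Q: bounded_linear Q by (rule bounded_linear_Q)

definition "X0 = {u. p u = u}"
definition "Y = {y. Q y = y}"

lemma X0_subspace: "subspace X0"
  by (auto simp: X0_def subspace_def p.zero p.add p.scaleR)

lemma Y_subspace: "subspace Y"
  by (auto simp: Y_def subspace_def Q.zero Q.add Q.scaleR)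

lemma closed_X0: "closed X0"
  unfolding X0_def
  by (rule closed_Collect_eq) (intro continuous_on_id p.continuous_on)+

lemma complete_X0: "complete X0"
  using closed_X0 by (simp add: complete_eq_closed)

lemma X0_closed_ops [simp]:
  "0 \<in> X0" "u \<in> X0 \<Longrightarrow> w \<in> X0 \<Longrightarrow> u + w \<in> X0" "u \<in> X0 \<Longrightarrow> w \<in> X0 \<Longrightarrow> u - w \<in> X0"
  "u \<in> X0 \<Longrightarrow> c *\<^sub>R u \<in> X0" "u \<in> X0 \<Longrightarrow> - u \<in> X0"
  using X0_subspace by (auto simp: subspace_0 subspace_add subspace_diff subspace_scale subspace_neg)

lemma Y_closed_ops [simp]:
  "0 \<in> Y" "u \<in> Y \<Longrightarrow> w \<in> Y \<Longrightarrow> u + w \<in> Y" "u \<in> Y \<Longrightarrow> w \<in> Y \<Longrightarrow> u - w \<in> Y"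
  "u \<in> Y \<Longrightarrow> c *\<^sub>R u \<in> Y" "u \<in> Y \<Longrightarrow> - u \<in> Y"
  using Y_subspace by (auto simp: subspace_0 subspace_add subspace_diff subspace_scale subspace_neg)

lemma p_in_X0 [simp]: "p u \<in> X0" by (simp add: X0_def p_idem)
lemma Q_in_Y [simp]: "Q y \<in> Y" by (simp add: Y_def Q_idem)
lemma p_ident [simp]: "u \<in> X0 \<Longrightarrow> p u = u" by (simp add: X0_def)
lemma Q_ident [simp]: "y \<in> Y \<Longrightarrow> Q y = y" by (simp add: Y_def)
lemma embed_in_Y [simp]: "u \<in> X0 \<Longrightarrow> \<iota> u \<in> Y" by (metis embed_p Q_in_Y p_ident)

lemma inner_Q [simp]: "y \<in> Y \<Longrightarrow> inner (Q a) y = inner a y"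
  by (simp add: Q_sym)
lemma inner_Q' [simp]: "y \<in> Y \<Longrightarrow> inner y (Q a) = inner y a"
  by (metis inner_Q inner_commute)

lemma norm_Q_le: "norm (Q y) \<le> norm y"
proof (cases "Q y = 0")
  case False
  have "norm (Q y) * norm (Q y) = inner y (Q y)"
    by (metis Q_idem Q_sym dot_square_norm power2_eq_square)
  also have "\<dots> \<le> norm y * norm (Q y)" by (rule norm_cauchy_schwarz)
  finally show ?thesis using False by simp
qed simp

definition iso_with :: "real \<Rightarrow> ('x \<Rightarrow> 'e) \<Rightarrow> bool" where
  "iso_with C B \<longleftrightarrow> 0 < C \<and> bounded_linear B \<and> B ` X0 = Y \<and> (\<forall>u\<in>X0. norm u \<le> C * norm (B u))"

lemma iso_withD:
  assumes "iso_with C B"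
  shows "0 < C" "bounded_linear B" "\<And>u. u \<in> X0 \<Longrightarrow> B u \<in> Y"
    "\<And>y. y \<in> Y \<Longrightarrow> \<exists>u\<in>X0. B u = y" "\<And>u. u \<in> X0 \<Longrightarrow> norm u \<le> C * norm (B u)"
proof -
  have C: "0 < C" and B: "bounded_linear B" and img: "B ` X0 = Y"
    and lower: "\<forall>u\<in>X0. norm u \<le> C * norm (B u)"
    using assms unfolding iso_with_def by simp_all
  show "0 < C" "bounded_linear B" by fact+
  show "B u \<in> Y" if "u \<in> X0" for u using img that by blast
  show "\<exists>u\<in>X0. B u = y" if "y \<in> Y" for y
  proof -
    have "y \<in> B ` X0" using img that by simp
    then show ?thesis by (rule imageE) auto
  qed
  show "norm u \<le> C * norm (B u)" if "u \<in> X0" for u using lower that by simp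
qed

lemma iso_with_inj:
  assumes "iso_with C B" "u \<in> X0" "w \<in> X0" "B u = B w"
  shows "u = w"
proof -
  interpret B: bounded_linear B using assms iso_withD by blast
  have "norm (u - w) \<le> C * norm (B (u - w))" using iso_withD(5)[OF assms(1)] assms by simp
  then show ?thesis using assms by (simp add: B.diff)
qed

text \<open>
  \<open>Y\<close> inherits completeness from the Banach space \<open>'x\<close> through \<open>B\<close>.
\<close>

lemma iso_complete_Y:
  assumes B: "iso_with C B"
  shows "complete Y"
proof (rule completeI)
  fix f :: "nat \<Rightarrow> 'e" assume f: "\<forall>n. f n \<in> Y" "Cauchy f"
  interpret B: bounded_linear B using B iso_withD by blast
  have "\<forall>n. \<exists>u. u \<in> X0 \<and> B u = f n"
    using iso_withD(4)[OF B] f(1) by blast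
  then obtain g where g: "\<And>n. g n \<in> X0" "\<And>n. B (g n) = f n"
    unfolding choice_iff by blast
  have "Cauchy g"
  proof (rule metric_CauchyI)
    fix e :: real assume "0 < e"
    then have "0 < e / C" using iso_withD(1)[OF B] by simp
    then obtain N where N: "\<And>a b. N \<le> a \<Longrightarrow> N \<le> b \<Longrightarrow> dist (f a) (f b) < e / C"
      using f(2) unfolding Cauchy_def by meson
    have "dist (g a) (g b) < e" if "N \<le> a" "N \<le> b" for a b
    proof -
      have "dist (g a) (g b) \<le> C * dist (f a) (f b)"
        using iso_withD(5)[OF B, of "g a - g b"] g by (simp add: dist_norm B.diff)
      also have "\<dots> < e" using N[OF that] iso_withD(1)[OF B] by (simp add: field_simps)
      finally show ?thesis .
    qed
    then show "\<exists>N. \<forall>a\<ge>N. \<forall>b\<ge>N. dist (g a) (g b) < e" by blast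
  qed
  then obtain l where l: "l \<in> X0" "g \<longlonglongrightarrow> l"
    using complete_X0 g(1) by (auto simp: complete_def)
  have "(\<lambda>n. B (g n)) \<longlonglongrightarrow> B l" using l(2) by (rule B.tendsto)
  then show "\<exists>l\<in>Y. f \<longlonglongrightarrow> l" using g(2) iso_withD(3)[OF B l(1)] by auto
qed

text \<open>
  Smallness of \<open>K\<close> is measured relative to \<open>B\<close>, so the fixed point iteration takes place in \<open>Y\<close>, for
  \<open>z \<mapsto> y - K (B\<^sup>-\<^sup>1 z)\<close>.
\<close>

lemma neumann_perturbation:
  assumes B: "iso_with C B" and K: "bounded_linear K" and KY: "\<And>u. u \<in> X0 \<Longrightarrow> K u \<in> Y"
    and small: "\<And>u. u \<in> X0 \<Longrightarrow> norm (K u) \<le> q * norm (B u)" and "0 \<le> q" "q < 1"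
  shows "iso_with (C / (1 - q)) (\<lambda>u. B u + K u)"
proof -
  interpret B: bounded_linear B using B iso_withD by blast
  interpret K: bounded_linear K by fact
  note B' = iso_withD[OF B]
  define R where "R y = (SOME u. u \<in> X0 \<and> B u = y)" for y
  have R: "R y \<in> X0" "B (R y) = y" if "y \<in> Y" for y
    using someI_ex[of "\<lambda>u. u \<in> X0 \<and> B u = y"] B'(4)[OF that] unfolding R_def by blast+
  have surj: "\<exists>u\<in>X0. B u + K u = y" if y: "y \<in> Y" for y
  proof -
    have "\<exists>!z. z \<in> Y \<and> y - K (R z) = z"
    proof (rule Banach_fix[OF iso_complete_Y[OF B] _ \<open>0 \<le> q\<close> \<open>q < 1\<close>])
      show "Y \<noteq> {}" using y by blast
      show "(\<lambda>z. y - K (R z)) ` Y \<subseteq> Y" using y KY R by auto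
      fix a b assume ab: "a \<in> Y" "b \<in> Y"
      have "norm (K (R b - R a)) \<le> q * norm (B (R b - R a))" using small R ab by simp
      then show "dist (y - K (R a)) (y - K (R b)) \<le> q * dist a b"
        using R ab by (simp add: dist_norm K.diff B.diff norm_minus_commute)
    qed
    then obtain z where "z \<in> Y" "y - K (R z) = z" by blast
    then show ?thesis using R[of z] by (intro bexI[of _ "R z"]) (auto simp: algebra_simps)
  qed
  have lower: "norm u \<le> C / (1 - q) * norm (B u + K u)" if u: "u \<in> X0" for u
  proof -
    have "(1 - q) * norm (B u) \<le> norm (B u + K u)"
      using norm_diff_ineq[of "B u" "K u"] small[OF u] by (simp add: algebra_simps)
    then have "norm (B u) \<le> norm (B u + K u) / (1 - q)"
      using \<open>q < 1\<close> by (simp add: field_simps)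
    then have "C * norm (B u) \<le> C * (norm (B u + K u) / (1 - q))"
      using B'(1) by (intro mult_left_mono) auto
    then show ?thesis using B'(5)[OF u] by simp
  qed
  have "(\<lambda>u. B u + K u) ` X0 = Y"
  proof
    show "(\<lambda>u. B u + K u) ` X0 \<subseteq> Y" using B'(3) KY by auto
    show "Y \<subseteq> (\<lambda>u. B u + K u) ` X0"
    proof
      fix y assume "y \<in> Y"
      from surj[OF this] show "y \<in> (\<lambda>u. B u + K u) ` X0" by blast
    qed
  qed
  moreover have "0 < C / (1 - q)" using B'(1) \<open>q < 1\<close> by simp
  moreover have "bounded_linear (\<lambda>u. B u + K u)"
    using B.bounded_linear_axioms K by (rule bounded_linear_add)
  ultimately show ?thesis unfolding iso_with_def using lower by (intro conjI ballI)
qed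

definition symmetric_form :: "('x \<Rightarrow> 'e) \<Rightarrow> bool" where
  "symmetric_form B \<longleftrightarrow> (\<forall>u\<in>X0. \<forall>w\<in>X0. inner (B u) (\<iota> w) = inner (\<iota> u) (B w))"

definition nonneg_form :: "('x \<Rightarrow> 'e) \<Rightarrow> bool" where
  "nonneg_form B \<longleftrightarrow> (\<forall>u\<in>X0. 0 \<le> inner (B u) (\<iota> u))"

lemma form_cauchy_schwarz:
  assumes "linear B" "symmetric_form B" "nonneg_form B" "u \<in> X0" "w \<in> X0"
  shows "(inner (B u) (\<iota> w))\<^sup>2 \<le> inner (B u) (\<iota> u) * inner (B w) (\<iota> w)"
  using assms
  by (intro cauchy_schwarz_semidefinite[of B \<iota> X0])
     (auto simp: embed.linear_axioms X0_subspace symmetric_form_def nonneg_form_def)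

text \<open>
  If \<open>\<langle>B u, u\<rangle> = 0\<close>, then Cauchy-Schwarz for the form gives \<open>\<langle>B u, w\<rangle> = 0\<close> for all \<open>w\<close>; take the \<open>w\<close>
  that \<open>B\<close> maps to \<open>u\<close>.
\<close>

lemma iso_positive:
  assumes B: "iso_with C B" "symmetric_form B" "nonneg_form B" and u: "u \<in> X0" "u \<noteq> 0"
  shows "0 < inner (B u) (\<iota> u)"
proof (rule ccontr)
  assume "\<not> ?thesis"
  then have z: "inner (B u) (\<iota> u) = 0"
    using B(3) u by (auto simp: nonneg_form_def intro: antisym)
  obtain w where w: "w \<in> X0" "B w = \<iota> u" using iso_withD(4)[OF B(1)] u by force
  have "linear B" using iso_withD(2)[OF B(1)] by (rule bounded_linear.linear)
  then have "(inner (B u) (\<iota> w))\<^sup>2 \<le> 0"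
    using form_cauchy_schwarz[of B u w] B u w z by simp
  then have "inner (\<iota> u) (B w) = 0" using B(2) u w by (simp add: symmetric_form_def)
  then have "\<iota> u = 0" using w by simp
  then show False using u inj_embed by (metis embed.zero injD)
qed

lemma shift_step:
  assumes B: "iso_with C B" and nonneg: "nonneg_form B" and "0 \<le> s"
  shows "\<And>u. u \<in> X0 \<Longrightarrow> norm (B u) \<le> norm (B u + s *\<^sub>R \<iota> u)"
proof -
  fix u assume u: "u \<in> X0"
  have "(norm (B u))\<^sup>2 \<le> (norm (B u + s *\<^sub>R \<iota> u))\<^sup>2"
  proof -
    show ?thesis unfolding power2_norm_add_scaleR using nonneg u \<open>0 \<le> s\<close> by (simp add: nonneg_form_def)
  qed
  then show "norm (B u) \<le> norm (B u + s *\<^sub>R \<iota> u)" by (rule power2_le_imp_le) simp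
qed

text \<open>
  Method of continuity: \<open>|B u + s u| \<ge> |B u|\<close> for a nonnegative form, so the inverses are bounded
  uniformly in \<open>s\<close> and the shift can be reached by Neumann steps of a fixed length.
\<close>

lemma iso_shift:
  assumes B: "iso_with C B" and nonneg: "nonneg_form B" and "0 \<le> s"
  shows "iso_with C (\<lambda>u. B u + s *\<^sub>R \<iota> u)"
proof -
  note B' = iso_withD[OF B]
  obtain K where K: "0 < K" "\<And>u. norm (\<iota> u) \<le> norm u * K" using embed.pos_bounded by blast
  have bl: "bounded_linear (\<lambda>u. B u + s *\<^sub>R \<iota> u)" for s
    using B'(2) embed.bounded_linear_axioms by (intro bounded_linear_intros) auto
  have lower: "norm u \<le> C * norm (B u + s *\<^sub>R \<iota> u)" if "u \<in> X0" "0 \<le> s" for u s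
    using order_trans[OF B'(5)[OF that(1)] mult_left_mono[OF shift_step[OF B nonneg that(2) that(1)], of C]] B'(1)
    by simp
  obtain n :: nat where n: "2 * s * K * C < real n" using reals_Archimedean2 by blast
  have n0: "0 < real n" using n \<open>0 \<le> s\<close> K B'(1) by (smt (verit) mult_nonneg_nonneg)
  define \<eta> where "\<eta> = s / real n"
  have \<eta>: "0 \<le> \<eta>" "\<eta> * K * C \<le> 1 / 2" using n n0 \<open>0 \<le> s\<close> by (auto simp: \<eta>_def field_simps)
  have "iso_with C (\<lambda>u. B u + (real k * \<eta>) *\<^sub>R \<iota> u)" for k
  proof (induction k)
    case 0
    then show ?case using B by simp
  next
    case (Suc k)
    have nk: "0 \<le> real k * \<eta>" using \<eta> by simp
    have "iso_with (C / (1 - 1 / 2)) (\<lambda>u. (B u + (real k * \<eta>) *\<^sub>R \<iota> u) + \<eta> *\<^sub>R \<iota> u)"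
    proof (rule neumann_perturbation[OF Suc])
      show "bounded_linear (\<lambda>u. \<eta> *\<^sub>R \<iota> u)" by (intro bounded_linear_intros embed.bounded_linear_axioms)
      fix u assume u: "u \<in> X0"
      have "norm (\<eta> *\<^sub>R \<iota> u) \<le> \<eta> * (norm u * K)" using K(2)[of u] \<eta> by (simp add: mult_left_mono)
      also have "\<dots> \<le> \<eta> * (C * norm (B u + (real k * \<eta>) *\<^sub>R \<iota> u) * K)"
        using lower[OF u nk] \<eta> K by (intro mult_left_mono mult_right_mono) auto
      also have "\<dots> = (\<eta> * K * C) * norm (B u + (real k * \<eta>) *\<^sub>R \<iota> u)" by simp
      also have "\<dots> \<le> 1 / 2 * norm (B u + (real k * \<eta>) *\<^sub>R \<iota> u)"
        using \<eta> by (intro mult_right_mono) auto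
      finally show "norm (\<eta> *\<^sub>R \<iota> u) \<le> 1 / 2 * norm (B u + (real k * \<eta>) *\<^sub>R \<iota> u)" .
    qed auto
    moreover have "(B u + (real k * \<eta>) *\<^sub>R \<iota> u) + \<eta> *\<^sub>R \<iota> u = B u + (real (Suc k) * \<eta>) *\<^sub>R \<iota> u" for u
      by (simp add: algebra_simps)
    ultimately have "iso_with (C / (1 - 1 / 2)) (\<lambda>u. B u + (real (Suc k) * \<eta>) *\<^sub>R \<iota> u)" by simp
    moreover have "0 \<le> real (Suc k) * \<eta>" using \<eta> by simp
    ultimately show ?case using lower B'(1) unfolding iso_with_def by (metis (no_types, lifting))
  qed
  from this[of n] show ?thesis using n0 by (simp add: \<eta>_def)
qed

text \<open>
  Krein's argument.  It turns a bound of operator norms into one of quadratic forms, which is what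
  makes positivity of a Hessian stable although the perturbation is small only from \<open>'x\<close> to L2 and not in
  the norm of the form.  The operator \<open>S = B\<^sup>-\<^sup>1 K\<close> is symmetric for the inner product
  \<open>\<langle>B u, w\<rangle>\<close>, hence \<open>\<langle>B S\<^sup>n u, S\<^sup>n u\<rangle>\<close> is log-convex in \<open>n\<close>; it decays like \<open>q\<^sup>2\<^sup>n\<close> because
  \<open>B S\<^sup>n u = (K B\<^sup>-\<^sup>1)\<^sup>n B u\<close>.
\<close>

lemma form_bound_of_operator_bound:
  assumes B: "iso_with C B" "symmetric_form B" "nonneg_form B"
    and K: "linear K" "symmetric_form K" and KY: "\<And>u. u \<in> X0 \<Longrightarrow> K u \<in> Y"
    and small: "\<And>u. u \<in> X0 \<Longrightarrow> norm (K u) \<le> q * norm (B u)" and "0 < q" and u: "u \<in> X0"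
  shows "\<bar>inner (K u) (\<iota> u)\<bar> \<le> q * inner (B u) (\<iota> u)"
proof -
  note B' = iso_withD[OF B(1)]
  have linB: "linear B" using B'(2) by (rule bounded_linear.linear)
  obtain L where L: "0 < L" "\<And>u. norm (\<iota> u) \<le> norm u * L" using embed.pos_bounded by blast
  define S where "S w = (SOME z. z \<in> X0 \<and> B z = K w)" for w
  have S: "S w \<in> X0" "B (S w) = K w" if "w \<in> X0" for w
    using someI_ex[of "\<lambda>z. z \<in> X0 \<and> B z = K w"] B'(4)[OF KY[OF that]] unfolding S_def by blast+
  define x where "x n = (S ^^ n) u" for n
  have x: "x n \<in> X0" for n by (induction n) (use u S in \<open>auto simp: x_def\<close>)
  have Bx: "B (x (Suc n)) = K (x n)" for n using S(2)[OF x[of n]] by (simp add: x_def)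
  define a where "a n = inner (B (x n)) (\<iota> (x n))" for n
  have nonneg: "0 \<le> a n" for n using B(3) x by (simp add: a_def nonneg_form_def)
  have cs: "(inner (B (x n)) (\<iota> (x k)))\<^sup>2 \<le> a n * a k" for n k
    unfolding a_def by (rule form_cauchy_schwarz[OF linB B(2,3) x x])
  have "a 1 \<le> q\<^sup>2 * a 0"
  proof (rule log_convex_geometric_bound)
    show "0 \<le> a n" for n by (rule nonneg)
    show "(a (Suc n))\<^sup>2 \<le> a n * a (Suc (Suc n))" for n
    proof -
      have "a (Suc n) = inner (K (x n)) (\<iota> (x (Suc n)))" by (simp add: a_def Bx)
      also have "\<dots> = inner (\<iota> (x n)) (B (x (Suc (Suc n))))"
        using K(2) x by (simp add: symmetric_form_def Bx)
      also have "\<dots> = inner (B (x n)) (\<iota> (x (Suc (Suc n))))"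
        using B(2) x by (simp add: symmetric_form_def)
      finally show ?thesis using cs[of n "Suc (Suc n)"] by simp
    qed
    have nB: "norm (B (x n)) \<le> q ^ n * norm (B u)" for n
    proof (induction n)
      case (Suc n)
      have "norm (B (x (Suc n))) \<le> q * norm (B (x n))" using small[OF x] by (simp add: Bx)
      also have "\<dots> \<le> q * (q ^ n * norm (B u))" using Suc \<open>0 < q\<close> by (intro mult_left_mono) auto
      finally show ?case by simp
    qed (simp add: x_def)
    show "a n \<le> (L * C * (norm (B u))\<^sup>2) * (q\<^sup>2) ^ n" for n
    proof -
      have "a n \<le> norm (B (x n)) * norm (\<iota> (x n))" unfolding a_def by (rule norm_cauchy_schwarz)
      also have "\<dots> \<le> norm (B (x n)) * (C * norm (B (x n)) * L)"
        using order_trans[OF L(2) mult_right_mono[OF B'(5)[OF x[of n]], of L]] L(1)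
        by (intro mult_left_mono) auto
      also have "\<dots> = L * C * (norm (B (x n)))\<^sup>2" by (simp add: power2_eq_square)
      also have "\<dots> \<le> L * C * (q ^ n * norm (B u))\<^sup>2"
        using nB[of n] L B'(1) by (intro mult_left_mono power_mono) auto
      also have "(q ^ n * norm (B u))\<^sup>2 = (norm (B u))\<^sup>2 * (q\<^sup>2) ^ n"
        by (metis mult.commute power_mult power_mult_distrib)
      finally show ?thesis by (simp only: mult.assoc)
    qed
    show "0 < q\<^sup>2" using \<open>0 < q\<close> by simp
  qed
  have "(inner (K u) (\<iota> u))\<^sup>2 \<le> a 1 * a 0"
    using cs[of 1 0] Bx[of 0] by (simp add: x_def)
  also have "\<dots> \<le> q\<^sup>2 * a 0 * a 0" using \<open>a 1 \<le> q\<^sup>2 * a 0\<close> nonneg by (intro mult_right_mono) auto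
  also have "\<dots> = (q * a 0)\<^sup>2" by (simp add: power2_eq_square)
  finally have "\<bar>inner (K u) (\<iota> u)\<bar> \<le> \<bar>q * a 0\<bar>" using abs_le_square_iff by blast
  then show ?thesis using nonneg[of 0] \<open>0 < q\<close> by (simp add: a_def x_def)
qed

end

section \<open>Flipping a simple negative eigenvalue\<close>

context constrained_embedding begin

text \<open>
  Spectral theory for the bounded symmetric operator \<open>T = A\<^sup>-\<^sup>1\<close>, whose spectrum below zero is reduced
  to \<open>\<kappa> = 1 / \<nu>\<close>.  Numerical range bounds for \<open>T\<close> and for \<open>(T - \<kappa> / 2)\<^sup>2\<close> show that \<open>S = T - \<kappa>\<close> is
  nonnegative with a spectral gap \<open>- \<kappa>\<close> above zero.  Its kernel is the line of the eigenvector, so on the orthogonal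
  complement \<open>S \<ge> - \<kappa>\<close>, that is \<open>T \<ge> 0\<close>.
\<close>

lemma simple_negative_eigenvalue_nonneg_complement:
  assumes A: "bounded_linear A" "symmetric_form A"
    and res: "\<And>\<mu>. \<mu> \<le> 0 \<Longrightarrow> \<mu> \<noteq> \<nu> \<Longrightarrow> \<exists>C. iso_with C (\<lambda>u. A u - \<mu> *\<^sub>R \<iota> u)"
    and "\<nu> < 0" and v0: "v0 \<in> X0" "A v0 = \<nu> *\<^sub>R \<iota> v0"
    and simple: "\<And>u. u \<in> X0 \<Longrightarrow> A u = \<nu> *\<^sub>R \<iota> u \<Longrightarrow> \<exists>c. u = c *\<^sub>R v0"
    and u: "u \<in> X0" "inner (\<iota> u) (\<iota> v0) = 0"
  shows "0 \<le> inner (A u) (\<iota> u)"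
proof -
  interpret A: bounded_linear A by fact
  obtain C where "iso_with C (\<lambda>u. A u - 0 *\<^sub>R \<iota> u)" using res[of 0] \<open>\<nu> < 0\<close> by auto
  then have isoA: "iso_with C A" by simp
  note A' = iso_withD[OF isoA]
  obtain KA where KA: "0 < KA" "\<And>u. norm (A u) \<le> norm u * KA" using A.pos_bounded by blast
  obtain L where L: "0 < L" "\<And>u. norm (\<iota> u) \<le> norm u * L" using embed.pos_bounded by blast
  have symA: "inner (A a) (\<iota> b) = inner (\<iota> a) (A b)" if "a \<in> X0" "b \<in> X0" for a b
    using A(2) that by (simp add: symmetric_form_def)
  define R where "R y = (SOME u. u \<in> X0 \<and> A u = Q y)" for y
  have R: "R y \<in> X0" "A (R y) = Q y" for y
    using someI_ex[of "\<lambda>u. u \<in> X0 \<and> A u = Q y"] A'(4)[of "Q y"] unfolding R_def by auto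
  have R_eq: "R y = a" if "a \<in> X0" "A a = Q y" for a y
    using iso_with_inj[OF isoA R(1) that(1)] R(2) that(2) by simp
  define T where "T y = \<iota> (R y)" for y
  have T_bl: "bounded_linear T"
  proof (rule bounded_linear_intro)
    have "R (x + y) = R x + R y" for x y by (rule R_eq) (simp_all add: R A.add Q.add)
    then show "T (x + y) = T x + T y" for x y by (simp add: T_def embed.add)
    have "R (c *\<^sub>R x) = c *\<^sub>R R x" for c x by (rule R_eq) (simp_all add: R A.scaleR Q.scaleR)
    then show "T (c *\<^sub>R x) = c *\<^sub>R T x" for c x by (simp add: T_def embed.scaleR)
    show "norm (T x) \<le> norm x * (C * L)" for x
    proof -
      have "norm (R x) \<le> C * norm (Q x)" using A'(5)[OF R(1)[of x]] by (simp add: R)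
      also have "\<dots> \<le> C * norm x" using A'(1) norm_Q_le by (intro mult_left_mono) auto
      finally have "norm (R x) * L \<le> C * norm x * L" using L by (intro mult_right_mono) auto
      then show ?thesis using L(2)[of "R x"] by (simp add: T_def algebra_simps)
    qed
  qed
  interpret T: bounded_linear T by fact
  have TY: "T y \<in> Y" for y using R by (simp add: T_def)
  have TA: "T (A a) = \<iota> a" if "a \<in> X0" for a
    using R_eq[of a "A a"] A'(3)[OF that] that by (simp add: T_def)
  have symT: "inner (T y) z = inner y (T z)" if "y \<in> Y" "z \<in> Y" for y z
    using symA[OF R(1)[of y] R(1)[of z]] that by (simp add: T_def R)
  \<comment> \<open>\<open>T - s\<close> equals \<open>- s (A - 1 / s) A\<^sup>-\<^sup>1\<close>, so resolvent points of \<open>A\<close> give resolvent points of \<open>T\<close>.\<close>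
  have below: "\<exists>c>0. \<forall>y\<in>Y. c * norm y \<le> norm (T y - s *\<^sub>R y)" if s: "s < 0" "s \<noteq> 1 / \<nu>" for s
  proof -
    have "1 / s \<le> 0" using s by simp
    moreover have "1 / s \<noteq> \<nu>" using s by auto
    ultimately obtain C' where C': "iso_with C' (\<lambda>u. A u - (1 / s) *\<^sub>R \<iota> u)" using res by blast
    have pos: "0 < C'" by (rule iso_withD[OF C'])
    have "\<bar>s\<bar> / (C' * KA) * norm y \<le> norm (T y - s *\<^sub>R y)" if y: "y \<in> Y" for y
    proof -
      obtain a where a: "a \<in> X0" "y = A a" using A'(4)[OF y] by blast
      have "T y - s *\<^sub>R y = - s *\<^sub>R (A a - (1 / s) *\<^sub>R \<iota> a)"
        using s a TA by (simp add: algebra_simps)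
      then have eq: "norm (T y - s *\<^sub>R y) = \<bar>s\<bar> * norm (A a - (1 / s) *\<^sub>R \<iota> a)" by simp
      have "norm y \<le> C' * norm (A a - (1 / s) *\<^sub>R \<iota> a) * KA"
        using order_trans[OF KA(2)[of a] mult_right_mono[OF iso_withD(5)[OF C' a(1)], of KA]] a KA(1)
        by simp
      then have "\<bar>s\<bar> / (C' * KA) * norm y
          \<le> \<bar>s\<bar> / (C' * KA) * (C' * norm (A a - (1 / s) *\<^sub>R \<iota> a) * KA)"
        using pos KA(1) by (intro mult_left_mono) auto
      also have "\<dots> = \<bar>s\<bar> * norm (A a - (1 / s) *\<^sub>R \<iota> a)" using pos KA(1) by simp
      finally show ?thesis using eq by simp
    qed
    moreover have "0 < \<bar>s\<bar> / (C' * KA)" using s pos KA(1) by (intro divide_pos_pos mult_pos_pos) auto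
    ultimately show ?thesis by blast
  qed
  define \<kappa> where "\<kappa> = 1 / \<nu>"
  have \<kappa>: "\<kappa> < 0" using \<open>\<nu> < 0\<close> by (simp add: \<kappa>_def)
  have T_ge: "\<kappa> * (norm y)\<^sup>2 \<le> inner (T y) y" if "y \<in> Y" for y
  proof (rule numerical_range_bound[OF T_bl Y_subspace TY symT _ that])
    fix s assume "s < \<kappa>"
    then have "s < 0" "s \<noteq> 1 / \<nu>" using \<kappa> unfolding \<kappa>_def by linarith+
    then show "\<exists>c>0. \<forall>y\<in>Y. c * norm y \<le> norm (T y - s *\<^sub>R y)" by (rule below)
  qed
  define P where "P y = T y - (\<kappa> / 2) *\<^sub>R y" for y
  have P_bl: "bounded_linear P"
    unfolding P_def using T_bl by (intro bounded_linear_intros)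
  interpret P: bounded_linear P by fact
  have PY: "P y \<in> Y" if "y \<in> Y" for y using that TY by (simp add: P_def)
  have symP: "inner (P y) z = inner y (P z)" if "y \<in> Y" "z \<in> Y" for y z
    using symT[OF that] by (simp add: P_def inner_diff)
  have P_below: "\<exists>c>0. \<forall>y\<in>Y. c * norm y \<le> norm (P y - t *\<^sub>R y)" if "\<bar>t\<bar> < - \<kappa> / 2" for t
  proof -
    have "\<kappa> / 2 + t < 0" "\<kappa> / 2 + t \<noteq> 1 / \<nu>" using that \<kappa>_def by auto
    then show ?thesis using below[of "\<kappa> / 2 + t"] by (simp add: P_def algebra_simps)
  qed
  have PP_ge: "\<kappa>\<^sup>2 / 4 * (norm y)\<^sup>2 \<le> inner (P (P y)) y" if "y \<in> Y" for y
  proof (rule numerical_range_bound[OF _ Y_subspace _ _ _ that, of "\<lambda>y. P (P y)"])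
    show "bounded_linear (\<lambda>y. P (P y))" using bounded_linear_compose[OF P_bl P_bl] .
    show "\<And>y. y \<in> Y \<Longrightarrow> P (P y) \<in> Y" using PY by blast
    show "\<And>y z. y \<in> Y \<Longrightarrow> z \<in> Y \<Longrightarrow> inner (P (P y)) z = inner y (P (P z))"
      using symP PY by simp
    fix s assume s: "s < \<kappa>\<^sup>2 / 4"
    show "\<exists>c>0. \<forall>y\<in>Y. c * norm y \<le> norm (P (P y) - s *\<^sub>R y)"
    proof (cases "s < 0")
      case True
      have "\<bar>s\<bar> * norm y \<le> norm (P (P y) - s *\<^sub>R y)" if "y \<in> Y" for y
      proof (cases "y = 0")
        case False
        have "\<bar>s\<bar> * norm y * norm y \<le> inner (P (P y) - s *\<^sub>R y) y"
          using symP[OF PY[OF that] that] True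
          by (simp add: inner_diff_left dot_square_norm power2_eq_square mult.assoc)
        also have "\<dots> \<le> norm (P (P y) - s *\<^sub>R y) * norm y" by (rule norm_cauchy_schwarz)
        finally show ?thesis using False by simp
      qed simp
      then show ?thesis using True by (intro exI[of _ "\<bar>s\<bar>"]) auto
    next
      case False
      \<comment> \<open>\<open>P\<^sup>2 - t\<^sup>2 = (P - t) (P + t)\<close>, and both factors are bounded below for \<open>|t| < - \<kappa> / 2\<close>.\<close>
      define t where "t = sqrt s"
      have t: "0 \<le> t" "t * t = s" using False by (auto simp: t_def)
      have "t\<^sup>2 < (- \<kappa> / 2)\<^sup>2" using s t by (simp add: power2_eq_square)
      then have "t < - \<kappa> / 2" by (rule power_less_imp_less_base) (use \<kappa> in simp)
      then have "\<bar>t\<bar> < - \<kappa> / 2" "\<bar>- t\<bar> < - \<kappa> / 2" using t by auto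
      then obtain c1 c2 where c: "0 < c1" "0 < c2"
        "\<And>y. y \<in> Y \<Longrightarrow> c1 * norm y \<le> norm (P y - t *\<^sub>R y)"
        "\<And>y. y \<in> Y \<Longrightarrow> c2 * norm y \<le> norm (P y - (- t) *\<^sub>R y)"
        using P_below by meson
      have "c1 * c2 * norm y \<le> norm (P (P y) - s *\<^sub>R y)" if "y \<in> Y" for y
      proof -
        let ?z = "P y + t *\<^sub>R y"
        have "c1 * (c2 * norm y) \<le> c1 * norm ?z"
          using c(4)[OF that] c(1) by (intro mult_left_mono) auto
        also have "\<dots> \<le> norm (P ?z - t *\<^sub>R ?z)" using c(3)[of ?z] PY[OF that] that by simp
        also have "P ?z - t *\<^sub>R ?z = P (P y) - s *\<^sub>R y"
          using t by (simp add: P.add P.scaleR algebra_simps)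
        finally show ?thesis by (simp add: mult.assoc)
      qed
      then show ?thesis using c by (intro exI[of _ "c1 * c2"]) auto
    qed
  qed
  define S where "S y = T y - \<kappa> *\<^sub>R y" for y
  obtain y where y: "y = A u" by blast
  have yY: "y \<in> Y" using A'(3)[OF u(1)] y by simp
  have "(- \<kappa>) * (norm y)\<^sup>2 \<le> inner (S y) y"
  proof (rule coercive_off_kernel[OF _ Y_subspace iso_complete_Y[OF isoA]])
    show "bounded_linear S" unfolding S_def using T_bl by (intro bounded_linear_intros)
    show "\<And>y. y \<in> Y \<Longrightarrow> S y \<in> Y" using TY by (simp add: S_def)
    show "\<And>y z. y \<in> Y \<Longrightarrow> z \<in> Y \<Longrightarrow> inner (S y) z = inner y (S z)"
      using symT by (simp add: S_def inner_diff)
    show "\<And>y. y \<in> Y \<Longrightarrow> 0 \<le> inner (S y) y"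
      using T_ge by (simp add: S_def inner_diff_left dot_square_norm)
    show "0 < - \<kappa>" using \<kappa> by simp
    show "- \<kappa> * inner (S z) z \<le> (norm (S z))\<^sup>2" if z: "z \<in> Y" for z
    proof -
      have "\<kappa>\<^sup>2 / 4 * (norm z)\<^sup>2 \<le> (norm (P z))\<^sup>2"
        using PP_ge[OF z] symP[OF PY[OF z] z] by (simp add: dot_square_norm)
      also have "\<dots> = (norm (T z))\<^sup>2 - \<kappa> * inner (T z) z + \<kappa>\<^sup>2 / 4 * (norm z)\<^sup>2"
        using power2_norm_add_scaleR[of "T z" "- (\<kappa> / 2)" z]
        by (simp add: P_def power_divide)
      finally have "\<kappa> * inner (T z) z \<le> (norm (T z))\<^sup>2" by simp
      moreover have "(norm (S z))\<^sup>2 = (norm (T z))\<^sup>2 - 2 * \<kappa> * inner (T z) z + \<kappa>\<^sup>2 * (norm z)\<^sup>2"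
        using power2_norm_add_scaleR[of "T z" "- \<kappa>" z] by (simp add: S_def)
      moreover have "- \<kappa> * inner (S z) z = - \<kappa> * inner (T z) z + \<kappa>\<^sup>2 * (norm z)\<^sup>2"
        by (simp add: S_def inner_diff_left dot_square_norm power2_eq_square algebra_simps)
      ultimately show ?thesis by linarith
    qed
    show "y \<in> Y" by (rule yY)
    fix w assume w: "w \<in> Y" "S w = 0"
    obtain a where a: "a \<in> X0" "w = A a" using A'(4)[OF w(1)] by blast
    have "\<iota> a = \<kappa> *\<^sub>R A a" using w(2) TA a by (simp add: S_def)
    then have "A a = \<nu> *\<^sub>R \<iota> a" using \<open>\<nu> < 0\<close> by (simp add: \<kappa>_def)
    then obtain c where c: "a = c *\<^sub>R v0" using simple a(1) by blast
    have "inner (\<iota> v0) (A u) = 0"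
      using symA[OF v0(1) u(1)] v0(2) u(2) by (simp add: inner_commute)
    then show "inner w y = 0" using a(2) c v0(2) y by (simp add: A.scaleR)
  qed
  then have "0 \<le> inner (T y) y" by (simp add: S_def inner_diff_left dot_square_norm)
  then show ?thesis using TA[OF u(1)] y by (simp add: inner_commute)
qed

text \<open>
  For the projected Hessian \<open>A\<close> at the saddle, \<open>B\<close> is the Hessian of the auxiliary functional.  Subtracting \<open>2 \<nu>\<close> times the projection
  onto the eigenvector turns the eigenvalue \<open>\<nu>\<close> into \<open>- \<nu>\<close>.  Invertibility is immediate because \<open>B\<close> is \<open>A\<close>
  composed with the reflection \<open>u \<mapsto> u - 2 \<langle>v0, u\<rangle> v0\<close>.
\<close>

lemma flip_negative_eigenvalue:
  assumes A: "bounded_linear A" "symmetric_form A"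
    and res: "\<And>\<mu>. \<mu> \<le> 0 \<Longrightarrow> \<mu> \<noteq> \<nu> \<Longrightarrow> \<exists>C. iso_with C (\<lambda>u. A u - \<mu> *\<^sub>R \<iota> u)"
    and "\<nu> < 0" and v0: "v0 \<in> X0" "A v0 = \<nu> *\<^sub>R \<iota> v0" "norm (\<iota> v0) = 1"
    and simple: "\<And>u. u \<in> X0 \<Longrightarrow> A u = \<nu> *\<^sub>R \<iota> u \<Longrightarrow> \<exists>c. u = c *\<^sub>R v0"
  defines "B \<equiv> \<lambda>u. A u - (2 * \<nu> * inner (\<iota> v0) (\<iota> u)) *\<^sub>R \<iota> v0"
  shows "symmetric_form B" "nonneg_form B" "\<exists>C. iso_with C B"
proof -
  interpret A: bounded_linear A by fact
  have symA: "inner (A a) (\<iota> b) = inner (\<iota> a) (A b)" if "a \<in> X0" "b \<in> X0" for a b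
    using A(2) that by (simp add: symmetric_form_def)
  have v01: "inner (\<iota> v0) (\<iota> v0) = 1" using v0(3) by (simp add: dot_square_norm)
  show "symmetric_form B"
    using symA by (simp add: symmetric_form_def B_def inner_diff inner_commute)
  show "nonneg_form B" unfolding nonneg_form_def
  proof
    fix u assume u: "u \<in> X0"
    define s where "s = inner (\<iota> v0) (\<iota> u)"
    define w where "w = u - s *\<^sub>R v0"
    have w: "w \<in> X0" "u = w + s *\<^sub>R v0" using u v0 by (auto simp: w_def)
    have w_orth: "inner (\<iota> w) (\<iota> v0) = 0"
      using v01 by (simp add: w_def embed.diff embed.scaleR inner_diff_left)
        (simp add: s_def inner_commute)
    have ww: "0 \<le> inner (A w) (\<iota> w)"
      by (rule simple_negative_eigenvalue_nonneg_complement[OF A res \<open>\<nu> < 0\<close> v0(1,2) simple w(1) w_orth])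
    have cross: "inner (A w) (\<iota> v0) = 0" using symA[OF w(1) v0(1)] w_orth v0(2) by simp
    have "inner (B u) (\<iota> u) = inner (A u) (\<iota> u) - 2 * \<nu> * s\<^sup>2"
      by (simp add: B_def s_def inner_diff_left power2_eq_square)
    also have "inner (A u) (\<iota> u) = inner (A w) (\<iota> w) + \<nu> * s\<^sup>2"
      using cross w_orth v01 v0(2) unfolding w(2)
      by (simp add: A.add A.scaleR embed.add embed.scaleR inner_add inner_commute power2_eq_square)
    finally show "0 \<le> inner (B u) (\<iota> u)"
      using ww \<open>\<nu> < 0\<close> mult_nonpos_nonneg[of \<nu> "s\<^sup>2"] by simp
  qed
  obtain C where "iso_with C (\<lambda>u. A u - 0 *\<^sub>R \<iota> u)" using res[of 0] \<open>\<nu> < 0\<close> by auto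
  then have isoA: "iso_with C A" by simp
  note A' = iso_withD[OF isoA]
  define h where "h u = u - (2 * inner (\<iota> v0) (\<iota> u)) *\<^sub>R v0" for u
  have h_bl: "bounded_linear h"
    unfolding h_def by (intro bounded_linear_intros embed.bounded_linear_axioms)
  then obtain K where K: "0 < K" "\<And>u. norm (h u) \<le> norm u * K"
    using bounded_linear.pos_bounded by blast
  have hX: "h u \<in> X0" if "u \<in> X0" for u using that v0 by (simp add: h_def)
  have hh: "h (h u) = u" for u
    using v01 by (simp add: h_def embed.diff embed.scaleR inner_diff_right algebra_simps)
  have Bh: "B u = A (h u)" for u using v0 by (simp add: B_def h_def A.diff A.scaleR)
  have "iso_with (C * K) B" unfolding iso_with_def
  proof (intro conjI ballI)
    show "0 < C * K" using A'(1) K by simp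
    show "bounded_linear B" unfolding Bh[abs_def] by (rule bounded_linear_compose[OF A(1) h_bl])
    have "h ` X0 = X0" using hX hh by (metis image_subsetI subsetI subset_antisym image_eqI)
    moreover have "B ` X0 = A ` (h ` X0)" by (simp add: Bh image_image)
    ultimately show "B ` X0 = Y" using isoA by (simp add: iso_with_def)
    fix u assume u: "u \<in> X0"
    have "norm u \<le> norm (h u) * K" using K(2)[of "h u"] by (simp add: hh)
    also have "\<dots> \<le> C * norm (A (h u)) * K" using A'(5)[OF hX[OF u]] K by (intro mult_right_mono) auto
    finally show "norm u \<le> C * K * norm (B u)" by (simp add: Bh algebra_simps)
  qed
  then show "\<exists>C. iso_with C B" by blast
qed

end

section \<open>An implicit function theorem on a constrained subspace\<close>

text \<open>
  The mean value inequality for \<open>M x t - M' x0 t0 x\<close>, whose derivative is small on a whole neighbourhood of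
  \<open>(x0, t0)\<close> because \<open>M'\<close> is jointly continuous.
\<close>

lemma uniform_strict_differentiability:
  fixes M :: "'x::real_normed_vector \<Rightarrow> 't::metric_space \<Rightarrow> 'e::real_normed_vector"
    and M' :: "'x \<Rightarrow> 't \<Rightarrow> 'x \<Rightarrow>\<^sub>L 'e"
  assumes deriv: "\<And>x t. ((\<lambda>x. M x t) has_derivative M' x t) (at x)"
    and cont: "isCont (\<lambda>(x, t). M' x t) (x0, t0)" and "0 < e"
  shows "\<exists>r>0. (\<forall>x\<in>cball x0 r. \<forall>t\<in>cball t0 r. norm (M' x t - M' x0 t0) \<le> e) \<and>
     (\<forall>x\<in>cball x0 r. \<forall>x'\<in>cball x0 r. \<forall>t\<in>cball t0 r.
        norm (M x t - M x' t - M' x0 t0 (x - x')) \<le> e * norm (x - x'))"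
proof -
  obtain d where d: "0 < d" "\<And>y. dist y (x0, t0) < d \<Longrightarrow> dist (case y of (x, t) \<Rightarrow> M' x t) (M' x0 t0) < e"
    using cont \<open>0 < e\<close> unfolding continuous_at_eps_delta by fastforce
  define r where "r = d / 4"
  have r: "0 < r" using d by (simp add: r_def)
  have close: "norm (M' x t - M' x0 t0) \<le> e" if "x \<in> cball x0 r" "t \<in> cball t0 r" for x t
  proof -
    have "dist (x, t) (x0, t0) \<le> dist x x0 + dist t t0"
      unfolding dist_Pair_Pair by (rule sqrt_sum_squares_le_sum) auto
    also have "\<dots> < d" using that d by (simp add: r_def dist_commute)
    finally show ?thesis using d(2)[of "(x, t)"] by (simp add: dist_norm)
  qed
  have "norm (M x t - M x' t - M' x0 t0 (x - x')) \<le> e * norm (x - x')"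
    if "x \<in> cball x0 r" "x' \<in> cball x0 r" "t \<in> cball t0 r" for x x' t
  proof -
    have "norm ((M x t - M' x0 t0 x) - (M x' t - M' x0 t0 x')) \<le> e * norm (x - x')"
    proof (rule differentiable_bound[of "cball x0 r" _ "\<lambda>x. blinfun_apply (M' x t - M' x0 t0)"])
      fix y assume y: "y \<in> cball x0 r"
      show "((\<lambda>x. M x t - M' x0 t0 x) has_derivative blinfun_apply (M' y t - M' x0 t0)) (at y within cball x0 r)"
        by (rule has_derivative_eq_rhs, rule has_derivative_diff,
            rule has_derivative_at_withinI, rule deriv,
            rule bounded_linear_imp_has_derivative, rule blinfun.bounded_linear_right)
           (auto simp: blinfun.diff_left)
      show "onorm (blinfun_apply (M' y t - M' x0 t0)) \<le> e"
        using close[OF y that(3)] by (simp add: norm_blinfun.rep_eq)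
    qed (use that in auto)
    then show ?thesis by (simp add: blinfun.diff_right algebra_simps)
  qed
  then show ?thesis using r close by blast
qed

context constrained_embedding begin

text \<open>
  The outcome of the implicit function theorem for \<open>Q (M x t) = 0\<close>: a quantitative injectivity in
  \<open>x\<close>, uniform in \<open>t\<close>, and existence of solutions as close to \<open>x0\<close> as desired.  Only displacements in
  \<open>X0\<close> are admitted, since the equation is invertible in these directions only.
\<close>

definition solvable_near where
  "solvable_near M x0 t0 C r0 \<longleftrightarrow> 0 < r0 \<and>
    (\<forall>x\<in>cball x0 r0. \<forall>x'\<in>cball x0 r0. \<forall>t\<in>cball t0 r0. x - x' \<in> X0 \<longrightarrow>
        norm (x - x') \<le> 2 * C * norm (Q (M x t) - Q (M x' t))) \<and>
    (\<forall>r. 0 < r \<and> r \<le> r0 \<longrightarrow> (\<exists>\<delta>>0. \<forall>t\<in>cball t0 \<delta>. \<exists>x\<in>cball x0 r. x - x0 \<in> X0 \<and> Q (M x t) = 0))"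

text \<open>
  The iteration \<open>x \<mapsto> x - B\<^sup>-\<^sup>1 Q (M x t)\<close> contracts by one half, with the derivative \<open>B\<close> frozen at the base point.  The last clause puts
  the derivatives at nearby points into the scope of the perturbation lemmas, which measure smallness relative to \<open>B\<close>.
\<close>

lemma implicit_solution:
  fixes M :: "'x \<Rightarrow> 't::metric_space \<Rightarrow> 'e" and M' :: "'x \<Rightarrow> 't \<Rightarrow> 'x \<Rightarrow>\<^sub>L 'e"
  assumes deriv: "\<And>x t. ((\<lambda>x. M x t) has_derivative M' x t) (at x)"
    and cont: "isCont (\<lambda>(x, t). M' x t) (x0, t0)"
    and M0: "Q (M x0 t0) = 0" and contM: "isCont (M x0) t0"
    and B: "iso_with C B" "\<And>h. h \<in> X0 \<Longrightarrow> Q (M' x0 t0 h) = B h"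
  shows "\<exists>r0. solvable_near M x0 t0 C r0 \<and>
    (\<forall>x\<in>cball x0 r0. \<forall>t\<in>cball t0 r0. \<forall>h\<in>X0. norm (Q (M' x t h) - B h) \<le> 1/2 * norm (B h))"
proof -
  note B' = iso_withD[OF B(1)]
  interpret B: bounded_linear B by fact
  define e where "e = 1 / (2 * C)"
  have e: "0 < e" "C * e = 1 / 2" using B'(1) by (auto simp: e_def)
  obtain r0 where r0: "0 < r0"
    and close: "\<And>x t. x \<in> cball x0 r0 \<Longrightarrow> t \<in> cball t0 r0 \<Longrightarrow> norm (M' x t - M' x0 t0) \<le> e"
    and strict: "\<And>x x' t. x \<in> cball x0 r0 \<Longrightarrow> x' \<in> cball x0 r0 \<Longrightarrow> t \<in> cball t0 r0 \<Longrightarrow>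
        norm (M x t - M x' t - M' x0 t0 (x - x')) \<le> e * norm (x - x')"
    using uniform_strict_differentiability[OF deriv cont e(1)] by metis
  have strictQ: "norm (Q (M x t) - Q (M x' t) - B (x - x')) \<le> e * norm (x - x')"
    if "x \<in> cball x0 r0" "x' \<in> cball x0 r0" "t \<in> cball t0 r0" "x - x' \<in> X0" for x x' t
    using order_trans[OF norm_Q_le strict[OF that(1-3)]] B(2)[OF that(4)]
    by (simp add: Q.diff)
  have inj: "norm (x - x') \<le> 2 * C * norm (Q (M x t) - Q (M x' t))"
    if "x \<in> cball x0 r0" "x' \<in> cball x0 r0" "t \<in> cball t0 r0" "x - x' \<in> X0" for x x' t
  proof -
    have "norm (B (x - x')) \<le> norm (Q (M x t) - Q (M x' t)) + e * norm (x - x')"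
      using strictQ[OF that] norm_triangle_sub[of "B (x - x')" "Q (M x t) - Q (M x' t)"]
      by (simp add: norm_minus_commute)
    then have "C * norm (B (x - x')) \<le> C * norm (Q (M x t) - Q (M x' t)) + (C * e) * norm (x - x')"
      using B'(1) by (metis distrib_left mult.assoc mult_left_mono less_imp_le)
    then show ?thesis using B'(5)[OF that(4)] e by simp
  qed
  have solve: "\<exists>\<delta>>0. \<forall>t\<in>cball t0 \<delta>. \<exists>x\<in>cball x0 r. x - x0 \<in> X0 \<and> Q (M x t) = 0"
    if r: "0 < r" "r \<le> r0" for r
  proof -
    have "0 < r * e" using r e by simp
    then obtain d where d: "0 < d" "\<And>t. dist t t0 < d \<Longrightarrow> dist (M x0 t) (M x0 t0) < r * e"
      using contM unfolding continuous_at_eps_delta by blast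
    define \<delta> where "\<delta> = min (d / 2) r0"
    have \<delta>: "0 < \<delta>" using d r0 by (simp add: \<delta>_def)
    have "\<exists>x\<in>cball x0 r. x - x0 \<in> X0 \<and> Q (M x t) = 0" if t: "t \<in> cball t0 \<delta>" for t
    proof -
      have tr: "t \<in> cball t0 r0" and "dist t t0 < d"
        using t d by (auto simp: \<delta>_def dist_commute)
      then have small: "norm (Q (M x0 t)) \<le> r * e"
        using d(2)[of t] M0 norm_Q_le[of "M x0 t - M x0 t0"] by (simp add: dist_norm Q.diff)
      define R where "R y = (SOME u. u \<in> X0 \<and> B u = y)" for y
      have R: "R y \<in> X0" "B (R y) = y" if "y \<in> Y" for y
        using someI_ex[of "\<lambda>u. u \<in> X0 \<and> B u = y"] B'(4)[OF that] unfolding R_def by auto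
      define S where "S = X0 \<inter> cball 0 r"
      define f where "f h = h - R (Q (M (x0 + h) t))" for h
      have half: "norm (f h - f h') \<le> 1 / 2 * norm (h - h')" if h: "h \<in> S" "h' \<in> S" for h h'
      proof -
        let ?y = "Q (M (x0 + h) t)" and ?y' = "Q (M (x0 + h') t)"
        have X: "h - h' \<in> X0" "f h - f h' \<in> X0" using h R by (auto simp: S_def f_def)
        have "B (f h - f h') = B (h - h') - (?y - ?y')"
          by (simp add: f_def B.diff R)
        then have "norm (B (f h - f h')) = norm (?y - ?y' - B (h - h'))"
          by (simp add: norm_minus_commute)
        also have "\<dots> \<le> e * norm (h - h')"
          using strictQ[of "x0 + h" "x0 + h'" t] tr X h r by (auto simp: S_def dist_norm)
        finally have "C * norm (B (f h - f h')) \<le> C * (e * norm (h - h'))"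
          using B'(1) by (intro mult_left_mono) auto
        then show ?thesis using B'(5)[OF X(2)] e by (simp add: mult.assoc[symmetric])
      qed
      have f0: "norm (f 0) \<le> r / 2"
      proof -
        have "norm (f 0) \<le> C * norm (Q (M x0 t))"
          using B'(5)[OF R(1)[of "Q (M x0 t)"]] by (simp add: f_def R)
        also have "\<dots> \<le> C * (r * e)" using small B'(1) by (intro mult_left_mono) auto
        also have "\<dots> = (C * e) * r" by simp
        finally show ?thesis using e by simp
      qed
      have 0: "0 \<in> S" using r by (simp add: S_def)
      have "\<exists>!h. h \<in> S \<and> f h = h"
      proof (rule Banach_fix[of S "1 / 2"])
        show "complete S" unfolding S_def
          by (simp add: complete_eq_closed closed_X0 closed_Int)
        show "S \<noteq> {}" using 0 by blast
        show "f ` S \<subseteq> S"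
        proof
          fix y assume "y \<in> f ` S"
          then obtain h where h: "h \<in> S" "y = f h" by blast
          have "norm (f h) \<le> norm (f h - f 0) + norm (f 0)" using norm_triangle_sub[of "f h" "f 0"] by simp
          also have "\<dots> \<le> 1 / 2 * norm h + r / 2" using half[OF h(1) 0] f0 by simp
          finally have "norm (f h) \<le> r" using h(1) by (simp add: S_def)
          then show "y \<in> S" using h R by (simp add: S_def f_def)
        qed
      qed (use half in \<open>auto simp: dist_norm\<close>)
      then obtain h where h: "h \<in> S" "f h = h" by blast
      then have "R (Q (M (x0 + h) t)) = 0" by (simp add: f_def)
      then have "Q (M (x0 + h) t) = 0" using R(2)[of "Q (M (x0 + h) t)"] by (simp add: B.zero)
      then show ?thesis using h(1) by (intro bexI[of _ "x0 + h"]) (auto simp: S_def dist_norm)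
    qed
    then show ?thesis using \<delta> by blast
  qed
  have "norm (Q (M' x t h) - B h) \<le> 1/2 * norm (B h)"
    if "x \<in> cball x0 r0" "t \<in> cball t0 r0" "h \<in> X0" for x t h
  proof -
    have "norm (Q (M' x t h) - B h) = norm (Q ((M' x t - M' x0 t0) h))"
      using B(2)[OF that(3)] by (simp add: Q.diff blinfun.diff_left)
    also have "\<dots> \<le> norm (M' x t - M' x0 t0) * norm h"
      using order_trans[OF norm_Q_le norm_blinfun] .
    also have "\<dots> \<le> e * (C * norm (B h))"
      using close[OF that(1,2)] B'(5)[OF that(3)] e by (intro mult_mono) auto
    also have "\<dots> = (C * e) * norm (B h)" by simp
    finally show ?thesis using e by simp
  qed
  moreover have "solvable_near M x0 t0 C r0"
    unfolding solvable_near_def using r0 inj solve by simp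
  ultimately show ?thesis by (intro exI[of _ r0] conjI ballI)
qed

text \<open>
  The injectivity estimate \<open>lip\<close> makes the solution Lipschitz at \<open>s1\<close>, so the linearization error of
  \<open>N\<close> along the solution is of smaller order than \<open>s - s1\<close>.  The derivative is minus the inverse of the partial
  derivative in \<open>x\<close> after the partial derivative in \<open>s\<close>.
\<close>

lemma differentiable_implicit_partials:
  fixes N :: "'x \<Rightarrow> 's::real_normed_vector \<Rightarrow> 'e" and x :: "'s \<Rightarrow> 'x"
  assumes N: "((\<lambda>(x, s). Q (N x s)) has_derivative (\<lambda>(h, k). Q (N' h k))) (at (x s1, s1) within UNIV \<times> S)"
    and s1: "s1 \<in> S"
    and zero: "\<And>s. s \<in> S \<Longrightarrow> Q (N (x s) s) = 0"
    and X: "\<And>s. s \<in> S \<Longrightarrow> x s - x s1 \<in> X0"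
    and lip: "\<And>s. s \<in> S \<Longrightarrow> norm (x s - x s1) \<le> K * norm (Q (N (x s1) s))"
    and iso: "iso_with C (\<lambda>h. Q (N' h 0))"
  shows "x differentiable (at s1 within S)"
proof -
  define D where "D = (\<lambda>h. Q (N' h 0))"
  define E where "E = (\<lambda>k. Q (N' 0 k))"
  have iso': "iso_with C D" using iso unfolding D_def .
  note D' = iso_withD[OF iso']
  have bl: "bounded_linear (\<lambda>(h, k). Q (N' h k))" using N by (rule has_derivative_bounded_linear)
  interpret NN: bounded_linear "\<lambda>(h, k). Q (N' h k)" by fact
  interpret D: bounded_linear D by (rule D')
  have E_bl: "bounded_linear E"
    using bounded_linear_compose[OF bl, of "\<lambda>k. (0, k)"]
    by (simp add: E_def bounded_linear_Pair bounded_linear_zero bounded_linear_ident)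
  interpret E: bounded_linear E by fact
  have split: "Q (N' h k) = D h + E k" for h k
    using NN.add[of "(h, 0)" "(0, k)"] by (simp add: D_def E_def)
  define R where "R y = (SOME u. u \<in> X0 \<and> D u = Q y)" for y
  have R: "R y \<in> X0" "D (R y) = Q y" for y
    using someI_ex[of "\<lambda>u. u \<in> X0 \<and> D u = Q y"] D'(4)[of "Q y"] unfolding R_def by auto
  have R_eq: "R y = a" if "a \<in> X0" "D a = Q y" for a y
    using iso_with_inj[OF iso' R(1) that(1)] R(2) that(2) by simp
  have R_norm: "norm (R y) \<le> C * norm y" for y
  proof -
    have "norm (R y) \<le> C * norm (Q y)" using D'(5)[OF R(1)[of y]] by (simp add: R)
    also have "\<dots> \<le> C * norm y" using norm_Q_le D'(1) by (intro mult_left_mono) auto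
    finally show ?thesis .
  qed
  have R_bl: "bounded_linear R"
  proof (rule bounded_linear_intro)
    show "R (x + y) = R x + R y" for x y by (rule R_eq) (simp_all add: R D.add Q.add)
    show "R (c *\<^sub>R x) = c *\<^sub>R R x" for c x by (rule R_eq) (simp_all add: R D.scaleR Q.scaleR)
    show "norm (R x) \<le> norm x * C" for x using R_norm by (simp add: mult.commute)
  qed
  define x' where "x' k = - R (E k)" for k
  have x'_bl: "bounded_linear x'"
    unfolding x'_def using bounded_linear_minus[OF bounded_linear_compose[OF R_bl E_bl]] .
  have Q1: "Q (N (x s1) s1) = 0" using zero s1 by blast
  have EY: "Q (E k) = E k" for k by (simp add: E_def)
  have small: "\<exists>d>0. \<forall>h::'x. \<forall>s\<in>S. norm h < d \<and> norm (s - s1) < d \<longrightarrow>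
      norm (Q (N (x s1 + h) s) - D h - E (s - s1)) \<le> e * (norm h + norm (s - s1))" if "0 < e" for e :: real
  proof -
    obtain d where d: "0 < d" "\<And>y. y \<in> UNIV \<times> S \<Longrightarrow> norm (y - (x s1, s1)) < d \<Longrightarrow>
        norm ((\<lambda>(x, s). Q (N x s)) y - (\<lambda>(x, s). Q (N x s)) (x s1, s1) - (\<lambda>(h, k). Q (N' h k)) (y - (x s1, s1)))
          \<le> e * norm (y - (x s1, s1))"
      using N \<open>0 < e\<close> unfolding has_derivative_within_alt by meson
    show ?thesis
    proof (intro exI[of _ "d / 2"] conjI allI ballI impI)
      fix h :: 'x and s assume s: "s \<in> S" and hs: "norm h < d / 2 \<and> norm (s - s1) < d / 2"
      have le: "norm (h, s - s1) \<le> norm h + norm (s - s1)"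
        unfolding norm_Pair by (rule sqrt_sum_squares_le_sum) auto
      then have "norm ((x s1 + h, s) - (x s1, s1)) < d" using hs by simp
      from d(2)[OF _ this] s have "norm (Q (N (x s1 + h) s) - D h - E (s - s1)) \<le> e * norm (h, s - s1)"
        by (simp add: Q1 split diff_diff_eq)
      also have "\<dots> \<le> e * (norm h + norm (s - s1))" using le that by (intro mult_left_mono) auto
      finally show "norm (Q (N (x s1 + h) s) - D h - E (s - s1)) \<le> e * (norm h + norm (s - s1))" .
    qed (use d in simp)
  qed
  obtain KE where KE: "0 < KE" "\<And>k. norm (E k) \<le> norm k * KE" using E.pos_bounded by blast
  define K' where "K' = \<bar>K\<bar> * (KE + 1)"
  have K': "0 \<le> K'" using KE by (simp add: K'_def)
  obtain d0 where d0: "0 < d0" "\<And>s. s \<in> S \<Longrightarrow> norm (s - s1) < d0 \<Longrightarrow> norm (x s - x s1) \<le> K' * norm (s - s1)"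
  proof -
    obtain d where d: "0 < d" "\<And>h s. s \<in> S \<Longrightarrow> norm h < d \<Longrightarrow> norm (s - s1) < d \<Longrightarrow>
      norm (Q (N (x s1 + h) s) - D h - E (s - s1)) \<le> 1 * (norm h + norm (s - s1))"
      using small[of 1] by auto
    show ?thesis
    proof (rule that[OF d(1)])
      fix s assume s: "s \<in> S" "norm (s - s1) < d"
      have "norm (Q (N (x s1) s)) \<le> norm (E (s - s1)) + norm (s - s1)"
        using d(2)[OF s(1) _ s(2), of 0] d(1) norm_triangle_sub[of "Q (N (x s1) s)" "E (s - s1)"]
        by (simp add: D.zero)
      also have "\<dots> \<le> (KE + 1) * norm (s - s1)" using KE(2)[of "s - s1"] by (simp add: algebra_simps)
      finally have "\<bar>K\<bar> * norm (Q (N (x s1) s)) \<le> K' * norm (s - s1)"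
        by (simp add: K'_def mult_left_mono mult.assoc)
      moreover have "K * norm (Q (N (x s1) s)) \<le> \<bar>K\<bar> * norm (Q (N (x s1) s))"
        by (intro mult_right_mono) auto
      ultimately show "norm (x s - x s1) \<le> K' * norm (s - s1)" using lip[OF s(1)] by linarith
    qed
  qed
  have "(x has_derivative x') (at s1 within S)"
    unfolding has_derivative_within_alt
  proof (intro conjI x'_bl allI impI)
    fix e :: real assume "0 < e"
    define e' where "e' = e / (C * (K' + 1))"
    have e': "0 < e'" "C * (e' * (K' + 1)) = e"
      using \<open>0 < e\<close> D'(1) K' by (auto simp: e'_def)
    obtain d where d: "0 < d" "\<And>h s. s \<in> S \<Longrightarrow> norm h < d \<Longrightarrow> norm (s - s1) < d \<Longrightarrow>
      norm (Q (N (x s1 + h) s) - D h - E (s - s1)) \<le> e' * (norm h + norm (s - s1))"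
      using small[OF e'(1)] by meson
    define d1 where "d1 = min (min d d0) (d / (K' + 1))"
    show "\<exists>d>0. \<forall>y\<in>S. norm (y - s1) < d \<longrightarrow> norm (x y - x s1 - x' (y - s1)) \<le> e * norm (y - s1)"
    proof (intro exI[of _ d1] conjI ballI impI)
      show "0 < d1" using d d0 K' by (simp add: d1_def)
      fix s assume s: "s \<in> S" "norm (s - s1) < d1"
      define h where "h = x s - x s1"
      have h: "norm h \<le> K' * norm (s - s1)" using d0(2)[OF s(1)] s(2) by (simp add: h_def d1_def)
      also have "\<dots> \<le> (K' + 1) * norm (s - s1)" by (simp add: algebra_simps)
      also have "\<dots> < d" using s(2) K' by (simp add: d1_def field_simps)
      finally have "norm h < d" .
      then have "norm (Q (N (x s1 + h) s) - D h - E (s - s1)) \<le> e' * (norm h + norm (s - s1))"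
        using d(2)[OF s(1)] s(2) by (simp add: d1_def)
      moreover have "Q (N (x s1 + h) s) = 0" using zero[OF s(1)] by (simp add: h_def)
      ultimately have "norm (D h + E (s - s1)) \<le> e' * (norm h + norm (s - s1))"
        by (metis diff_0 diff_diff_eq norm_minus_cancel minus_diff_eq diff_minus_eq_add minus_add_distrib)
      also have "\<dots> \<le> e' * ((K' + 1) * norm (s - s1))"
        using h e' by (intro mult_left_mono) (auto simp: algebra_simps)
      finally have 1: "C * norm (D h + E (s - s1)) \<le> C * (e' * ((K' + 1) * norm (s - s1)))"
        using D'(1) by (intro mult_left_mono) auto
      have "D (h - x' (s - s1)) = D h + E (s - s1)" by (simp add: x'_def D.diff D.neg R EY D.add)
      moreover have "h - x' (s - s1) \<in> X0" using X[OF s(1)] R by (simp add: h_def x'_def)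
      ultimately have "norm (h - x' (s - s1)) \<le> C * norm (D h + E (s - s1))" using D'(5) by metis
      also note 1
      also have "C * (e' * ((K' + 1) * norm (s - s1))) = e * norm (s - s1)"
        using e'(2) by (metis mult.assoc)
      finally show "norm (x s - x s1 - x' (s - s1)) \<le> e * norm (s - s1)" by (simp add: h_def)
    qed
  qed
  then show ?thesis unfolding differentiable_def by blast
qed


lemma differentiable_implicit:
  fixes N :: "'x \<Rightarrow> 's::real_normed_vector \<Rightarrow> 'e" and x :: "'s \<Rightarrow> 'x"
  assumes N: "(\<lambda>y. N (fst y) (snd y)) differentiable (at (x s1, s1) within UNIV \<times> S)"
    and D: "((\<lambda>x. N x s1) has_derivative D) (at (x s1))"
    and s1: "s1 \<in> S"
    and zero: "\<And>s. s \<in> S \<Longrightarrow> Q (N (x s) s) = 0"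
    and X: "\<And>s. s \<in> S \<Longrightarrow> x s - x s1 \<in> X0"
    and lip: "\<And>s. s \<in> S \<Longrightarrow> norm (x s - x s1) \<le> K * norm (Q (N (x s1) s))"
    and iso: "iso_with C (\<lambda>h. Q (D h))"
  shows "x differentiable (at s1 within S)"
proof -
  obtain N' where N': "((\<lambda>y. N (fst y) (snd y)) has_derivative N') (at (x s1, s1) within UNIV \<times> S)"
    using N unfolding differentiable_def by blast
  have "((\<lambda>h. N (fst (h, s1)) (snd (h, s1))) has_derivative (\<lambda>h. N' (h, 0))) (at (x s1) within UNIV)"
  proof (rule has_derivative_in_compose[where g = "\<lambda>y. N (fst y) (snd y)" and g' = N'])
    show "((\<lambda>h. (h, s1)) has_derivative (\<lambda>h. (h, 0))) (at (x s1) within UNIV)"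
      by (auto intro!: derivative_eq_intros)
    show "((\<lambda>y. N (fst y) (snd y)) has_derivative N') (at (x s1, s1) within range (\<lambda>h. (h, s1)))"
      by (rule has_derivative_subset[OF N']) (use s1 in auto)
  qed
  then have "((\<lambda>h. N h s1) has_derivative (\<lambda>h. N' (h, 0))) (at (x s1))" by simp
  then have "(\<lambda>h. N' (h, 0)) = D" using D by (rule has_derivative_unique)
  then have "N' (h, 0) = D h" for h by (rule fun_cong)
  moreover have "((\<lambda>(x, s). Q (N x s)) has_derivative (\<lambda>(h, k). Q (N' (h, k)))) (at (x s1, s1) within UNIV \<times> S)"
    using Q.has_derivative[OF N'] by (simp add: case_prod_beta')
  ultimately show ?thesis
    using differentiable_implicit_partials[of N "\<lambda>h k. N' (h, k)" x s1 S K C] s1 zero X lip iso by simp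
qed

end

section \<open>The eigenvector equation and the gradient of the auxiliary functional\<close>

text \<open>
  By the mean value theorem the slopes of \<open>f\<close> along a segment are values of its derivative there, which
  increase strictly.  The second part makes a critical point the strict minimizer.
\<close>

lemma strictly_convex_of_monotone_gradient:
  fixes f :: "'x::real_normed_vector \<Rightarrow> real" and E :: "'x \<Rightarrow> 'x \<Rightarrow> real"
  assumes "convex U" and deriv: "\<And>x. (f has_derivative E x) (at x)"
    and mono: "\<And>x y. x \<in> U \<Longrightarrow> y \<in> U \<Longrightarrow> x \<noteq> y \<Longrightarrow> E x (y - x) < E y (y - x)"
  shows "strictly_convex_on U f"
    and "\<And>x y. x \<in> U \<Longrightarrow> y \<in> U \<Longrightarrow> x \<noteq> y \<Longrightarrow> E x (y - x) = 0 \<Longrightarrow> f x < f y"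
proof -
  have seg: "(1 - s) *\<^sub>R x + s *\<^sub>R y \<in> U" if "x \<in> U" "y \<in> U" "0 \<le> s" "s \<le> 1" for x y s
    using \<open>convex U\<close> that by (simp add: convex_alt)
  have pt: "(1 - s) *\<^sub>R x + s *\<^sub>R y = x + s *\<^sub>R (y - x)" for x y :: 'x and s
    by (simp add: algebra_simps)
  have der: "((\<lambda>s. f (x + s *\<^sub>R (y - x))) has_real_derivative E (x + s *\<^sub>R (y - x)) (y - x)) (at s)" for x y s
  proof -
    interpret E: bounded_linear "E (x + s *\<^sub>R (y - x))" using deriv by (rule has_derivative_bounded_linear)
    have "((\<lambda>s. x + s *\<^sub>R (y - x)) has_derivative (\<lambda>h. h *\<^sub>R (y - x))) (at s)"
      by (auto intro!: derivative_eq_intros)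
    from has_derivative_compose[OF this deriv]
    show ?thesis by (simp add: has_field_derivative_def E.scaleR mult_commute_abs)
  qed
  have incr: "E (x + s *\<^sub>R (y - x)) (y - x) < E (x + s' *\<^sub>R (y - x)) (y - x)"
    if xy: "x \<in> U" "y \<in> U" "x \<noteq> y" and s: "0 \<le> s" "s < s'" "s' \<le> 1" for x y s s'
  proof -
    let ?a = "x + s *\<^sub>R (y - x)" and ?b = "x + s' *\<^sub>R (y - x)"
    interpret A: bounded_linear "E ?a" using deriv by (rule has_derivative_bounded_linear)
    interpret B: bounded_linear "E ?b" using deriv by (rule has_derivative_bounded_linear)
    have d: "?b - ?a = (s' - s) *\<^sub>R (y - x)" by (simp add: algebra_simps)
    have "?a \<in> U" "?b \<in> U" using seg[OF xy(1,2), of s] seg[OF xy(1,2), of s'] s pt[of _ x y] by auto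
    moreover have "?a \<noteq> ?b" using d xy(3) s by (metis eq_iff_diff_eq_0 less_irrefl scaleR_eq_0_iff)
    ultimately have "E ?a (?b - ?a) < E ?b (?b - ?a)" by (rule mono)
    then show ?thesis using s unfolding d A.scaleR B.scaleR by simp
  qed
  show "strictly_convex_on U f"
    unfolding strictly_convex_on_def
  proof (intro conjI ballI allI impI \<open>convex U\<close>)
    fix x y and t :: real assume xy: "x \<in> U" "y \<in> U" and "x \<noteq> y \<and> 0 < t \<and> t < 1"
    then have t: "x \<noteq> y" "0 < t" "t < 1" by auto
    define h where "h s = f (x + s *\<^sub>R (y - x))" for s
    obtain \<xi>1 where 1: "0 < \<xi>1" "\<xi>1 < t" "h t - h 0 = t * E (x + \<xi>1 *\<^sub>R (y - x)) (y - x)"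
      using MVT2[of 0 t h "\<lambda>s. E (x + s *\<^sub>R (y - x)) (y - x)"] t der unfolding h_def by auto
    obtain \<xi>2 where 2: "t < \<xi>2" "\<xi>2 < 1" "h 1 - h t = (1 - t) * E (x + \<xi>2 *\<^sub>R (y - x)) (y - x)"
      using MVT2[of t 1 h "\<lambda>s. E (x + s *\<^sub>R (y - x)) (y - x)"] t der unfolding h_def by auto
    have "(1 - t) * (h t - h 0) = (1 - t) * t * E (x + \<xi>1 *\<^sub>R (y - x)) (y - x)" by (simp add: 1)
    also have "\<dots> < (1 - t) * t * E (x + \<xi>2 *\<^sub>R (y - x)) (y - x)"
      using incr[OF xy t(1), of \<xi>1 \<xi>2] 1 2 t by (intro mult_strict_left_mono) auto
    also have "\<dots> = t * (h 1 - h t)" by (simp add: 2)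
    finally have "h t < (1 - t) * h 0 + t * h 1" by (simp add: algebra_simps)
    then show "f ((1 - t) *\<^sub>R x + t *\<^sub>R y) < (1 - t) * f x + t * f y" by (simp add: h_def pt)
  qed
  show "f x < f y" if xy: "x \<in> U" "y \<in> U" "x \<noteq> y" and crit: "E x (y - x) = 0" for x y
  proof -
    obtain \<xi> where "0 < \<xi>" "\<xi> < 1"
      "f (x + 1 *\<^sub>R (y - x)) - f (x + 0 *\<^sub>R (y - x)) = (1 - 0) * E (x + \<xi> *\<^sub>R (y - x)) (y - x)"
      using MVT2[of 0 1 "\<lambda>s. f (x + s *\<^sub>R (y - x))" "\<lambda>s. E (x + s *\<^sub>R (y - x)) (y - x)"] der by auto
    moreover have "E (x + 0 *\<^sub>R (y - x)) (y - x) < E (x + \<xi> *\<^sub>R (y - x)) (y - x)"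
      using calculation xy by (intro incr) auto
    ultimately show ?thesis using crit by simp
  qed
qed

text \<open>
  A critical point \<open>\<phi>s\<close> whose projected Hessian has \<open>\<nu>\<close> as its only spectral value in
  the half line \<open>(-\<infinity>, 0]\<close>, simple and with unit eigenvector \<open>v0\<close>.
\<close>

locale saddle_problem = constrained_embedding \<iota> p Q
  for \<iota> :: "'x::banach \<Rightarrow> 'e::real_inner" and p :: "'x \<Rightarrow> 'x" and Q :: "'e \<Rightarrow> 'e" +
  fixes F :: "'x \<Rightarrow> real" and G :: "'x \<Rightarrow> 'e" and H :: "'x \<Rightarrow> 'x \<Rightarrow>\<^sub>L 'e"
    and \<phi>s :: 'x and \<nu> :: real and v0 :: 'x
  assumes F_deriv: "\<And>\<phi>. (F has_derivative (\<lambda>h. inner (G \<phi>) (\<iota> h))) (at \<phi>)"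
    and G_deriv: "\<And>\<phi>. (G has_derivative blinfun_apply (H \<phi>)) (at \<phi>)"
    and H_cont: "\<And>\<phi>. isCont H \<phi>"
    and H_sym: "\<And>\<phi> u w. inner (H \<phi> u) (\<iota> w) = inner (\<iota> u) (H \<phi> w)"
    and stationary: "Q (G \<phi>s) = 0"
    and \<nu>_neg: "\<nu> < 0"
    and resolvent: "\<And>\<mu>. \<mu> \<le> 0 \<Longrightarrow> \<mu> \<noteq> \<nu> \<Longrightarrow> \<exists>C. iso_with C (\<lambda>u. Q (H \<phi>s u) - \<mu> *\<^sub>R \<iota> u)"
    and v0: "v0 \<in> X0" "Q (H \<phi>s v0) = \<nu> *\<^sub>R \<iota> v0" "norm (\<iota> v0) = 1"
    and simple: "\<And>u. u \<in> X0 \<Longrightarrow> Q (H \<phi>s u) = \<nu> *\<^sub>R \<iota> u \<Longrightarrow> \<exists>c. u = c *\<^sub>R v0"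
begin

definition "flip u = Q (H \<phi>s u) - (2 * \<nu> * inner (\<iota> v0) (\<iota> u)) *\<^sub>R \<iota> v0"

lemma bounded_linear_QH: "bounded_linear (\<lambda>u. Q (H \<phi> u))"
  by (rule bounded_linear_compose[OF bounded_linear_Q blinfun.bounded_linear_right])

lemma symmetric_QH: "symmetric_form (\<lambda>u. Q (H \<phi> u))"
  using H_sym by (simp add: symmetric_form_def)

lemma flip_facts:
  shows "symmetric_form flip" "nonneg_form flip" "\<exists>C. iso_with C flip"
proof -
  note * = flip_negative_eigenvalue[OF bounded_linear_QH symmetric_QH resolvent \<nu>_neg v0 simple, folded flip_def[abs_def]]
  show "symmetric_form flip" by (rule *(1))
  show "nonneg_form flip" by (rule *(2))
  show "\<exists>C. iso_with C flip" by (rule *(3))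
qed

definition "embed_blinfun = Blinfun \<iota>"

lemma embed_blinfun [simp]: "embed_blinfun u = \<iota> u"
  by (simp add: embed_blinfun_def bounded_linear_Blinfun_apply bounded_linear_embed)

text \<open>
  The eigenvector equation with the normalization built in: pairing it with \<open>x\<close> gives
  \<open>\<langle>H x, x\<rangle> (1 - |x|\<^sup>2) = 0\<close>, so solutions with \<open>\<langle>H x, x\<rangle> \<noteq> 0\<close> are unit vectors.  Its linearization at
  \<open>v0\<close> is \<open>flip - \<nu>\<close>, a positive shift of a nonnegative invertible operator, whereas \<open>A - \<nu>\<close> alone is singular.
\<close>

definition "eig_eq x \<phi> = H \<phi> x - inner (H \<phi> x) (\<iota> x) *\<^sub>R \<iota> x"

definition "eig_deriv x \<phi> = H \<phi> - inner (H \<phi> x) (\<iota> x) *\<^sub>R embed_blinfun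
  - (blinfun_scaleR_left (\<iota> x) o\<^sub>L ((blinfun_inner_left (\<iota> x) o\<^sub>L H \<phi>) + (blinfun_inner_left (H \<phi> x) o\<^sub>L embed_blinfun)))"

text \<open>
  The L2 gradient of the auxiliary functional at \<open>\<psi>\<close>, and its derivative in \<open>\<psi>\<close>.  The parameter \<open>t\<close> is the
  pair of the base point and the direction, which are kept independent: the equation is smooth in both,
  and the dependence of the direction on the base point enters by composition.
\<close>

definition "newton_eq \<psi> t = G \<psi> - (2 * inner (G (fst t + inner (\<iota> (snd t)) (\<iota> (\<psi> - fst t)) *\<^sub>R snd t)) (\<iota> (snd t))) *\<^sub>R \<iota> (snd t)"

definition "newton_deriv \<psi> t = H \<psi>
  - (2 * inner (H (fst t + inner (\<iota> (snd t)) (\<iota> (\<psi> - fst t)) *\<^sub>R snd t) (snd t)) (\<iota> (snd t))) *\<^sub>R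
      (blinfun_scaleR_left (\<iota> (snd t)) o\<^sub>L (blinfun_inner_left (\<iota> (snd t)) o\<^sub>L embed_blinfun))"

lemma has_derivative_H: "((\<lambda>x. blinfun_apply (H \<phi>) x) has_derivative H \<phi>) (at x)"
  by (rule bounded_linear_imp_has_derivative, rule blinfun.bounded_linear_right)

lemma eig_eq_deriv: "((\<lambda>x. eig_eq x \<phi>) has_derivative eig_deriv x \<phi>) (at x)"
  unfolding eig_eq_def
  by (rule has_derivative_eq_rhs,
      rule has_derivative_diff[OF has_derivative_H has_derivative_scaleR[OF has_derivative_inner[OF has_derivative_H]]],
      (rule bounded_linear_imp_has_derivative[OF bounded_linear_embed])+)
     (auto simp: eig_deriv_def fun_eq_iff blinfun.bilinear_simps inner_commute algebra_simps)

lemma newton_eq_deriv: "((\<lambda>\<psi>. newton_eq \<psi> t) has_derivative newton_deriv \<psi> t) (at \<psi>)"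
proof -
  have line: "((\<lambda>\<psi>. fst t + inner (\<iota> (snd t)) (\<iota> (\<psi> - fst t)) *\<^sub>R snd t) has_derivative
      (\<lambda>h. inner (\<iota> (snd t)) (\<iota> h) *\<^sub>R snd t)) (at \<psi>)"
    by (auto intro!: derivative_eq_intros embed.has_derivative)
  have "((\<lambda>\<psi>. inner (G (fst t + inner (\<iota> (snd t)) (\<iota> (\<psi> - fst t)) *\<^sub>R snd t)) (\<iota> (snd t))) has_derivative
      (\<lambda>h. inner (H (fst t + inner (\<iota> (snd t)) (\<iota> (\<psi> - fst t)) *\<^sub>R snd t) (inner (\<iota> (snd t)) (\<iota> h) *\<^sub>R snd t)) (\<iota> (snd t)))) (at \<psi>)"
    using has_derivative_compose[OF line G_deriv] by (rule has_derivative_inner_left)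
  then have "((\<lambda>\<psi>. newton_eq \<psi> t) has_derivative (\<lambda>h. H \<psi> h - (2 *
      inner (H (fst t + inner (\<iota> (snd t)) (\<iota> (\<psi> - fst t)) *\<^sub>R snd t) (inner (\<iota> (snd t)) (\<iota> h) *\<^sub>R snd t)) (\<iota> (snd t))) *\<^sub>R \<iota> (snd t))) (at \<psi>)"
    unfolding newton_eq_def
    by (intro has_derivative_diff G_deriv has_derivative_scaleR_left has_derivative_mult_right)
  then show ?thesis
    by (rule has_derivative_eq_rhs)
       (auto simp: newton_deriv_def fun_eq_iff blinfun.bilinear_simps inner_commute mult.left_commute)
qed

lemma isCont_eig_deriv: "isCont (\<lambda>(x, \<phi>). eig_deriv x \<phi>) y"
proof -
  have H: "isCont (\<lambda>y. H (snd y)) y" for y :: "'x \<times> 'x"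
    by (rule isCont_o2[OF _ H_cont]) (intro continuous_intros)
  show ?thesis unfolding case_prod_beta eig_deriv_def
    by (intro continuous_intros H embed.isCont blinfun.isCont
        bounded_linear.isCont[OF bounded_linear_blinfun_scaleR_left]
        bounded_linear.isCont[OF bounded_linear_blinfun_inner_left]
        bounded_bilinear.isCont[OF bounded_bilinear_blinfun_compose])
qed

lemma isCont_newton_deriv: "isCont (\<lambda>(x, t). newton_deriv x t) y"
proof -
  have H: "isCont (\<lambda>y. H (f y)) y" if "isCont f y" for y :: "'x \<times> 'x \<times> 'x" and f
    by (rule isCont_o2[OF that H_cont])
  show ?thesis unfolding case_prod_beta newton_deriv_def
    by (intro continuous_intros H embed.isCont blinfun.isCont
        bounded_linear.isCont[OF bounded_linear_blinfun_scaleR_left]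
        bounded_linear.isCont[OF bounded_linear_blinfun_inner_left]
        bounded_bilinear.isCont[OF bounded_bilinear_blinfun_compose])
qed

lemma isCont_G: "isCont G x" using G_deriv has_derivative_continuous by blast

lemma inner_Hv0: "inner (H \<phi>s v0) (\<iota> v0) = \<nu>"
proof -
  have "inner (H \<phi>s v0) (\<iota> v0) = inner (Q (H \<phi>s v0)) (\<iota> v0)" using v0(1) by simp
  also have "\<dots> = \<nu>" unfolding v0(2) using v0(3) by (simp add: dot_square_norm)
  finally show ?thesis .
qed

lemma inner_H_v0: "h \<in> X0 \<Longrightarrow> inner (H \<phi>s h) (\<iota> v0) = \<nu> * inner (\<iota> v0) (\<iota> h)"
proof -
  assume h: "h \<in> X0"
  have "inner (H \<phi>s h) (\<iota> v0) = inner (\<iota> h) (Q (H \<phi>s v0))" using h H_sym by simp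
  then show ?thesis unfolding v0(2) by (simp add: inner_commute)
qed

lemma newton_deriv_base: "h \<in> X0 \<Longrightarrow> Q (newton_deriv \<phi>s (\<phi>s, v0) h) = flip h"
  using inner_Hv0 v0
  by (simp add: newton_deriv_def flip_def blinfun.bilinear_simps Q.diff Q.scaleR embed.zero inner_commute)

lemma eig_deriv_base: "h \<in> X0 \<Longrightarrow> Q (eig_deriv v0 \<phi>s h) = flip h + (- \<nu>) *\<^sub>R \<iota> h"
proof -
  assume h: "h \<in> X0"
  have "inner (\<iota> h) (H \<phi>s v0) = \<nu> * inner (\<iota> v0) (\<iota> h)" using inner_H_v0[OF h] H_sym by metis
  then show ?thesis using inner_Hv0 inner_H_v0[OF h] v0 h
    by (simp add: eig_deriv_def flip_def blinfun.bilinear_simps Q.diff Q.scaleR algebra_simps)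
qed

lemma iso_near:
  assumes B: "iso_with C B" and near: "\<And>h. h \<in> X0 \<Longrightarrow> norm (Q (W h) - B h) \<le> 1/2 * norm (B h)"
    and W: "bounded_linear W"
  shows "iso_with (C / (1 - 1/2)) (\<lambda>h. Q (W h))"
proof -
  have "iso_with (C / (1 - 1/2)) (\<lambda>h. B h + (Q (W h) - B h))"
    by (rule neumann_perturbation[OF B])
       (use iso_withD[OF B] near bounded_linear_sub[OF bounded_linear_compose[OF bounded_linear_Q W]] in auto)
  then show ?thesis by simp
qed

text \<open>
  Strict convexity comes from here: by Krein's bound the form of \<open>W\<close> keeps at least half of the
  positive form of \<open>flip\<close>.
\<close>

lemma form_positive_near:
  assumes B: "iso_with C flip" and near: "\<And>h. h \<in> X0 \<Longrightarrow> norm (Q (W h) - flip h) \<le> 1/2 * norm (flip h)"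
    and W: "bounded_linear W" and sym: "\<And>h k. inner (W h) (\<iota> k) = inner (\<iota> h) (W k)"
    and h: "h \<in> X0" "h \<noteq> 0"
  shows "0 < inner (W h) (\<iota> h)"
proof -
  have pos: "0 < inner (flip h) (\<iota> h)" by (rule iso_positive[OF B flip_facts(1,2) h])
  have bl: "bounded_linear (\<lambda>h. Q (W h) - flip h)"
    using iso_withD(2)[OF B] bounded_linear_sub[OF bounded_linear_compose[OF bounded_linear_Q W]] by simp
  have "\<bar>inner (Q (W h) - flip h) (\<iota> h)\<bar> \<le> 1/2 * inner (flip h) (\<iota> h)"
  proof (rule form_bound_of_operator_bound[OF B flip_facts(1,2)])
    show "linear (\<lambda>h. Q (W h) - flip h)" using bl by (rule bounded_linear.linear)
    show "symmetric_form (\<lambda>h. Q (W h) - flip h)"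
      using flip_facts(1) sym by (simp add: symmetric_form_def inner_diff)
    show "\<And>u. u \<in> X0 \<Longrightarrow> Q (W u) - flip u \<in> Y" using iso_withD(3)[OF B] by simp
  qed (use near h in auto)
  then have "\<bar>inner (W h) (\<iota> h) - inner (flip h) (\<iota> h)\<bar> \<le> 1/2 * inner (flip h) (\<iota> h)"
    using h by (simp add: inner_diff_left)
  then show ?thesis using pos by linarith
qed

lemma newton_deriv_sym: "inner (newton_deriv \<psi> t h) (\<iota> k) = inner (\<iota> h) (newton_deriv \<psi> t k)"
  using H_sym[of \<psi> h k]
  by (simp add: newton_deriv_def blinfun.bilinear_simps inner_diff inner_commute)

lemma eig_eq_differentiable:
  assumes "H differentiable (at \<phi> within S)"
  shows "(\<lambda>y. eig_eq (fst y) (snd y)) differentiable (at (x, \<phi>) within UNIV \<times> S)"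
proof -
  obtain H' where H': "(H has_derivative H') (at \<phi> within S)" using assms by (auto simp: differentiable_def)
  have "((\<lambda>y. H (snd y)) has_derivative (\<lambda>h. H' (snd h))) (at (x, \<phi>) within UNIV \<times> S)"
  proof (rule has_derivative_in_compose[where g = H])
    show "(snd has_derivative snd) (at (x, \<phi>) within UNIV \<times> S)" by (intro derivative_eq_intros) auto
    show "(H has_derivative H') (at (snd (x, \<phi>)) within snd ` (UNIV \<times> S))"
      by (rule has_derivative_subset[of _ _ _ S]) (use H' in auto)
  qed
  from blinfun.FDERIV[OF this has_derivative_fst[OF has_derivative_ident]]
  have Hx: "((\<lambda>y. H (snd y) (fst y)) has_derivative (\<lambda>h. H (snd (x, \<phi>)) (fst h) + H' (snd h) (fst (x, \<phi>)))) (at (x, \<phi>) within UNIV \<times> S)" .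
  have \<iota>x: "((\<lambda>y. \<iota> (fst y)) has_derivative (\<lambda>h. \<iota> (fst h))) (at (x, \<phi>) within UNIV \<times> S)"
    by (intro embed.has_derivative derivative_eq_intros) auto
  show ?thesis unfolding eig_eq_def differentiable_def
    by (rule exI, rule has_derivative_diff[OF Hx has_derivative_scaleR[OF has_derivative_inner[OF Hx \<iota>x] \<iota>x]])
qed

lemma newton_eq_differentiable:
  assumes "g differentiable (at \<phi> within S)"
  shows "(\<lambda>y. newton_eq (fst y) (snd y, g (snd y))) differentiable (at (x, \<phi>) within UNIV \<times> S)"
proof -
  let ?F = "at (x, \<phi>) within UNIV \<times> S"
  obtain g' where g': "(g has_derivative g') (at \<phi> within S)" using assms by (auto simp: differentiable_def)
  have g: "((\<lambda>y. g (snd y)) has_derivative (\<lambda>h. g' (snd h))) ?F"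
  proof (rule has_derivative_in_compose[where f = snd and f' = snd and g = g and g' = g'])
    show "(snd has_derivative snd) (at (x, \<phi>) within UNIV \<times> S)" by (intro derivative_eq_intros) auto
    show "(g has_derivative g') (at (snd (x, \<phi>)) within snd ` (UNIV \<times> S))"
      by (rule has_derivative_subset[of _ _ _ S]) (use g' in auto)
  qed
  note \<iota>g = embed.has_derivative[OF g]
  have f: "(fst has_derivative fst) ?F" and s: "(snd has_derivative snd) ?F"
    using has_derivative_fst[OF has_derivative_ident] has_derivative_snd[OF has_derivative_ident] by auto
  note line = has_derivative_add[OF s has_derivative_scaleR[OF
     has_derivative_inner[OF \<iota>g embed.has_derivative[OF has_derivative_diff[OF f s]]] g]]
  show ?thesis unfolding newton_eq_def differentiable_def fst_conv snd_conv
    by (rule exI, rule has_derivative_diff[OF has_derivative_compose[OF f G_deriv]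
        has_derivative_scaleR[OF has_derivative_mult_right[OF has_derivative_inner[OF
          has_derivative_compose[OF line G_deriv] \<iota>g]] \<iota>g]])
qed

end

section \<open>Minimal directions near the saddle\<close>

context saddle_problem begin

text \<open>
  The implicit function theorem for \<open>eig_eq\<close>.  Differentiability is stated relative to sets \<open>S\<close>, since later
  \<open>H\<close> is known to be differentiable only relative to a neighbourhood within the affine class \<open>V\<close>.
\<close>

lemma eigen_branch:
  obtains g \<delta> where "0 < \<delta>" "g \<phi>s = v0" "isCont g \<phi>s"
    "\<And>\<phi>. \<phi> \<in> cball \<phi>s \<delta> \<Longrightarrow> g \<phi> \<in> X0 \<and> norm (\<iota> (g \<phi>)) = 1 \<and>
        Q (H \<phi> (g \<phi>)) = inner (H \<phi> (g \<phi>)) (\<iota> (g \<phi>)) *\<^sub>R \<iota> (g \<phi>) \<and> inner (H \<phi> (g \<phi>)) (\<iota> (g \<phi>)) < 0"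
    "\<And>S \<phi>. S \<subseteq> cball \<phi>s \<delta> \<Longrightarrow> \<phi> \<in> S \<Longrightarrow> H differentiable (at \<phi> within S) \<Longrightarrow> g differentiable (at \<phi> within S)"
proof -
  obtain C where C: "iso_with C flip" using flip_facts(3) by blast
  define B where "B u = flip u + (- \<nu>) *\<^sub>R \<iota> u" for u
  have B: "iso_with C B" unfolding B_def
    by (rule iso_shift[OF C flip_facts(2)]) (use \<nu>_neg in simp)
  have C0: "0 < C" by (rule iso_withD[OF C])
  have M0: "Q (eig_eq v0 \<phi>s) = 0"
    using v0(1,2) inner_Hv0 by (simp add: eig_eq_def Q.diff Q.scaleR)
  have contM: "isCont (eig_eq v0) \<phi>s"
    unfolding eig_eq_def[abs_def]
    by (intro continuous_intros H_cont bounded_linear.isCont[OF blinfun.bounded_linear_left])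
  have base: "Q (eig_deriv v0 \<phi>s h) = B h" if "h \<in> X0" for h
    using eig_deriv_base[OF that] by (simp add: B_def)
  obtain r0 where r0: "solvable_near eig_eq v0 \<phi>s C r0"
    and near: "\<forall>x\<in>cball v0 r0. \<forall>\<phi>\<in>cball \<phi>s r0. \<forall>h\<in>X0. norm (Q (eig_deriv x \<phi> h) - B h) \<le> 1/2 * norm (B h)"
    using implicit_solution[OF eig_eq_deriv isCont_eig_deriv M0 contM B base] by blast
  have r0_pos: "0 < r0"
    and inj: "\<And>x x' \<phi>. x \<in> cball v0 r0 \<Longrightarrow> x' \<in> cball v0 r0 \<Longrightarrow> \<phi> \<in> cball \<phi>s r0 \<Longrightarrow> x - x' \<in> X0 \<Longrightarrow>
      norm (x - x') \<le> 2 * C * norm (Q (eig_eq x \<phi>) - Q (eig_eq x' \<phi>))"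
    and solve: "\<And>r. 0 < r \<Longrightarrow> r \<le> r0 \<Longrightarrow>
      \<exists>\<delta>>0. \<forall>\<phi>\<in>cball \<phi>s \<delta>. \<exists>x\<in>cball v0 r. x - v0 \<in> X0 \<and> Q (eig_eq x \<phi>) = 0"
    using r0 unfolding solvable_near_def by auto
  have "isCont (\<lambda>y. inner (H (snd y) (fst y)) (\<iota> (fst y))) (v0, \<phi>s)"
    by (intro continuous_intros blinfun.isCont embed.isCont isCont_o2[OF _ H_cont])
  then have "\<exists>d>0. \<forall>y. dist y (v0, \<phi>s) < d \<longrightarrow> dist (inner (H (snd y) (fst y)) (\<iota> (fst y))) \<nu> < - \<nu>"
    using \<nu>_neg inner_Hv0 unfolding continuous_at_eps_delta by simp
  then obtain d where d: "0 < d" "\<And>y. dist y (v0, \<phi>s) < d \<Longrightarrow> dist (inner (H (snd y) (fst y)) (\<iota> (fst y))) \<nu> < - \<nu>"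
    by blast
  \<comment> \<open>Within distance \<open>d\<close> the Rayleigh quotient stays negative, so solutions are genuine unit
    eigenvectors; a quarter of it for \<open>x\<close> and for \<open>\<phi>\<close> each keeps the pair closer than \<open>d\<close>.\<close>
  define r where "r = min r0 (d / 4)"
  have r: "0 < r" "r \<le> r0" using r0_pos d by (auto simp: r_def)
  obtain \<delta>' where \<delta>': "0 < \<delta>'" "\<And>\<phi>. \<phi> \<in> cball \<phi>s \<delta>' \<Longrightarrow> \<exists>x. x \<in> cball v0 r \<and> x - v0 \<in> X0 \<and> Q (eig_eq x \<phi>) = 0"
    using solve[OF r] by blast
  define \<delta> where "\<delta> = min \<delta>' r"
  have \<delta>: "0 < \<delta>" "\<delta> \<le> \<delta>'" "\<delta> \<le> r" using \<delta>' r by (auto simp: \<delta>_def)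
  define g where "g \<phi> = (SOME x. x \<in> cball v0 r \<and> x - v0 \<in> X0 \<and> Q (eig_eq x \<phi>) = 0)" for \<phi>
  have g: "g \<phi> \<in> cball v0 r" "g \<phi> - v0 \<in> X0" "Q (eig_eq (g \<phi>) \<phi>) = 0" if "\<phi> \<in> cball \<phi>s \<delta>" for \<phi>
    using someI_ex[OF \<delta>'(2), of \<phi>] that \<delta> unfolding g_def by auto
  have gX: "g \<phi> \<in> X0" if "\<phi> \<in> cball \<phi>s \<delta>" for \<phi>
    using g(2)[OF that] v0(1) X0_closed_ops(2)[of "g \<phi> - v0" v0] by simp
  have ball: "cball v0 r \<subseteq> cball v0 r0" "cball \<phi>s \<delta> \<subseteq> cball \<phi>s r0" using r \<delta> by auto
  have lip: "norm (g \<phi> - g \<phi>') \<le> 2 * C * norm (Q (eig_eq (g \<phi>') \<phi>))"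
    if "\<phi> \<in> cball \<phi>s \<delta>" "\<phi>' \<in> cball \<phi>s \<delta>" for \<phi> \<phi>'
  proof -
    have "g \<phi> - g \<phi>' \<in> X0" using gX that by simp
    moreover have "g \<phi> \<in> cball v0 r0" "g \<phi>' \<in> cball v0 r0" "\<phi> \<in> cball \<phi>s r0"
      using subsetD[OF ball(1) g(1)[OF that(1)]] subsetD[OF ball(1) g(1)[OF that(2)]] subsetD[OF ball(2) that(1)]
      by auto
    ultimately show ?thesis using inj[of "g \<phi>" "g \<phi>'" \<phi>] g(3)[OF that(1)] by simp
  qed
  have lip0: "norm (g \<phi> - v0) \<le> 2 * C * norm (Q (eig_eq v0 \<phi>))" if "\<phi> \<in> cball \<phi>s \<delta>" for \<phi>
  proof -
    have "g \<phi> \<in> cball v0 r0" "v0 \<in> cball v0 r0" "\<phi> \<in> cball \<phi>s r0"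
      using subsetD[OF ball(1) g(1)[OF that]] subsetD[OF ball(2) that] r0_pos by auto
    then show ?thesis using inj[of "g \<phi>" v0 \<phi>] g(2,3)[OF that] by simp
  qed
  have g0: "g \<phi>s = v0" using lip0[of \<phi>s] \<delta> M0 by simp
  show ?thesis
  proof (rule that[of \<delta> g, OF \<delta>(1) g0])
    show "isCont g \<phi>s" unfolding isCont_def
    proof (rule LIM_zero_cancel, rule Lim_null_comparison)
      have "eventually (\<lambda>\<phi>. \<phi> \<in> ball \<phi>s \<delta>) (at \<phi>s)"
        using \<delta>(1) by (intro eventually_at_in_open') auto
      then show "eventually (\<lambda>\<phi>. norm (g \<phi> - g \<phi>s) \<le> 2 * C * norm (Q (eig_eq v0 \<phi>))) (at \<phi>s)"
        by eventually_elim (use lip0 g0 in auto)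
      have "isCont (\<lambda>\<phi>. 2 * C * norm (Q (eig_eq v0 \<phi>))) \<phi>s"
        by (intro continuous_intros Q.isCont contM)
      then show "((\<lambda>\<phi>. 2 * C * norm (Q (eig_eq v0 \<phi>))) \<longlongrightarrow> 0) (at \<phi>s)"
        unfolding isCont_def using M0 by simp
    qed
  next
    fix \<phi> assume \<phi>: "\<phi> \<in> cball \<phi>s \<delta>"
    define c where "c = inner (H \<phi> (g \<phi>)) (\<iota> (g \<phi>))"
    have "dist (g \<phi>, \<phi>) (v0, \<phi>s) \<le> dist (g \<phi>) v0 + dist \<phi> \<phi>s"
      unfolding dist_Pair_Pair by (rule sqrt_sum_squares_le_sum) auto
    also have "\<dots> < d" using g(1)[OF \<phi>] \<phi> \<delta> d by (simp add: r_def dist_commute)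
    finally have neg: "c < 0" using d(2)[of "(g \<phi>, \<phi>)"] by (simp add: c_def dist_real_def)
    have eig: "Q (H \<phi> (g \<phi>)) = c *\<^sub>R \<iota> (g \<phi>)"
      using g(3)[OF \<phi>] gX[OF \<phi>] by (simp add: eig_eq_def c_def Q.diff Q.scaleR)
    have "c = inner (Q (H \<phi> (g \<phi>))) (\<iota> (g \<phi>))" using gX[OF \<phi>] by (simp add: c_def)
    also have "\<dots> = c * (norm (\<iota> (g \<phi>)))\<^sup>2" unfolding eig by (simp add: dot_square_norm)
    finally have "(norm (\<iota> (g \<phi>)))\<^sup>2 = 1" using neg by simp
    then have "norm (\<iota> (g \<phi>)) = 1" by (simp add: power2_eq_1_iff) (metis norm_ge_zero not_one_le_zero neg_0_le_iff_le)
    then show "g \<phi> \<in> X0 \<and> norm (\<iota> (g \<phi>)) = 1 \<and>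
        Q (H \<phi> (g \<phi>)) = inner (H \<phi> (g \<phi>)) (\<iota> (g \<phi>)) *\<^sub>R \<iota> (g \<phi>) \<and> inner (H \<phi> (g \<phi>)) (\<iota> (g \<phi>)) < 0"
      using gX[OF \<phi>] eig neg by (simp add: c_def)
  next
    fix S \<phi> assume S: "S \<subseteq> cball \<phi>s \<delta>" "\<phi> \<in> S" and H: "H differentiable (at \<phi> within S)"
    show "g differentiable (at \<phi> within S)"
    proof (rule differentiable_implicit[OF eig_eq_differentiable[OF H] eig_eq_deriv S(2)])
      have sD: "s \<in> cball \<phi>s \<delta>" if "s \<in> S" for s using subsetD[OF S(1) that] .
      note \<phi> = sD[OF S(2)]
      show "Q (eig_eq (g s) s) = 0" if "s \<in> S" for s by (rule g(3)[OF sD[OF that]])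
      show "g s - g \<phi> \<in> X0" if "s \<in> S" for s
        by (rule X0_closed_ops(3)[OF gX[OF sD[OF that]] gX[OF \<phi>]])
      show "norm (g s - g \<phi>) \<le> 2 * C * norm (Q (eig_eq (g \<phi>) s))" if "s \<in> S" for s
        by (rule lip[OF sD[OF that] \<phi>])
      have "g \<phi> \<in> cball v0 r0" "\<phi> \<in> cball \<phi>s r0"
        using subsetD[OF ball(1) g(1)[OF \<phi>]] subsetD[OF ball(2) \<phi>] by auto
      then have "norm (Q (eig_deriv (g \<phi>) \<phi> h) - B h) \<le> 1/2 * norm (B h)" if "h \<in> X0" for h
        using near that by blast
      then show "iso_with (C / (1 - 1/2)) (\<lambda>h. Q (eig_deriv (g \<phi>) \<phi> h))"
        by (rule iso_near[OF B _ blinfun.bounded_linear_right])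
    qed
  qed
qed

definition "min_dir \<phi> = is_arg_min (\<lambda>u. inner (\<iota> u) (Q (H \<phi> (p u)))) (\<lambda>u. u \<in> X0 \<and> norm (\<iota> u) = 1)"

text \<open>
  Split \<open>u = w + s g\<close> with \<open>w\<close> orthogonal to \<open>g\<close>.  The form has no cross term, the part \<open>s\<^sup>2 \<mu>\<close> is at least
  \<open>\<mu>\<close> because \<open>\<mu>\<close> is negative and \<open>s\<^sup>2 \<le> 1\<close>, and the part in \<open>w\<close> is positive unless \<open>w = 0\<close>.
\<close>

lemma min_dir_eigenvector:
  assumes g: "g \<in> X0" "norm (\<iota> g) = 1" "Q (H \<phi> g) = \<mu> *\<^sub>R \<iota> g" "\<mu> < 0"
    and pos: "\<And>h. h \<in> X0 \<Longrightarrow> h \<noteq> 0 \<Longrightarrow> inner (\<iota> g) (\<iota> h) = 0 \<Longrightarrow> 0 < inner (H \<phi> h) (\<iota> h)"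
  shows "min_dir \<phi> g" "\<And>u. min_dir \<phi> u \<Longrightarrow> u = g \<or> u = - g"
proof -
  have gg: "inner (\<iota> g) (\<iota> g) = 1" using g by (simp add: dot_square_norm)
  have val: "inner (\<iota> u) (Q (H \<phi> (p u))) = inner (H \<phi> u) (\<iota> u)" if "u \<in> X0" for u
    using that by (simp add: inner_commute)
  have Hg: "inner (H \<phi> g) (\<iota> u) = \<mu> * inner (\<iota> g) (\<iota> u)" if "u \<in> X0" for u
    by (metis g(3) inner_Q embed_in_Y that inner_scaleR_left)
  have ge: "\<mu> \<le> inner (H \<phi> u) (\<iota> u) \<and> (inner (H \<phi> u) (\<iota> u) = \<mu> \<longrightarrow> u = g \<or> u = - g)"
    if u: "u \<in> X0" "norm (\<iota> u) = 1" for u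
  proof -
    define s where "s = inner (\<iota> g) (\<iota> u)"
    define w where "w = u - s *\<^sub>R g"
    have w: "w \<in> X0" "u = w + s *\<^sub>R g" using u g by (auto simp: w_def)
    have orth: "inner (\<iota> g) (\<iota> w) = 0"
      using gg by (simp add: w_def embed.diff embed.scaleR inner_diff_right) (simp add: s_def)
    have cross: "inner (H \<phi> g) (\<iota> w) = 0" "inner (H \<phi> w) (\<iota> g) = 0"
      using Hg[OF w(1)] orth H_sym[of \<phi> w g] by (auto simp: inner_commute)
    have eq: "inner (H \<phi> u) (\<iota> u) = inner (H \<phi> w) (\<iota> w) + s\<^sup>2 * \<mu>"
      using cross Hg[OF g(1)] gg unfolding w(2)
      by (simp add: blinfun.bilinear_simps embed.add embed.scaleR inner_add power2_eq_square)
    have "inner (\<iota> u) (\<iota> u) = inner (\<iota> w) (\<iota> w) + s\<^sup>2"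
      using orth gg unfolding w(2)
      by (simp add: embed.add embed.scaleR inner_add inner_commute power2_eq_square)
    then have one: "1 = (norm (\<iota> w))\<^sup>2 + s\<^sup>2" using u by (simp add: dot_square_norm)
    then have "s\<^sup>2 \<le> 1" using zero_le_power2[of "norm (\<iota> w)"] by linarith
    then have le: "\<mu> \<le> s\<^sup>2 * \<mu>" using g(4) mult_right_mono_neg[of "s\<^sup>2" 1 \<mu>] by simp
    show ?thesis
    proof (cases "w = 0")
      case True
      then have "s\<^sup>2 = 1" using one by (simp add: embed.zero)
      then have "s = 1 \<or> s = - 1" by (simp add: power2_eq_1_iff)
      then show ?thesis using le eq True w(2) by (auto simp: embed.zero)
    next
      case False
      then have "0 < inner (H \<phi> w) (\<iota> w)" using pos w(1) orth by blast
      then show ?thesis using eq le by simp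
    qed
  qed
  have g_val: "inner (H \<phi> g) (\<iota> g) = \<mu>" using Hg[OF g(1)] gg by simp
  show "min_dir \<phi> g"
    unfolding min_dir_def is_arg_min_def
  proof (intro conjI notI g(1,2))
    assume "\<exists>y. (y \<in> X0 \<and> norm (\<iota> y) = 1) \<and>
        inner (\<iota> y) (Q (H \<phi> (p y))) < inner (\<iota> g) (Q (H \<phi> (p g)))"
    then obtain y where "y \<in> X0" "norm (\<iota> y) = 1" "inner (H \<phi> y) (\<iota> y) < \<mu>"
      using val g_val g(1) by auto
    then show False using ge[of y] by simp
  qed
  fix u assume u: "min_dir \<phi> u"
  then have u': "u \<in> X0" "norm (\<iota> u) = 1" by (auto simp: min_dir_def is_arg_min_def)
  have "\<not> inner (H \<phi> g) (\<iota> g) < inner (H \<phi> u) (\<iota> u)"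
    using u g val u'(1) unfolding min_dir_def is_arg_min_def by auto
  then have "inner (H \<phi> u) (\<iota> u) = \<mu>" using ge[OF u'] g_val by simp
  then show "u = g \<or> u = - g" using ge[OF u'] by blast
qed

definition "aux \<phi> g \<psi> = F \<psi> - 2 * F (\<phi> + inner (\<iota> g) (\<iota> (\<psi> - \<phi>)) *\<^sub>R g)"

text \<open>
  The minimal direction is determined only up to sign.
\<close>

lemma aux_uminus [simp]: "aux \<phi> (- g) = aux \<phi> g"
  by (simp add: aux_def fun_eq_iff embed.neg)

lemma aux_deriv: "(aux \<phi> g has_derivative (\<lambda>h. inner (newton_eq \<psi> (\<phi>, g)) (\<iota> h))) (at \<psi>)"
proof -
  have line: "((\<lambda>\<psi>. \<phi> + inner (\<iota> g) (\<iota> (\<psi> - \<phi>)) *\<^sub>R g) has_derivative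
      (\<lambda>h. inner (\<iota> g) (\<iota> h) *\<^sub>R g)) (at \<psi>)"
    by (auto intro!: derivative_eq_intros embed.has_derivative)
  show ?thesis unfolding aux_def[abs_def]
    by (rule has_derivative_eq_rhs,
        rule has_derivative_diff[OF F_deriv has_derivative_mult_right[OF has_derivative_compose[OF line F_deriv]]])
       (simp add: newton_eq_def fun_eq_iff inner_diff_left embed.scaleR)
qed

text \<open>
  The reason for the quadratic rate.  For \<open>\<psi> = \<phi>s\<close> the reflected point is \<open>\<phi>s + w\<close>, where \<open>w\<close> is the part of
  \<open>\<phi> - \<phi>s\<close> orthogonal to \<open>g\<close>, and the gradient is \<open>- 2 \<langle>G (\<phi>s + w), g\<rangle> g\<close>.  The expected first-order term
  \<open>\<langle>H \<phi> w, g\<rangle>\<close> vanishes since \<open>g\<close> is an eigenvector of \<open>H \<phi>\<close>.  What remains is the oscillation \<open>\<eta>\<close> of \<open>H\<close>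
  times \<open>|w|\<close>: it is \<open>o(|\<phi> - \<phi>s|)\<close> for continuous \<open>H\<close>, and quadratic if \<open>H\<close> is differentiable at
  the saddle.
\<close>

lemma newton_eq_at_saddle:
  assumes g: "g \<in> X0" "norm (\<iota> g) = 1" "Q (H \<phi> g) = \<mu> *\<^sub>R \<iota> g"
    and \<phi>: "\<phi> - \<phi>s \<in> X0"
    and L: "\<And>u. norm (\<iota> u) \<le> norm u * L" "0 \<le> L" and gK: "norm g \<le> K'"
    and K: "K = 1 + L * K'"
    and osc: "\<And>z. z - \<phi>s \<in> X0 \<Longrightarrow> norm (z - \<phi>s) \<le> K * norm (\<phi> - \<phi>s) \<Longrightarrow> norm (H z - H \<phi>s) \<le> \<eta>"
  shows "norm (Q (newton_eq \<phi>s (\<phi>, g))) \<le> 4 * \<eta> * K * norm (\<phi> - \<phi>s)"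
proof -
  define e where "e = \<phi> - \<phi>s"
  define w where "w = e - inner (\<iota> g) (\<iota> e) *\<^sub>R g"
  have K'0: "0 \<le> K'" using gK norm_ge_zero order_trans by blast
  have K1: "1 \<le> K" using K L K'0 by simp
  have gg: "inner (\<iota> g) (\<iota> g) = 1" using g by (simp add: dot_square_norm)
  have wX: "w \<in> X0" using \<phi> g by (simp add: w_def e_def)
  have "\<bar>inner (\<iota> g) (\<iota> e)\<bar> \<le> norm e * L"
    using order_trans[OF Cauchy_Schwarz_ineq2[of "\<iota> g" "\<iota> e"]] L(1)[of e] g by simp
  then have "\<bar>inner (\<iota> g) (\<iota> e)\<bar> * norm g \<le> norm e * L * K'"
    using gK L(2) by (intro mult_mono) auto
  then have w_norm: "norm w \<le> K * norm e"
    using norm_triangle_ineq4[of e "inner (\<iota> g) (\<iota> e) *\<^sub>R g"] by (simp add: w_def K algebra_simps)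
  have orth: "inner (\<iota> g) (\<iota> w) = 0" using gg by (simp add: w_def embed.diff embed.scaleR inner_diff_right)
  have \<eta>0: "0 \<le> \<eta>" using osc[of \<phi>s] K1 by (simp add: order_trans[OF norm_ge_zero])
  have "norm ((G (\<phi>s + w) - H \<phi>s (\<phi>s + w)) - (G \<phi>s - H \<phi>s \<phi>s)) \<le> \<eta> * norm ((\<phi>s + w) - \<phi>s)"
  proof (rule differentiable_bound[of "{z. z - \<phi>s \<in> X0 \<and> norm (z - \<phi>s) \<le> K * norm e}" _ "\<lambda>z. blinfun_apply (H z - H \<phi>s)"])
    have "{z. z - \<phi>s \<in> X0 \<and> norm (z - \<phi>s) \<le> K * norm e} = (\<lambda>z. z - \<phi>s) -` X0 \<inter> cball \<phi>s (K * norm e)"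
      by (auto simp: dist_norm norm_minus_commute)
    moreover have "convex ((\<lambda>z. z - \<phi>s) -` X0)"
    proof -
      have "(\<lambda>z. z - \<phi>s) -` X0 = (+) \<phi>s ` X0"
        by (auto simp: image_iff) (metis add_diff_cancel_left' diff_add_cancel add.commute)
      then show ?thesis using convex_translation[OF subspace_imp_convex[OF X0_subspace], of \<phi>s] by simp
    qed
    ultimately show "convex {z. z - \<phi>s \<in> X0 \<and> norm (z - \<phi>s) \<le> K * norm e}" by (simp add: convex_Int)
    fix z assume z: "z \<in> {z. z - \<phi>s \<in> X0 \<and> norm (z - \<phi>s) \<le> K * norm e}"
    show "((\<lambda>z. G z - H \<phi>s z) has_derivative blinfun_apply (H z - H \<phi>s)) (at z within {z. z - \<phi>s \<in> X0 \<and> norm (z - \<phi>s) \<le> K * norm e})"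
      by (rule has_derivative_at_withinI, rule has_derivative_eq_rhs, rule has_derivative_diff[OF G_deriv has_derivative_H])
         (auto simp: blinfun.diff_left)
    show "onorm (blinfun_apply (H z - H \<phi>s)) \<le> \<eta>"
      using osc[of z] z by (simp add: norm_blinfun.rep_eq[symmetric] e_def)
  qed (use wX w_norm K1 in \<open>auto simp: zero_le_mult_iff\<close>)
  then have 1: "norm (G (\<phi>s + w) - G \<phi>s - H \<phi>s w) \<le> \<eta> * norm w"
    by (simp add: blinfun.add_right algebra_simps)
  have "norm (H \<phi> - H \<phi>s) \<le> \<eta>"
    using osc[OF \<phi>] K1 by (simp add: mult_le_cancel_right1)
  then have 2: "norm ((H \<phi> - H \<phi>s) w) \<le> \<eta> * norm w"
    using norm_blinfun[of "H \<phi> - H \<phi>s" w] by (meson mult_right_mono norm_ge_zero order_trans)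
  have "inner (H \<phi> w) (\<iota> g) = inner (\<iota> w) (Q (H \<phi> g))" using wX H_sym by simp
  also have "\<dots> = 0" unfolding g(3) using orth by (simp add: inner_commute)
  finally have z1: "inner (H \<phi> w) (\<iota> g) = 0" .
  have z2: "inner (G \<phi>s) (\<iota> g) = 0"
    using stationary g(1) inner_Q[of "\<iota> g" "G \<phi>s"] by simp
  have "inner (G (\<phi>s + w)) (\<iota> g) = inner (G (\<phi>s + w) - G \<phi>s - H \<phi>s w) (\<iota> g) - inner ((H \<phi> - H \<phi>s) w) (\<iota> g)"
    using z1 z2 by (simp add: inner_diff_left blinfun.diff_left)
  moreover have "\<bar>inner (G (\<phi>s + w) - G \<phi>s - H \<phi>s w) (\<iota> g)\<bar> \<le> \<eta> * norm w"
    using Cauchy_Schwarz_ineq2[of "G (\<phi>s + w) - G \<phi>s - H \<phi>s w" "\<iota> g"] 1 unfolding g(2) by linarith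
  moreover have "\<bar>inner ((H \<phi> - H \<phi>s) w) (\<iota> g)\<bar> \<le> \<eta> * norm w"
    using Cauchy_Schwarz_ineq2[of "(H \<phi> - H \<phi>s) w" "\<iota> g"] 2 unfolding g(2) by linarith
  ultimately have G: "\<bar>inner (G (\<phi>s + w)) (\<iota> g)\<bar> \<le> 2 * (\<eta> * norm w)" by linarith
  have pt: "\<phi> + inner (\<iota> g) (\<iota> (\<phi>s - \<phi>)) *\<^sub>R g = \<phi>s + w"
  proof -
    have "inner (\<iota> g) (\<iota> (\<phi>s - \<phi>)) = - inner (\<iota> g) (\<iota> e)"
      by (simp add: e_def embed.diff inner_diff_right)
    then show ?thesis by (simp add: w_def e_def)
  qed
  have "Q (newton_eq \<phi>s (\<phi>, g)) = - (2 * inner (G (\<phi>s + w)) (\<iota> g)) *\<^sub>R \<iota> g"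
    using g(1) stationary by (simp add: newton_eq_def pt Q.diff Q.scaleR)
  then have "norm (Q (newton_eq \<phi>s (\<phi>, g))) = 2 * \<bar>inner (G (\<phi>s + w)) (\<iota> g)\<bar>"
    using g(2) by (simp add: abs_mult)
  also have "\<dots> \<le> 4 * (\<eta> * norm w)" using G by simp
  also have "\<dots> \<le> 4 * (\<eta> * (K * norm e))" using w_norm \<eta>0 by (intro mult_left_mono) auto
  finally show ?thesis by (simp add: e_def mult.assoc)
qed

end

section \<open>The minimizer map\<close>

context saddle_problem begin

definition "V = {\<phi>. \<phi> - \<phi>s \<in> X0}"

lemma convex_V: "convex V"
proof -
  have "V = (+) \<phi>s ` X0"
    by (auto simp: V_def image_iff) (metis add_diff_cancel_left' diff_add_cancel add.commute)
  then show ?thesis using convex_translation[OF subspace_imp_convex[OF X0_subspace], of \<phi>s] by simp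
qed

lemma V_diff: "x \<in> V \<Longrightarrow> y \<in> V \<Longrightarrow> x - y \<in> X0"
  using X0_closed_ops(3)[of "x - \<phi>s" "y - \<phi>s"] by (simp add: V_def)

text \<open>
  The zero \<open>\<Psi> \<phi>\<close> of the gradient is at most half as far from the saddle as \<open>\<phi>\<close>, which lets one
  and the same ball serve for the base points and for the minimizers.  The estimate with a free oscillation bound
  \<open>\<eta>\<close> is applied twice: with \<open>\<eta>\<close> arbitrarily small it shows that the derivative of \<open>\<Psi>\<close> at the saddle is zero, and
  with \<open>\<eta>\<close> proportional to \<open>|\<phi> - \<phi>s|\<close> it gives the quadratic rate.
\<close>

lemma local_structure:
  obtains \<rho> g \<Psi> c where "0 < \<rho>" "0 < c"
    "\<And>\<phi>. \<phi> \<in> V \<inter> ball \<phi>s \<rho> \<Longrightarrow> g \<phi> \<in> X0 \<and> norm (\<iota> (g \<phi>)) = 1 \<and> min_dir \<phi> (g \<phi>) \<and> (\<forall>u. min_dir \<phi> u \<longrightarrow> u = g \<phi> \<or> u = - g \<phi>)"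
    "\<And>\<phi> x y. \<phi> \<in> V \<inter> ball \<phi>s \<rho> \<Longrightarrow> x \<in> V \<inter> ball \<phi>s \<rho> \<Longrightarrow> y \<in> V \<inter> ball \<phi>s \<rho> \<Longrightarrow> x \<noteq> y \<Longrightarrow>
        inner (newton_eq x (\<phi>, g \<phi>)) (\<iota> (y - x)) < inner (newton_eq y (\<phi>, g \<phi>)) (\<iota> (y - x))"
    "\<And>\<phi>. \<phi> \<in> V \<inter> ball \<phi>s \<rho> \<Longrightarrow> \<Psi> \<phi> \<in> V \<and> norm (\<Psi> \<phi> - \<phi>s) \<le> 1/2 * norm (\<phi> - \<phi>s) \<and> Q (newton_eq (\<Psi> \<phi>) (\<phi>, g \<phi>)) = 0"
    "\<And>\<phi> \<eta>. \<phi> \<in> V \<inter> ball \<phi>s \<rho> \<Longrightarrow> (\<And>z. z \<in> V \<Longrightarrow> norm (z - \<phi>s) \<le> c * norm (\<phi> - \<phi>s) \<Longrightarrow> norm (H z - H \<phi>s) \<le> \<eta>) \<Longrightarrow>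
        norm (\<Psi> \<phi> - \<phi>s) \<le> c * \<eta> * norm (\<phi> - \<phi>s)"
    "H differentiable_on (V \<inter> ball \<phi>s \<rho>) \<Longrightarrow> \<Psi> differentiable_on (V \<inter> ball \<phi>s \<rho>)"
proof -
  obtain C where C: "iso_with C flip" using flip_facts(3) by blast
  have C0: "0 < C" by (rule iso_withD[OF C])
  obtain g \<delta> where \<delta>: "0 < \<delta>" and g0: "g \<phi>s = v0" and g_cont: "isCont g \<phi>s"
    and g: "\<And>\<phi>. \<phi> \<in> cball \<phi>s \<delta> \<Longrightarrow> g \<phi> \<in> X0 \<and> norm (\<iota> (g \<phi>)) = 1 \<and>
        Q (H \<phi> (g \<phi>)) = inner (H \<phi> (g \<phi>)) (\<iota> (g \<phi>)) *\<^sub>R \<iota> (g \<phi>) \<and> inner (H \<phi> (g \<phi>)) (\<iota> (g \<phi>)) < 0"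
    and g_diff: "\<And>S \<phi>. S \<subseteq> cball \<phi>s \<delta> \<Longrightarrow> \<phi> \<in> S \<Longrightarrow> H differentiable (at \<phi> within S) \<Longrightarrow> g differentiable (at \<phi> within S)"
    by (rule eigen_branch) blast
  have z2: "inner (G \<phi>s) (\<iota> v0) = 0"
    using stationary v0(1) inner_Q[of "\<iota> v0" "G \<phi>s"] by simp
  have M0: "Q (newton_eq \<phi>s (\<phi>s, v0)) = 0"
    using z2 stationary by (simp add: newton_eq_def embed.zero Q.diff Q.scaleR)
  have contM: "isCont (newton_eq \<phi>s) (\<phi>s, v0)"
    unfolding newton_eq_def[abs_def]
    by (intro continuous_intros embed.isCont isCont_o2[OF _ isCont_G])
  obtain r where r: "solvable_near newton_eq \<phi>s (\<phi>s, v0) C r"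
    and near: "\<forall>x\<in>cball \<phi>s r. \<forall>t\<in>cball (\<phi>s, v0) r. \<forall>h\<in>X0. norm (Q (newton_deriv x t h) - flip h) \<le> 1/2 * norm (flip h)"
    using implicit_solution[OF newton_eq_deriv isCont_newton_deriv M0 contM C newton_deriv_base] by blast
  have r_pos: "0 < r"
    and inj: "\<And>x x' t. x \<in> cball \<phi>s r \<Longrightarrow> x' \<in> cball \<phi>s r \<Longrightarrow> t \<in> cball (\<phi>s, v0) r \<Longrightarrow> x - x' \<in> X0 \<Longrightarrow>
      norm (x - x') \<le> 2 * C * norm (Q (newton_eq x t) - Q (newton_eq x' t))"
    and solve: "\<exists>\<delta>>0. \<forall>t\<in>cball (\<phi>s, v0) \<delta>. \<exists>x\<in>cball \<phi>s r. x - \<phi>s \<in> X0 \<and> Q (newton_eq x t) = 0"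
    using r unfolding solvable_near_def by auto
  obtain \<delta>' where \<delta>': "0 < \<delta>'" "\<And>t. t \<in> cball (\<phi>s, v0) \<delta>' \<Longrightarrow> \<exists>x. x \<in> cball \<phi>s r \<and> x - \<phi>s \<in> X0 \<and> Q (newton_eq x t) = 0"
    using solve by blast
  obtain L where L: "0 < L" "\<And>u. norm (\<iota> u) \<le> norm u * L" using embed.pos_bounded by blast
  define K where "K = 1 + L * (norm v0 + 1)"
  have K: "1 \<le> K" using L by (simp add: K_def)
  \<comment> \<open>The injectivity estimate contributes \<open>2 C\<close> and the gradient at the saddle \<open>4 K\<close>; the summand \<open>K\<close>
    makes \<open>c\<close> usable as the radius factor too.\<close>
  define c where "c = 8 * C * K + K"
  have "0 < 8 * C * K" using C0 K by (intro mult_pos_pos) auto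
  then have c: "0 < c" "K \<le> c" using K unfolding c_def by linarith+
  \<comment> \<open>Oscillation below \<open>1 / (2 c)\<close> yields the contraction factor \<open>1 / 2\<close>.\<close>
  have "0 < 1 / (2 * c)" using c by simp
  then obtain dH where dH: "0 < dH" "\<And>z. norm (z - \<phi>s) < dH \<Longrightarrow> norm (H z - H \<phi>s) < 1 / (2 * c)"
    using H_cont[of \<phi>s] unfolding continuous_at_eps_delta dist_norm by blast
  define r1 where "r1 = min (min r \<delta>') 1"
  have r1: "0 < r1" "r1 \<le> r" "r1 \<le> \<delta>'" "r1 \<le> 1" using r_pos \<delta>' by (auto simp: r1_def)
  obtain dg where dg: "0 < dg" "\<And>\<phi>. norm (\<phi> - \<phi>s) < dg \<Longrightarrow> norm (g \<phi> - v0) < r1 / 2"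
    using g_cont r1(1) g0 unfolding continuous_at_eps_delta dist_norm by (metis half_gt_zero)
  define \<rho> where "\<rho> = min (min \<delta> dg) (min (r1 / 2) (dH / c))"
  have "0 < dH / c" using dH c by simp
  then have \<rho>: "0 < \<rho>" "\<rho> \<le> \<delta>" "\<rho> \<le> dg" "\<rho> \<le> r1 / 2" "\<rho> \<le> dH / c"
    using \<delta> dg(1) r1(1) unfolding \<rho>_def by linarith+
  define U where "U = V \<inter> ball \<phi>s \<rho>"
  have U: "\<phi> \<in> V" "\<phi> - \<phi>s \<in> X0" "norm (\<phi> - \<phi>s) < \<rho>" "\<phi> \<in> cball \<phi>s \<delta>" "\<phi> \<in> cball \<phi>s r" "norm (g \<phi>) \<le> norm v0 + 1"
    "(\<phi>, g \<phi>) \<in> cball (\<phi>s, v0) r" "(\<phi>, g \<phi>) \<in> cball (\<phi>s, v0) \<delta>'" if "\<phi> \<in> U" for \<phi>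
  proof -
    show *: "\<phi> \<in> V" "\<phi> - \<phi>s \<in> X0" "norm (\<phi> - \<phi>s) < \<rho>" "\<phi> \<in> cball \<phi>s \<delta>" "\<phi> \<in> cball \<phi>s r"
      using that \<rho> r1 by (auto simp: U_def V_def dist_norm norm_minus_commute)
    have n: "norm (g \<phi> - v0) < r1 / 2" using dg(2) *(3) \<rho> by simp
    have "dist (\<phi>s, v0) (\<phi>, g \<phi>) \<le> dist \<phi>s \<phi> + dist v0 (g \<phi>)"
      unfolding dist_Pair_Pair by (rule sqrt_sum_squares_le_sum) auto
    also have "\<dots> \<le> r1" using n *(3) \<rho> by (simp add: dist_norm norm_minus_commute)
    finally show "(\<phi>, g \<phi>) \<in> cball (\<phi>s, v0) r" "(\<phi>, g \<phi>) \<in> cball (\<phi>s, v0) \<delta>'" using r1 by auto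
    show "norm (g \<phi>) \<le> norm v0 + 1" using norm_triangle_sub[of "g \<phi>" v0] n r1 by simp
  qed
  have pos: "0 < inner (newton_deriv x t h) (\<iota> h)"
    if "x \<in> cball \<phi>s r" "t \<in> cball (\<phi>s, v0) r" "h \<in> X0" "h \<noteq> 0" for x t h
    by (rule form_positive_near[OF C _ blinfun.bounded_linear_right newton_deriv_sym that(3,4)])
       (use near that in blast)
  define \<Psi> where "\<Psi> \<phi> = (SOME x. x \<in> cball \<phi>s r \<and> x - \<phi>s \<in> X0 \<and> Q (newton_eq x (\<phi>, g \<phi>)) = 0)" for \<phi>
  have \<Psi>: "\<Psi> \<phi> \<in> cball \<phi>s r" "\<Psi> \<phi> - \<phi>s \<in> X0" "Q (newton_eq (\<Psi> \<phi>) (\<phi>, g \<phi>)) = 0" if "\<phi> \<in> U" for \<phi>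
    using someI_ex[OF \<delta>'(2)[OF U(8)[OF that]]] unfolding \<Psi>_def by auto
  have est: "norm (\<Psi> \<phi> - \<phi>s) \<le> c * \<eta> * norm (\<phi> - \<phi>s)"
    if \<phi>: "\<phi> \<in> U" and osc: "\<And>z. z \<in> V \<Longrightarrow> norm (z - \<phi>s) \<le> c * norm (\<phi> - \<phi>s) \<Longrightarrow> norm (H z - H \<phi>s) \<le> \<eta>" for \<phi> \<eta>
  proof -
    have "norm (Q (newton_eq \<phi>s (\<phi>, g \<phi>))) \<le> 4 * \<eta> * K * norm (\<phi> - \<phi>s)"
    proof (rule newton_eq_at_saddle)
      show "norm (H z - H \<phi>s) \<le> \<eta>" if "z - \<phi>s \<in> X0" "norm (z - \<phi>s) \<le> K * norm (\<phi> - \<phi>s)" for z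
        using osc[of z] that c order_trans[OF that(2) mult_right_mono[OF c(2)]] by (simp add: V_def)
    qed (use g[OF U(4)[OF \<phi>]] U[OF \<phi>] L in \<open>auto simp: K_def\<close>)
    moreover have "norm (\<Psi> \<phi> - \<phi>s) \<le> 2 * C * norm (Q (newton_eq (\<Psi> \<phi>) (\<phi>, g \<phi>)) - Q (newton_eq \<phi>s (\<phi>, g \<phi>)))"
      using \<Psi>[OF \<phi>] U(7)[OF \<phi>] r_pos by (intro inj) auto
    ultimately have "norm (\<Psi> \<phi> - \<phi>s) \<le> 2 * C * (4 * \<eta> * K * norm (\<phi> - \<phi>s))"
      using \<Psi>(3)[OF \<phi>] C0 by (smt (verit) mult_left_mono diff_0 norm_minus_cancel)
    also have "\<dots> = (8 * C * K) * \<eta> * norm (\<phi> - \<phi>s)" by simp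
    also have "\<dots> \<le> c * \<eta> * norm (\<phi> - \<phi>s)"
    proof -
      have "0 \<le> \<eta>" using osc[of \<phi>s] c by (simp add: V_def)
      then show ?thesis using K by (intro mult_right_mono) (auto simp: c_def)
    qed
    finally show ?thesis .
  qed
  show ?thesis
  proof (rule that[OF \<rho>(1) c(1), of g \<Psi>, folded U_def])
    fix \<phi> assume \<phi>: "\<phi> \<in> U"
    note gp = g[OF U(4)[OF \<phi>]]
    \<comment> \<open>For \<open>h\<close> orthogonal to \<open>g \<phi>\<close> the Hessian of the auxiliary functional at \<open>\<psi> = \<phi>\<close> has the form of \<open>H \<phi>\<close>.\<close>
    have form: "0 < inner (H \<phi> h) (\<iota> h)" if h: "h \<in> X0" "h \<noteq> 0" "inner (\<iota> (g \<phi>)) (\<iota> h) = 0" for h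
      using pos[OF U(5,7)[OF \<phi>] h(1,2)] h(3)
      by (simp add: newton_deriv_def blinfun.bilinear_simps inner_diff_left inner_commute)
    from min_dir_eigenvector[OF _ _ _ _ form, of "g \<phi>"] gp
    show "g \<phi> \<in> X0 \<and> norm (\<iota> (g \<phi>)) = 1 \<and> min_dir \<phi> (g \<phi>) \<and> (\<forall>u. min_dir \<phi> u \<longrightarrow> u = g \<phi> \<or> u = - g \<phi>)"
      by blast
    show "\<Psi> \<phi> \<in> V \<and> norm (\<Psi> \<phi> - \<phi>s) \<le> 1/2 * norm (\<phi> - \<phi>s) \<and> Q (newton_eq (\<Psi> \<phi>) (\<phi>, g \<phi>)) = 0"
    proof (intro conjI)
      show "\<Psi> \<phi> \<in> V" "Q (newton_eq (\<Psi> \<phi>) (\<phi>, g \<phi>)) = 0" using \<Psi>[OF \<phi>] by (auto simp: V_def)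
      have "norm (\<Psi> \<phi> - \<phi>s) \<le> c * (1 / (2 * c)) * norm (\<phi> - \<phi>s)"
      proof (rule est[OF \<phi>])
        fix z assume "norm (z - \<phi>s) \<le> c * norm (\<phi> - \<phi>s)"
        also have "\<dots> < c * \<rho>" by (rule mult_strict_left_mono[OF U(3)[OF \<phi>] c(1)])
        also have "\<dots> \<le> dH" using \<rho>(5) c by (simp add: field_simps)
        finally show "norm (H z - H \<phi>s) \<le> 1 / (2 * c)" using dH(2) by (simp add: less_imp_le)
      qed
      then show "norm (\<Psi> \<phi> - \<phi>s) \<le> 1/2 * norm (\<phi> - \<phi>s)" using c by simp
    qed
    show "inner (newton_eq x (\<phi>, g \<phi>)) (\<iota> (y - x)) < inner (newton_eq y (\<phi>, g \<phi>)) (\<iota> (y - x))"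
      if xy: "x \<in> U" "y \<in> U" "x \<noteq> y" for x y
    proof -
      define f where "f s = inner (newton_eq (x + s *\<^sub>R (y - x)) (\<phi>, g \<phi>)) (\<iota> (y - x))" for s
      define f' where "f' s = inner (newton_deriv (x + s *\<^sub>R (y - x)) (\<phi>, g \<phi>) (y - x)) (\<iota> (y - x))" for s
      have "(f has_real_derivative f' s) (at s)" for s
      proof -
        have "((\<lambda>s. x + s *\<^sub>R (y - x)) has_derivative (\<lambda>h. h *\<^sub>R (y - x))) (at s)"
          by (auto intro!: derivative_eq_intros)
        from has_derivative_inner_left[OF has_derivative_compose[OF this newton_eq_deriv]]
        show ?thesis unfolding f_def f'_def has_field_derivative_def
          by (simp add: blinfun.scaleR_right mult_commute_abs)
      qed
      then obtain s where s: "0 < s" "s < 1" "f 1 - f 0 = (1 - 0) * f' s"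
        using MVT2[of 0 1 f f'] by auto
      have "x + s *\<^sub>R (y - x) \<in> cball \<phi>s r"
      proof -
        have "(1 - s) *\<^sub>R x + s *\<^sub>R y \<in> cball \<phi>s r"
          using convexD_alt[OF convex_cball, of x \<phi>s r y s] U(5) xy s by simp
        then show ?thesis by (simp add: algebra_simps)
      qed
      then have "0 < f' s" unfolding f'_def
        using pos U(7)[OF \<phi>] V_diff U(1) xy by simp
      then show ?thesis using s by (simp add: f_def)
    qed
    show "norm (\<Psi> \<phi> - \<phi>s) \<le> c * \<eta> * norm (\<phi> - \<phi>s)"
      if "\<And>z. z \<in> V \<Longrightarrow> norm (z - \<phi>s) \<le> c * norm (\<phi> - \<phi>s) \<Longrightarrow> norm (H z - H \<phi>s) \<le> \<eta>" for \<eta>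
      using est[OF \<phi>] that by blast
  next
    assume "H differentiable_on U"
    then have H: "H differentiable (at \<phi> within U)" if "\<phi> \<in> U" for \<phi> using that by (simp add: differentiable_on_def)
    show "\<Psi> differentiable_on U" unfolding differentiable_on_def
    proof
      fix \<phi> assume \<phi>: "\<phi> \<in> U"
      have "g differentiable (at \<phi> within U)" using g_diff[OF _ \<phi> H[OF \<phi>]] U(4) by blast
      from newton_eq_differentiable[OF this]
      show "\<Psi> differentiable (at \<phi> within U)"
      proof (rule differentiable_implicit[OF _ newton_eq_deriv \<phi>])
        show "Q (newton_eq (\<Psi> s) (s, g s)) = 0" if "s \<in> U" for s using \<Psi>(3)[OF that] .
        show "\<Psi> s - \<Psi> \<phi> \<in> X0" if "s \<in> U" for s
          using V_diff \<Psi>(2) that \<phi> by (simp add: V_def)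
        then show "norm (\<Psi> s - \<Psi> \<phi>) \<le> 2 * C * norm (Q (newton_eq (\<Psi> \<phi>) (s, g s)))" if "s \<in> U" for s
          using inj[OF \<Psi>(1)[OF that] \<Psi>(1)[OF \<phi>] U(7)[OF that]] \<Psi>(3)[OF that] that by simp
        show "iso_with (C / (1 - 1/2)) (\<lambda>h. Q (newton_deriv (\<Psi> \<phi>) (\<phi>, g \<phi>) h))"
          by (rule iso_near[OF C _ blinfun.bounded_linear_right])
             (use near \<Psi>(1)[OF \<phi>] U(7)[OF \<phi>] in blast)
      qed
    qed
  qed
qed

text \<open>
  Since critical points of the strictly convex functional are its minimizers, any minimizer map agrees on
  \<open>U\<close> with the map \<open>\<Psi>\<close> of zeros of the gradient, and all claims about it are read off from \<open>\<Psi>\<close>.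
\<close>

theorem newton_map_theorem:
  assumes v: "\<And>\<phi>. \<phi> \<in> V \<Longrightarrow> \<exists>u. min_dir \<phi> u \<Longrightarrow> min_dir \<phi> (v \<phi>)"
  defines "L \<equiv> \<lambda>\<psi> \<phi>. aux \<phi> (v \<phi>) \<psi>"
  shows "\<exists>U. openin (top_of_set V) U \<and> \<phi>s \<in> U \<and> (\<forall>\<psi>\<in>U. L \<phi>s \<phi>s \<le> L \<psi> \<phi>s) \<and>
            (\<forall>\<phi>\<in>U. strictly_convex_on U (\<lambda>\<psi>. L \<psi> \<phi>) \<and>
                   (\<exists>!\<psi>. is_arg_min (\<lambda>\<psi>. L \<psi> \<phi>) (\<lambda>\<psi>. \<psi> \<in> U) \<psi>)) \<and>
            (\<forall>\<Phi>. (\<forall>\<phi>\<in>U. is_arg_min (\<lambda>\<psi>. L \<psi> \<phi>) (\<lambda>\<psi>. \<psi> \<in> U) (\<Phi> \<phi>)) \<longrightarrow>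
               ((\<forall>\<phi>\<in>U. Q (G \<phi>) = 0 \<longrightarrow> \<phi> = \<phi>s) \<longrightarrow> {\<phi> \<in> U. \<Phi> \<phi> = \<phi>} = {\<phi>s}) \<and>
               \<Phi> differentiable (at \<phi>s within U) \<and>
               (\<forall>D. (\<Phi> has_derivative D) (at \<phi>s within U) \<longrightarrow> (\<forall>u. D (p u) = 0)) \<and>
               (H differentiable_on U \<longrightarrow>
                  \<Phi> differentiable_on U \<and>
                  (\<exists>C \<delta>. 0 < \<delta> \<and>
                     (\<forall>\<phi>0\<in>U. norm (\<phi>0 - \<phi>s) < \<delta> \<longrightarrow>
                        (\<lambda>k. (\<Phi> ^^ k) \<phi>0) \<longlonglongrightarrow> \<phi>s \<and>
                        (\<forall>k. norm ((\<Phi> ^^ Suc k) \<phi>0 - \<phi>s)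
                               \<le> C * (norm ((\<Phi> ^^ k) \<phi>0 - \<phi>s))\<^sup>2)))))"
proof (rule local_structure)
  fix \<rho> g \<Psi> c assume \<rho>: "0 < \<rho>" and c: "0 < c"
    and g: "\<And>\<phi>. \<phi> \<in> V \<inter> ball \<phi>s \<rho> \<Longrightarrow> g \<phi> \<in> X0 \<and> norm (\<iota> (g \<phi>)) = 1 \<and> min_dir \<phi> (g \<phi>) \<and> (\<forall>u. min_dir \<phi> u \<longrightarrow> u = g \<phi> \<or> u = - g \<phi>)"
    and mono: "\<And>\<phi> x y. \<phi> \<in> V \<inter> ball \<phi>s \<rho> \<Longrightarrow> x \<in> V \<inter> ball \<phi>s \<rho> \<Longrightarrow> y \<in> V \<inter> ball \<phi>s \<rho> \<Longrightarrow> x \<noteq> y \<Longrightarrow>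
        inner (newton_eq x (\<phi>, g \<phi>)) (\<iota> (y - x)) < inner (newton_eq y (\<phi>, g \<phi>)) (\<iota> (y - x))"
    and \<Psi>: "\<And>\<phi>. \<phi> \<in> V \<inter> ball \<phi>s \<rho> \<Longrightarrow> \<Psi> \<phi> \<in> V \<and> norm (\<Psi> \<phi> - \<phi>s) \<le> 1/2 * norm (\<phi> - \<phi>s) \<and> Q (newton_eq (\<Psi> \<phi>) (\<phi>, g \<phi>)) = 0"
    and est: "\<And>\<phi> \<eta>. \<phi> \<in> V \<inter> ball \<phi>s \<rho> \<Longrightarrow> (\<And>z. z \<in> V \<Longrightarrow> norm (z - \<phi>s) \<le> c * norm (\<phi> - \<phi>s) \<Longrightarrow> norm (H z - H \<phi>s) \<le> \<eta>) \<Longrightarrow>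
        norm (\<Psi> \<phi> - \<phi>s) \<le> c * \<eta> * norm (\<phi> - \<phi>s)"
    and diff: "H differentiable_on (V \<inter> ball \<phi>s \<rho>) \<Longrightarrow> \<Psi> differentiable_on (V \<inter> ball \<phi>s \<rho>)"
  define U where "U = V \<inter> ball \<phi>s \<rho>"
  note g = g[folded U_def] and mono = mono[folded U_def] and \<Psi> = \<Psi>[folded U_def]
    and est = est[folded U_def] and diff = diff[folded U_def]
  have U_V: "\<phi> \<in> V" "norm (\<phi> - \<phi>s) < \<rho>" if "\<phi> \<in> U" for \<phi>
    using that by (auto simp: U_def dist_norm norm_minus_commute)
  have convU: "convex U" unfolding U_def by (intro convex_Int convex_V convex_ball)
  have s_U: "\<phi>s \<in> U" using \<rho> by (simp add: U_def V_def)
  have \<Psi>_U: "\<Psi> \<phi> \<in> U" if "\<phi> \<in> U" for \<phi>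
  proof -
    have "norm (\<Psi> \<phi> - \<phi>s) < \<rho>" using \<Psi>[OF that] U_V(2)[OF that] norm_ge_zero[of "\<phi> - \<phi>s"] by linarith
    then show ?thesis using \<Psi>[OF that] by (simp add: U_def dist_norm norm_minus_commute)
  qed
  have L_eq: "(\<lambda>\<psi>. L \<psi> \<phi>) = aux \<phi> (g \<phi>)" if "\<phi> \<in> U" for \<phi>
  proof -
    have "min_dir \<phi> (v \<phi>)" using v[OF U_V(1)[OF that]] g[OF that] by blast
    then have "v \<phi> = g \<phi> \<or> v \<phi> = - g \<phi>" using g[OF that] by blast
    then show ?thesis by (auto simp: L_def)
  qed
  have conv: "strictly_convex_on U (\<lambda>\<psi>. L \<psi> \<phi>)" if "\<phi> \<in> U" for \<phi>
    unfolding L_eq[OF that]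
    by (rule strictly_convex_of_monotone_gradient(1)[OF convU aux_deriv mono]) (use that in auto)
  have less: "L (\<Psi> \<phi>) \<phi> < L y \<phi>" if \<phi>: "\<phi> \<in> U" "y \<in> U" "y \<noteq> \<Psi> \<phi>" for \<phi> y
  proof -
    have "y - \<Psi> \<phi> \<in> X0" using V_diff U_V(1) \<Psi>_U \<phi> by blast
    then have "inner (newton_eq (\<Psi> \<phi>) (\<phi>, g \<phi>)) (\<iota> (y - \<Psi> \<phi>)) = 0"
      using \<Psi>[OF \<phi>(1)] inner_Q[of "\<iota> (y - \<Psi> \<phi>)" "newton_eq (\<Psi> \<phi>) (\<phi>, g \<phi>)"] by simp
    then have "aux \<phi> (g \<phi>) (\<Psi> \<phi>) < aux \<phi> (g \<phi>) y"
      using \<phi> \<Psi>_U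
      by (intro strictly_convex_of_monotone_gradient(2)[OF convU aux_deriv mono]) auto
    then show ?thesis using fun_cong[OF L_eq[OF \<phi>(1)]] by simp
  qed
  have arg_min: "is_arg_min (\<lambda>\<psi>. L \<psi> \<phi>) (\<lambda>\<psi>. \<psi> \<in> U) x \<longleftrightarrow> x = \<Psi> \<phi>" if "\<phi> \<in> U" for \<phi> x
    unfolding is_arg_min_def using less[OF that] \<Psi>_U[OF that] by (metis order_less_asym)
  have \<Psi>s: "\<Psi> \<phi>s = \<phi>s" using \<Psi>[OF s_U] by simp
  have Hosc: "\<exists>d>0. \<forall>z. norm (z - \<phi>s) < d \<longrightarrow> norm (H z - H \<phi>s) < e" if "0 < e" for e
    using H_cont[of \<phi>s] that unfolding continuous_at_eps_delta dist_norm by blast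
  have \<Psi>_der: "(\<Psi> has_derivative (\<lambda>_. 0)) (at \<phi>s within U)"
    unfolding has_derivative_within_alt
  proof (intro conjI bounded_linear_zero allI impI)
    fix e :: real assume "0 < e"
    then obtain d where d: "0 < d" "\<And>z. norm (z - \<phi>s) < d \<Longrightarrow> norm (H z - H \<phi>s) < e / c"
      using Hosc[of "e / c"] c by auto
    show "\<exists>d>0. \<forall>y\<in>U. norm (y - \<phi>s) < d \<longrightarrow> norm (\<Psi> y - \<Psi> \<phi>s - 0) \<le> e * norm (y - \<phi>s)"
    proof (intro exI[of _ "d / c"] conjI ballI impI)
      show "0 < d / c" using d c by simp
      fix y assume y: "y \<in> U" "norm (y - \<phi>s) < d / c"
      have "norm (\<Psi> y - \<phi>s) \<le> c * (e / c) * norm (y - \<phi>s)"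
      proof (rule est[OF y(1)])
        fix z assume "norm (z - \<phi>s) \<le> c * norm (y - \<phi>s)"
        also have "\<dots> < d" using y(2) c by (simp add: field_simps)
        finally show "norm (H z - H \<phi>s) \<le> e / c" using d(2) by (simp add: less_imp_le)
      qed
      then show "norm (\<Psi> y - \<Psi> \<phi>s - 0) \<le> e * norm (y - \<phi>s)" using c \<Psi>s by simp
    qed
  qed
  have main: "((\<forall>\<phi>\<in>U. Q (G \<phi>) = 0 \<longrightarrow> \<phi> = \<phi>s) \<longrightarrow> {\<phi> \<in> U. \<Phi> \<phi> = \<phi>} = {\<phi>s}) \<and>
               \<Phi> differentiable (at \<phi>s within U) \<and>
               (\<forall>D. (\<Phi> has_derivative D) (at \<phi>s within U) \<longrightarrow> (\<forall>u. D (p u) = 0)) \<and>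
               (H differentiable_on U \<longrightarrow>
                  \<Phi> differentiable_on U \<and>
                  (\<exists>C \<delta>. 0 < \<delta> \<and>
                     (\<forall>\<phi>0\<in>U. norm (\<phi>0 - \<phi>s) < \<delta> \<longrightarrow>
                        (\<lambda>k. (\<Phi> ^^ k) \<phi>0) \<longlonglongrightarrow> \<phi>s \<and>
                        (\<forall>k. norm ((\<Phi> ^^ Suc k) \<phi>0 - \<phi>s)
                               \<le> C * (norm ((\<Phi> ^^ k) \<phi>0 - \<phi>s))\<^sup>2))))"
    if "\<forall>\<phi>\<in>U. is_arg_min (\<lambda>\<psi>. L \<psi> \<phi>) (\<lambda>\<psi>. \<psi> \<in> U) (\<Phi> \<phi>)" for \<Phi>
  proof (intro conjI impI allI)
    have \<Phi>: "\<Phi> \<phi> = \<Psi> \<phi>" if "\<phi> \<in> U" for \<phi>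
      using \<open>\<forall>\<phi>\<in>U. is_arg_min (\<lambda>\<psi>. L \<psi> \<phi>) (\<lambda>\<psi>. \<psi> \<in> U) (\<Phi> \<phi>)\<close> arg_min that by blast
    have \<Phi>_der: "(\<Phi> has_derivative (\<lambda>_. 0)) (at \<phi>s within U)"
      by (rule has_derivative_transform[OF s_U _ \<Psi>_der]) (rule \<Phi>)
    show "{\<phi> \<in> U. \<Phi> \<phi> = \<phi>} = {\<phi>s}" if only: "\<forall>\<phi>\<in>U. Q (G \<phi>) = 0 \<longrightarrow> \<phi> = \<phi>s"
    proof
      show "{\<phi>s} \<subseteq> {\<phi> \<in> U. \<Phi> \<phi> = \<phi>}" using s_U \<Phi> \<Psi>s by simp
      show "{\<phi> \<in> U. \<Phi> \<phi> = \<phi>} \<subseteq> {\<phi>s}"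
      proof
        fix \<phi> assume "\<phi> \<in> {\<phi> \<in> U. \<Phi> \<phi> = \<phi>}"
        then have \<phi>: "\<phi> \<in> U" "\<Psi> \<phi> = \<phi>" using \<Phi> by auto
        have gX: "g \<phi> \<in> X0" "inner (\<iota> (g \<phi>)) (\<iota> (g \<phi>)) = 1"
          using g[OF \<phi>(1)] by (auto simp: dot_square_norm)
        have "Q (newton_eq \<phi> (\<phi>, g \<phi>)) = 0" using \<Psi>[OF \<phi>(1)] unfolding \<phi>(2) by blast
        then have z: "Q (G \<phi>) = (2 * inner (G \<phi>) (\<iota> (g \<phi>))) *\<^sub>R \<iota> (g \<phi>)"
          using gX by (simp add: newton_eq_def embed.zero Q.diff Q.scaleR)
        \<comment> \<open>At a fixed point the gradient of the auxiliary functional is the gradient of \<open>F\<close> reflected in the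
          direction \<open>g\<close>, so one vanishes only with the other.\<close>
        have "inner (G \<phi>) (\<iota> (g \<phi>)) = inner (Q (G \<phi>)) (\<iota> (g \<phi>))" using gX by simp
        also have "\<dots> = 2 * inner (G \<phi>) (\<iota> (g \<phi>))" unfolding z using gX by simp
        finally have "inner (G \<phi>) (\<iota> (g \<phi>)) = 0" by simp
        then have "Q (G \<phi>) = 0" using z by simp
        then show "\<phi> \<in> {\<phi>s}" using only \<phi>(1) by simp
      qed
    qed
    show "\<Phi> differentiable (at \<phi>s within U)" using \<Phi>_der by (auto simp: differentiable_def)
    show "D (p u) = 0" if D: "(\<Phi> has_derivative D) (at \<phi>s within U)" for D u
    proof (rule ccontr)
      assume neq: "D (p u) \<noteq> 0"
      define f where "f s = \<phi>s + s *\<^sub>R p u" for s :: real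
      have pu: "p u \<noteq> 0" using neq D linear_0[OF has_derivative_linear] by metis
      define T where "T = {s::real. \<bar>s\<bar> < \<rho> / norm (p u)}"
      have T: "open T" "0 \<in> T" using \<rho> pu by (auto simp: T_def open_Collect_less continuous_on_id intro!: continuous_intros open_Collect_less)
      have fT: "f ` T \<subseteq> U"
      proof
        fix y assume "y \<in> f ` T"
        then obtain s where s: "y = \<phi>s + s *\<^sub>R p u" "\<bar>s\<bar> < \<rho> / norm (p u)" by (auto simp: f_def T_def)
        then have "\<bar>s\<bar> * norm (p u) < \<rho>" using pu by (simp add: field_simps)
        then show "y \<in> U" using s(1) by (simp add: U_def V_def dist_norm)
      qed
      have f0: "f 0 = \<phi>s" by (simp add: f_def)
      have fder: "(f has_derivative (\<lambda>s. s *\<^sub>R p u)) (at 0 within T)"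
        unfolding f_def by (auto intro!: derivative_eq_intros)
      have "((\<lambda>s. \<Phi> (f s)) has_derivative (\<lambda>s. D (s *\<^sub>R p u))) (at 0 within T)"
        by (rule has_derivative_in_compose[OF fder]) (use D f0 fT has_derivative_subset in auto)
      moreover have "((\<lambda>s. \<Phi> (f s)) has_derivative (\<lambda>s. 0)) (at 0 within T)"
        by (rule has_derivative_in_compose[OF fder]) (use \<Phi>_der f0 fT has_derivative_subset in auto)
      ultimately have "(\<lambda>s. D (s *\<^sub>R p u)) = (\<lambda>s. 0)"
        using T has_derivative_unique at_within_open[OF T(2,1)] by metis
      then have "D (1 *\<^sub>R p u) = 0" by (rule fun_cong)
      then show False using neq by simp
    qed
    assume Hd: "H differentiable_on U"
    show "\<Phi> differentiable_on U" unfolding differentiable_on_def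
    proof
      fix \<phi> assume \<phi>: "\<phi> \<in> U"
      then have "\<Psi> differentiable (at \<phi> within U)" using diff[OF Hd] by (simp add: differentiable_on_def)
      then obtain D where "(\<Psi> has_derivative D) (at \<phi> within U)" by (auto simp: differentiable_def)
      then have "(\<Phi> has_derivative D) (at \<phi> within U)"
        by (intro has_derivative_transform[OF \<phi> _ \<open>(\<Psi> has_derivative D) _\<close>] \<Phi>)
      then show "\<Phi> differentiable (at \<phi> within U)" by (auto simp: differentiable_def)
    qed
    obtain H' where H': "(H has_derivative H') (at \<phi>s within U)"
      using Hd s_U by (auto simp: differentiable_on_def differentiable_def)
    obtain KH where KH: "0 < KH" "\<And>x. norm (H' x) \<le> norm x * KH"
      using bounded_linear.pos_bounded[OF has_derivative_bounded_linear[OF H']] by blast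
    obtain d where d: "0 < d" "\<And>z. z \<in> U \<Longrightarrow> norm (z - \<phi>s) < d \<Longrightarrow>
        norm (H z - H \<phi>s - H' (z - \<phi>s)) \<le> 1 * norm (z - \<phi>s)"
      using H' unfolding has_derivative_within_alt by (meson zero_less_one)
    have H_lip: "norm (H z - H \<phi>s) \<le> (KH + 1) * norm (z - \<phi>s)" if "z \<in> U" "norm (z - \<phi>s) < d" for z
      using d(2)[OF that] KH(2)[of "z - \<phi>s"] norm_triangle_sub[of "H z - H \<phi>s" "H' (z - \<phi>s)"]
      by (simp add: algebra_simps)
    define \<delta> where "\<delta> = min d \<rho> / c"
    define C where "C = c * (KH + 1) * c"
    have quad: "norm (\<Phi> \<phi> - \<phi>s) \<le> C * (norm (\<phi> - \<phi>s))\<^sup>2" if \<phi>: "\<phi> \<in> U" "norm (\<phi> - \<phi>s) < \<delta>" for \<phi>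
    proof -
      have small: "c * norm (\<phi> - \<phi>s) < min d \<rho>" using \<phi>(2) c by (simp add: \<delta>_def field_simps)
      have "norm (\<Psi> \<phi> - \<phi>s) \<le> c * ((KH + 1) * (c * norm (\<phi> - \<phi>s))) * norm (\<phi> - \<phi>s)"
      proof (rule est[OF \<phi>(1)])
        fix z assume z: "z \<in> V" "norm (z - \<phi>s) \<le> c * norm (\<phi> - \<phi>s)"
        then have "z \<in> U" "norm (z - \<phi>s) < d" using small by (auto simp: U_def dist_norm norm_minus_commute)
        then have "norm (H z - H \<phi>s) \<le> (KH + 1) * norm (z - \<phi>s)" by (rule H_lip)
        also have "\<dots> \<le> (KH + 1) * (c * norm (\<phi> - \<phi>s))" using z KH by (intro mult_left_mono) auto
        finally show "norm (H z - H \<phi>s) \<le> (KH + 1) * (c * norm (\<phi> - \<phi>s))" .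
      qed
      then show ?thesis using \<Phi>[OF \<phi>(1)] by (simp add: C_def power2_eq_square mult_ac)
    qed
    have "0 < \<delta>" using d \<rho> c by (simp add: \<delta>_def)
    moreover have "(\<lambda>k. (\<Phi> ^^ k) \<phi>0) \<longlonglongrightarrow> \<phi>s \<and> (\<forall>k. norm ((\<Phi> ^^ Suc k) \<phi>0 - \<phi>s) \<le> C * (norm ((\<Phi> ^^ k) \<phi>0 - \<phi>s))\<^sup>2)"
      if \<phi>0: "\<phi>0 \<in> U" "norm (\<phi>0 - \<phi>s) < \<delta>" for \<phi>0
    proof -
      have it: "(\<Phi> ^^ k) \<phi>0 \<in> U \<and> norm ((\<Phi> ^^ k) \<phi>0 - \<phi>s) \<le> (1/2) ^ k * norm (\<phi>0 - \<phi>s)" for k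
      proof (induction k)
        case (Suc k)
        let ?x = "(\<Phi> ^^ k) \<phi>0"
        have "norm (\<Phi> ?x - \<phi>s) \<le> 1/2 * norm (?x - \<phi>s)" using \<Psi>[of ?x] \<Phi>[of ?x] Suc by simp
        moreover have "\<Phi> ?x \<in> U" using \<Psi>_U[of ?x] \<Phi>[of ?x] Suc by simp
        ultimately show ?case using Suc by simp
      qed (use \<phi>0 in simp)
      have lim: "(\<lambda>k. (1/2::real) ^ k * norm (\<phi>0 - \<phi>s)) \<longlonglongrightarrow> 0"
        by (intro tendsto_mult_left_zero LIMSEQ_power_zero) simp
      have "(\<lambda>k. (\<Phi> ^^ k) \<phi>0) \<longlonglongrightarrow> \<phi>s"
        by (rule LIM_zero_cancel, rule Lim_null_comparison[OF _ lim]) (use it in auto)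
      moreover have "norm ((\<Phi> ^^ k) \<phi>0 - \<phi>s) < \<delta>" for k
      proof -
        have "(1/2::real) ^ k * norm (\<phi>0 - \<phi>s) \<le> 1 * norm (\<phi>0 - \<phi>s)"
          by (intro mult_right_mono power_le_one) auto
        then show ?thesis using it[of k] \<phi>0(2) by linarith
      qed
      then have "norm ((\<Phi> ^^ Suc k) \<phi>0 - \<phi>s) \<le> C * (norm ((\<Phi> ^^ k) \<phi>0 - \<phi>s))\<^sup>2" for k
        using quad it by simp
      ultimately show ?thesis by blast
    qed
    ultimately show "\<exists>C \<delta>. 0 < \<delta> \<and> (\<forall>\<phi>0\<in>U. norm (\<phi>0 - \<phi>s) < \<delta> \<longrightarrow>
        (\<lambda>k. (\<Phi> ^^ k) \<phi>0) \<longlonglongrightarrow> \<phi>s \<and>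
        (\<forall>k. norm ((\<Phi> ^^ Suc k) \<phi>0 - \<phi>s) \<le> C * (norm ((\<Phi> ^^ k) \<phi>0 - \<phi>s))\<^sup>2))"
      by blast
  qed
  have open_U: "openin (top_of_set V) U" unfolding U_def by (rule openin_open_Int) simp
  have minimal: "L \<phi>s \<phi>s \<le> L \<psi> \<phi>s" if "\<psi> \<in> U" for \<psi>
    using less[OF s_U that] \<Psi>s by (cases "\<psi> = \<phi>s") auto
  have unique: "\<exists>!\<psi>. is_arg_min (\<lambda>\<psi>. L \<psi> \<phi>) (\<lambda>\<psi>. \<psi> \<in> U) \<psi>" if "\<phi> \<in> U" for \<phi>
    using arg_min[OF that] by simp
  show ?thesis
    by (rule exI[of _ U], rule conjI[OF open_U], rule conjI[OF s_U], rule conjI, rule ballI, erule minimal,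
        rule conjI, rule ballI, rule conjI, erule conv, erule unique, rule allI, rule impI, erule main)
qed

end

section \<open>Symmetry of second derivatives and mean-zero functions in L2\<close>

text \<open>
  The mixed second difference, by the mean value theorem along \<open>w\<close> and then along \<open>u\<close>.
\<close>

lemma mixed_difference:
  fixes F :: "'x::real_normed_vector \<Rightarrow> real" and G :: "'x \<Rightarrow> 'e::real_inner"
  assumes F: "\<And>x. (F has_derivative (\<lambda>h. inner (G x) (\<iota> h))) (at x)"
    and G: "\<And>x. (G has_derivative blinfun_apply (H x)) (at x)" and "bounded_linear \<iota>" and "0 < s"
  shows "\<exists>\<sigma> \<xi>. 0 < \<sigma> \<and> \<sigma> < s \<and> 0 < \<xi> \<and> \<xi> < s \<and>
    F (x + s *\<^sub>R u + s *\<^sub>R w) - F (x + s *\<^sub>R u) - F (x + s *\<^sub>R w) + F x =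
      s\<^sup>2 * inner (H (x + \<sigma> *\<^sub>R u + \<xi> *\<^sub>R w) u) (\<iota> w)"
proof -
  interpret \<iota>: bounded_linear \<iota> by fact
  have line: "((\<lambda>t. y + t *\<^sub>R z) has_derivative (\<lambda>h. h *\<^sub>R z)) (at t)" for y z :: 'x and t
    by (auto intro!: derivative_eq_intros)
  have F_line: "((\<lambda>t. F (y + t *\<^sub>R w)) has_real_derivative inner (G (y + t *\<^sub>R w)) (\<iota> w)) (at t)" for y t
    using has_derivative_compose[OF line F, of y w t]
    by (simp add: has_field_derivative_def \<iota>.scaleR mult_commute_abs)
  have G_line: "((\<lambda>t. inner (G (y + t *\<^sub>R u)) (\<iota> w)) has_real_derivative inner (H (y + t *\<^sub>R u) u) (\<iota> w)) (at t)" for y t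
    using has_derivative_inner_left[OF has_derivative_compose[OF line G, of y u t], of "\<iota> w"]
    by (simp add: has_field_derivative_def blinfun.scaleR_right mult_commute_abs)
  obtain \<xi> where \<xi>: "0 < \<xi>" "\<xi> < s"
    "(F (x + s *\<^sub>R u + s *\<^sub>R w) - F (x + s *\<^sub>R w)) - (F (x + s *\<^sub>R u + 0 *\<^sub>R w) - F (x + 0 *\<^sub>R w)) =
      (s - 0) * (inner (G (x + s *\<^sub>R u + \<xi> *\<^sub>R w)) (\<iota> w) - inner (G (x + \<xi> *\<^sub>R w)) (\<iota> w))"
    using MVT2[OF \<open>0 < s\<close> DERIV_diff[OF F_line[of "x + s *\<^sub>R u"] F_line[of x]]] by blast
  obtain \<sigma> where \<sigma>: "0 < \<sigma>" "\<sigma> < s"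
    "inner (G ((x + \<xi> *\<^sub>R w) + s *\<^sub>R u)) (\<iota> w) - inner (G ((x + \<xi> *\<^sub>R w) + 0 *\<^sub>R u)) (\<iota> w) =
      (s - 0) * inner (H ((x + \<xi> *\<^sub>R w) + \<sigma> *\<^sub>R u) u) (\<iota> w)"
    using MVT2[OF \<open>0 < s\<close> G_line[of "x + \<xi> *\<^sub>R w"]] by blast
  have e: "x + \<xi> *\<^sub>R w + s *\<^sub>R u = x + s *\<^sub>R u + \<xi> *\<^sub>R w" "x + \<xi> *\<^sub>R w + \<sigma> *\<^sub>R u = x + \<sigma> *\<^sub>R u + \<xi> *\<^sub>R w"
    by (simp_all add: algebra_simps)
  have "F (x + s *\<^sub>R u + s *\<^sub>R w) - F (x + s *\<^sub>R u) - F (x + s *\<^sub>R w) + F x =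
      s * (inner (G (x + s *\<^sub>R u + \<xi> *\<^sub>R w)) (\<iota> w) - inner (G (x + \<xi> *\<^sub>R w)) (\<iota> w))"
    using \<xi>(3) by simp
  also have "inner (G (x + s *\<^sub>R u + \<xi> *\<^sub>R w)) (\<iota> w) - inner (G (x + \<xi> *\<^sub>R w)) (\<iota> w) =
      s * inner (H (x + \<sigma> *\<^sub>R u + \<xi> *\<^sub>R w) u) (\<iota> w)"
    using \<sigma>(3) unfolding e by simp
  finally have "F (x + s *\<^sub>R u + s *\<^sub>R w) - F (x + s *\<^sub>R u) - F (x + s *\<^sub>R w) + F x =
      s\<^sup>2 * inner (H (x + \<sigma> *\<^sub>R u + \<xi> *\<^sub>R w) u) (\<iota> w)"
    by (simp add: power2_eq_square mult.assoc)
  then show ?thesis using \<xi>(1,2) \<sigma>(1,2) by blast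
qed

text \<open>
  Schwarz's theorem: the second difference of \<open>mixed_difference\<close> does not change when \<open>u\<close> and \<open>w\<close> are
  exchanged.
\<close>

lemma hessian_symmetric:
  fixes F :: "'x::real_normed_vector \<Rightarrow> real" and G :: "'x \<Rightarrow> 'e::real_inner"
  assumes F: "\<And>x. (F has_derivative (\<lambda>h. inner (G x) (\<iota> h))) (at x)"
    and G: "\<And>x. (G has_derivative blinfun_apply (H x)) (at x)" and \<iota>: "bounded_linear \<iota>"
    and H: "isCont H x"
  shows "inner (H x u) (\<iota> w) = inner (\<iota> u) (H x w)"
proof -
  have "dist (inner (H x u) (\<iota> w)) (inner (H x w) (\<iota> u)) \<le> e" if "0 < e" for e
  proof -
    have cont: "isCont (\<lambda>z. inner (H z a) (\<iota> b)) x" for a b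
      by (intro continuous_intros bounded_linear.isCont[OF blinfun.bounded_linear_left] H)
    obtain d1 where d1: "0 < d1" "\<And>z. dist z x < d1 \<Longrightarrow> dist (inner (H z u) (\<iota> w)) (inner (H x u) (\<iota> w)) < e / 2"
      using cont[of u w] \<open>0 < e\<close> unfolding continuous_at_eps_delta by (meson half_gt_zero)
    obtain d2 where d2: "0 < d2" "\<And>z. dist z x < d2 \<Longrightarrow> dist (inner (H z w) (\<iota> u)) (inner (H x w) (\<iota> u)) < e / 2"
      using cont[of w u] \<open>0 < e\<close> unfolding continuous_at_eps_delta by (meson half_gt_zero)
    define d where "d = min d1 d2"
    define s where "s = d / (norm u + norm w + 1)"
    have N: "0 < norm u + norm w + 1" by (simp add: add_nonneg_pos)
    have d: "0 < d" using d1 d2 by (simp add: d_def)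
    then have s: "0 < s" using N by (simp add: s_def)
    have near: "dist (x + \<sigma> *\<^sub>R a + \<xi> *\<^sub>R b) x < d"
      if "0 < \<sigma>" "\<sigma> < s" "0 < \<xi>" "\<xi> < s" "norm a + norm b = norm u + norm w" for \<sigma> \<xi> a b
    proof -
      have "dist (x + \<sigma> *\<^sub>R a + \<xi> *\<^sub>R b) x \<le> \<sigma> * norm a + \<xi> * norm b"
        using norm_triangle_ineq[of "\<sigma> *\<^sub>R a" "\<xi> *\<^sub>R b"] that by (simp add: dist_norm)
      also have "\<dots> \<le> s * norm a + s * norm b" using that by (intro add_mono mult_right_mono) auto
      also have "\<dots> = s * (norm u + norm w)" using that(5) by (simp add: distrib_left[symmetric])
      also have "\<dots> < s * (norm u + norm w + 1)" using s by simp
      also have "\<dots> = d" using N by (simp add: s_def)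
      finally show ?thesis .
    qed
    obtain \<sigma> \<xi> where 1: "0 < \<sigma>" "\<sigma> < s" "0 < \<xi>" "\<xi> < s"
      "F (x + s *\<^sub>R u + s *\<^sub>R w) - F (x + s *\<^sub>R u) - F (x + s *\<^sub>R w) + F x =
        s\<^sup>2 * inner (H (x + \<sigma> *\<^sub>R u + \<xi> *\<^sub>R w) u) (\<iota> w)"
      using mixed_difference[OF F G \<iota> s] by blast
    obtain \<sigma>' \<xi>' where 2: "0 < \<sigma>'" "\<sigma>' < s" "0 < \<xi>'" "\<xi>' < s"
      "F (x + s *\<^sub>R w + s *\<^sub>R u) - F (x + s *\<^sub>R w) - F (x + s *\<^sub>R u) + F x =
        s\<^sup>2 * inner (H (x + \<sigma>' *\<^sub>R w + \<xi>' *\<^sub>R u) w) (\<iota> u)"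
      using mixed_difference[OF F G \<iota> s] by blast
    have swap: "x + s *\<^sub>R w + s *\<^sub>R u = x + s *\<^sub>R u + s *\<^sub>R w" by (simp add: algebra_simps)
    have "s\<^sup>2 * inner (H (x + \<sigma> *\<^sub>R u + \<xi> *\<^sub>R w) u) (\<iota> w) = s\<^sup>2 * inner (H (x + \<sigma>' *\<^sub>R w + \<xi>' *\<^sub>R u) w) (\<iota> u)"
      using 1(5) 2(5) unfolding swap by linarith
    then have eq: "inner (H (x + \<sigma> *\<^sub>R u + \<xi> *\<^sub>R w) u) (\<iota> w) = inner (H (x + \<sigma>' *\<^sub>R w + \<xi>' *\<^sub>R u) w) (\<iota> u)"
      using s by simp
    have "dist (inner (H (x + \<sigma> *\<^sub>R u + \<xi> *\<^sub>R w) u) (\<iota> w)) (inner (H x u) (\<iota> w)) < e / 2"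
      using near[OF 1(1-4), of u w] by (intro d1(2)) (simp add: d_def)
    moreover have "dist (inner (H (x + \<sigma>' *\<^sub>R w + \<xi>' *\<^sub>R u) w) (\<iota> u)) (inner (H x w) (\<iota> u)) < e / 2"
      using near[OF 2(1-4), of w u] by (intro d2(2)) (simp add: d_def)
    ultimately show ?thesis unfolding eq dist_real_def by linarith
  qed
  then have "dist (inner (H x u) (\<iota> w)) (inner (H x w) (\<iota> u)) \<le> 0" by (rule field_le_epsilon) simp
  then show ?thesis by (simp add: inner_commute)
qed

lemma square_integrable_cut:
  assumes "\<Omega> \<in> sets lborel" "square_integrable h"
  shows "square_integrable (\<lambda>x. indicat_real \<Omega> x * h x)"
proof -
  have [measurable]: "\<Omega> \<in> sets borel" "h \<in> borel_measurable borel" using assms by (auto simp: square_integrable_def)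
  have "integrable lborel (\<lambda>x. (indicat_real \<Omega> x * h x)\<^sup>2)"
    by (rule Bochner_Integration.integrable_bound[of _ "\<lambda>x. (h x)\<^sup>2"])
       (use assms in \<open>auto simp: square_integrable_def indicator_def\<close>)
  then show ?thesis by (simp add: square_integrable_def)
qed

text \<open>
  Restriction to \<open>\<Omega>\<close>.  It is an orthogonal projection defined on the whole type, and so is its composition
  with \<open>l2_proj \<Omega>\<close>; \<open>L2 \<Omega>\<close> and the mean-zero functions are their fixed sets.
\<close>

lift_definition l2_cut :: "'d::euclidean_space set \<Rightarrow> 'd l2 \<Rightarrow> 'd l2"
  is "\<lambda>\<Omega> f. if \<Omega> \<in> sets lborel then (\<lambda>x. indicat_real \<Omega> x * f x) else (\<lambda>_. 0)"
  using square_integrable_cut by (auto simp: ae_eq_def square_integrable_zero)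

lemma l2_cut_add: "l2_cut \<Omega> (u + v) = l2_cut \<Omega> u + l2_cut \<Omega> v"
  by transfer (auto simp: ae_eq_def square_integrable_zero distrib_left
      intro!: square_integrable_add square_integrable_cut)

lemma l2_cut_scaleR: "l2_cut \<Omega> (c *\<^sub>R u) = c *\<^sub>R l2_cut \<Omega> u"
  by transfer (auto simp: ae_eq_def square_integrable_zero mult.left_commute[of "indicat_real _ _"]
      intro!: square_integrable_scale square_integrable_cut)

lemma l2_cut_idem: "l2_cut \<Omega> (l2_cut \<Omega> u) = l2_cut \<Omega> u"
proof -
  have "indicat_real \<Omega> x * (indicat_real \<Omega> x * y) = indicat_real \<Omega> x * y" for x y
    by (simp add: indicator_def)
  then show ?thesis
    by transfer (auto simp: ae_eq_def square_integrable_zero intro!: square_integrable_cut)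
qed

lemma l2_cut_sym: "inner (l2_cut \<Omega> u) v = inner u (l2_cut \<Omega> v)"
  by transfer (auto simp: mult_ac)

lemma l2_cut_in_L2: "l2_cut \<Omega> u \<in> L2 \<Omega>"
  unfolding L2_def mem_Collect_eq by transfer (auto simp: indicator_def)

lemma l2_cut_ident: "\<Omega> \<in> sets lborel \<Longrightarrow> u \<in> L2 \<Omega> \<Longrightarrow> l2_cut \<Omega> u = u"
  unfolding L2_def mem_Collect_eq
proof transfer
  fix \<Omega> :: "'a set" and f
  assume \<Omega>: "\<Omega> \<in> sets lborel" and "ae_eq f f" and vanish: "AE x in lborel. x \<notin> \<Omega> \<longrightarrow> f x = 0"
  from vanish have "AE x in lborel. indicat_real \<Omega> x * f x = f x"
    by (rule eventually_mono) (auto simp: indicator_def)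
  then show "ae_eq (if \<Omega> \<in> sets lborel then \<lambda>x. indicat_real \<Omega> x * f x else (\<lambda>_. 0)) f"
    using \<Omega> \<open>ae_eq f f\<close> square_integrable_cut by (auto simp: ae_eq_def)
qed

lemma l2_integral_inner: "\<Omega> \<in> fmeasurable lborel \<Longrightarrow> l2_integral \<Omega> u = inner (l2_one \<Omega>) u"
  by transfer (simp add: set_lebesgue_integral_def)

lemma l2_one_in_L2: "l2_one \<Omega> \<in> L2 \<Omega>"
  unfolding L2_def mem_Collect_eq by transfer (auto simp: indicator_def)

lemma inner_l2_one: "\<Omega> \<in> fmeasurable lborel \<Longrightarrow> inner (l2_one \<Omega>) (l2_one \<Omega>) = measure lborel \<Omega>"
proof transfer
  fix \<Omega> :: "'a set" assume \<Omega>: "\<Omega> \<in> fmeasurable lborel"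
  have "(\<lambda>x. indicat_real \<Omega> x * indicat_real \<Omega> x) = indicat_real \<Omega>" by (auto simp: indicator_def)
  then show "(LINT x|lborel. (if \<Omega> \<in> fmeasurable lborel then indicat_real \<Omega> else (\<lambda>_. 0)) x *
      (if \<Omega> \<in> fmeasurable lborel then indicat_real \<Omega> else (\<lambda>_. 0)) x) = measure lborel \<Omega>"
    using \<Omega> by simp
qed

lemma bounded_linear_of_symmetric_projection:
  fixes P :: "'e::real_inner \<Rightarrow> 'e"
  assumes "\<And>u v. P (u + v) = P u + P v" "\<And>c u. P (c *\<^sub>R u) = c *\<^sub>R P u"
    and "\<And>u. P (P u) = P u" "\<And>u v. inner (P u) v = inner u (P v)"
  shows "bounded_linear P"
proof (rule bounded_linear_intro[of _ 1])
  fix u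
  have "norm (P u) * norm (P u) = inner u (P u)"
    using assms(3,4) by (metis dot_square_norm power2_eq_square)
  also have "\<dots> \<le> norm u * norm (P u)" by (rule norm_cauchy_schwarz)
  finally show "norm (P u) \<le> norm u * 1" by (cases "P u = 0") auto
qed (use assms in auto)

definition "l2_mean_zero_proj \<Omega> y = l2_proj \<Omega> (l2_cut \<Omega> y)"

context
  fixes \<Omega> :: "'d::euclidean_space set"
  assumes \<Omega>: "bounded_domain \<Omega>"
begin

lemma domain_fmeasurable: "\<Omega> \<in> fmeasurable lborel" and domain_sets: "\<Omega> \<in> sets lborel"
  using bounded_domain_fmeasurable[OF \<Omega>] by (auto simp: fmeasurable_def)

lemma measure_domain_pos: "0 < measure lborel \<Omega>"
proof -
  obtain x where "x \<in> \<Omega>" using \<Omega> by (auto simp: bounded_domain_def)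
  then obtain r where r: "0 < r" "ball x r \<subseteq> \<Omega>"
    using \<Omega> by (auto simp: bounded_domain_def open_contains_ball)
  have "0 < measure lborel (ball x r)" using r(1) by (rule content_ball_pos)
  also have "\<dots> \<le> measure lborel \<Omega>"
    by (rule measure_mono_fmeasurable[OF r(2) _ domain_fmeasurable]) simp
  finally show ?thesis .
qed

lemma l2_proj_inner: "l2_proj \<Omega> u = u - (inner (l2_one \<Omega>) u / measure lborel \<Omega>) *\<^sub>R l2_one \<Omega>"
  using domain_fmeasurable by (simp add: l2_proj_def l2_integral_inner)

lemma cut_one: "l2_cut \<Omega> (l2_one \<Omega>) = l2_one \<Omega>"
  by (rule l2_cut_ident[OF domain_sets l2_one_in_L2])

lemma mean_zero_proj_eq:
  "l2_mean_zero_proj \<Omega> y = l2_cut \<Omega> y - (inner (l2_one \<Omega>) y / measure lborel \<Omega>) *\<^sub>R l2_one \<Omega>"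
  using l2_cut_sym[of \<Omega> "l2_one \<Omega>" y] by (simp add: l2_mean_zero_proj_def l2_proj_inner cut_one)

lemma bounded_linear_cut: "bounded_linear (l2_cut \<Omega>)"
  by (rule bounded_linear_of_symmetric_projection[OF l2_cut_add l2_cut_scaleR l2_cut_idem l2_cut_sym])

lemma inner_one_proj: "inner (l2_one \<Omega>) (l2_mean_zero_proj \<Omega> y) = 0"
  using l2_cut_sym[of \<Omega> "l2_one \<Omega>" y] measure_domain_pos
  by (simp add: mean_zero_proj_eq inner_diff_right inner_l2_one[OF domain_fmeasurable] cut_one)

lemma cut_proj: "l2_cut \<Omega> (l2_mean_zero_proj \<Omega> y) = l2_mean_zero_proj \<Omega> y"
proof -
  interpret c: bounded_linear "l2_cut \<Omega>" by (rule bounded_linear_cut)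
  show ?thesis by (simp add: mean_zero_proj_eq c.diff c.scaleR l2_cut_idem cut_one)
qed

lemma mean_zero_proj_idem: "l2_mean_zero_proj \<Omega> (l2_mean_zero_proj \<Omega> y) = l2_mean_zero_proj \<Omega> y"
  by (subst mean_zero_proj_eq) (simp add: cut_proj inner_one_proj)

lemma mean_zero_proj_sym: "inner (l2_mean_zero_proj \<Omega> u) v = inner u (l2_mean_zero_proj \<Omega> v)"
  using l2_cut_sym[of \<Omega> u v] by (simp add: mean_zero_proj_eq inner_diff inner_commute mult.commute)

lemma bounded_linear_mean_zero_proj: "bounded_linear (l2_mean_zero_proj \<Omega>)"
  unfolding mean_zero_proj_eq[abs_def]
  by (intro bounded_linear_sub bounded_linear_cut bounded_linear_scaleR_const
      bounded_linear_compose[OF bounded_linear_divide bounded_linear_inner_right])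

lemma mean_zero_fixed: "mean_zero \<Omega> = {y. l2_mean_zero_proj \<Omega> y = y}"
proof (intro set_eqI iffI)
  fix y assume "y \<in> mean_zero \<Omega>"
  then have "y \<in> L2 \<Omega>" "inner (l2_one \<Omega>) y = 0"
    using l2_integral_inner[OF domain_fmeasurable] by (auto simp: mean_zero_def)
  then show "y \<in> {y. l2_mean_zero_proj \<Omega> y = y}"
    by (simp add: mean_zero_proj_eq l2_cut_ident[OF domain_sets])
next
  fix y assume "y \<in> {y. l2_mean_zero_proj \<Omega> y = y}"
  then have y: "y = l2_mean_zero_proj \<Omega> y" by simp
  then have "l2_cut \<Omega> y = y" "inner (l2_one \<Omega>) y = 0" using cut_proj[of y] inner_one_proj[of y] by auto
  then show "y \<in> mean_zero \<Omega>"
    using l2_cut_in_L2[of \<Omega> y] l2_integral_inner[OF domain_fmeasurable] by (simp add: mean_zero_def)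
qed

lemma mean_zero_proj_L2: "u \<in> L2 \<Omega> \<Longrightarrow> l2_mean_zero_proj \<Omega> u = l2_proj \<Omega> u"
  by (simp add: l2_mean_zero_proj_def l2_cut_ident[OF domain_sets])

lemma constrained_embedding_mean_zero:
  fixes \<iota> :: "'x::banach \<Rightarrow> 'd l2"
  assumes fs: "function_space \<Omega> \<iota>"
  shows "constrained_embedding \<iota> (proj \<Omega> \<iota>) (l2_mean_zero_proj \<Omega>)"
proof -
  have \<iota>: "bounded_linear \<iota>" "inj \<iota>" "\<And>u. \<iota> u \<in> L2 \<Omega>" using fs by (auto simp: function_space_def)
  have embed: "\<iota> (proj \<Omega> \<iota> u) = l2_mean_zero_proj \<Omega> (\<iota> u)" for u
    by (simp add: embed_proj[OF fs] mean_zero_proj_L2 \<iota>(3))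
  show ?thesis
  proof (rule constrained_embedding.intro)
    show "bounded_linear \<iota>" "inj \<iota>" by (rule \<iota>)+
    show "bounded_linear (proj \<Omega> \<iota>)"
      unfolding proj_def[abs_def] l2_integral_inner[OF domain_fmeasurable]
      by (intro bounded_linear_sub bounded_linear_ident bounded_linear_scaleR_const
          bounded_linear_compose[OF bounded_linear_divide bounded_linear_compose[OF bounded_linear_inner_right \<iota>(1)]])
    show "proj \<Omega> \<iota> (proj \<Omega> \<iota> u) = proj \<Omega> \<iota> u" for u
      by (rule injD[OF \<iota>(2)]) (simp add: embed mean_zero_proj_idem)
  qed (simp_all add: bounded_linear_mean_zero_proj mean_zero_proj_idem mean_zero_proj_sym embed)
qed

end

lemma dim_one_generator:
  fixes E :: "'x::real_vector set"
  assumes "dim E = 1"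
  obtains w where "w \<in> E" "w \<noteq> 0" "\<And>u. u \<in> E \<Longrightarrow> \<exists>c. u = c *\<^sub>R w"
proof -
  obtain B where B: "B \<subseteq> E" "independent B" "E \<subseteq> span B" "card B = dim E" by (rule basis_exists)
  then obtain w where w: "B = {w}" using assms by (metis card_1_singletonE)
  show ?thesis
  proof (rule that)
    show "w \<in> E" using B w by simp
    show "w \<noteq> 0" using B(2) w dependent_zero by blast
    show "\<exists>c. u = c *\<^sub>R w" if "u \<in> E" for u
      using B(3) that w by (auto simp: span_singleton)
  qed
qed

theorem theorem3:
  fixes \<Omega> :: "'d::euclidean_space set"
    and \<iota> :: "'x::banach \<Rightarrow> 'd l2"
    and F :: "'x \<Rightarrow> real"
    and G :: "'x \<Rightarrow> 'd l2"
    and H :: "'x \<Rightarrow> 'x \<Rightarrow>\<^sub>L 'd l2"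
    and m :: real
    and \<phi>s :: 'x
    and v :: "'x \<Rightarrow> 'x"
  assumes "bounded_domain \<Omega>"
    and "function_space \<Omega> \<iota>"
    and "variational_derivatives \<Omega> \<iota> F G H"
    and "continuous_on UNIV H"
    and "index1_saddle \<Omega> \<iota> G H m \<phi>s"
    and "\<And>\<phi>. \<phi> \<in> mass_class \<Omega> \<iota> m \<Longrightarrow> \<exists>u. is_min_direction \<Omega> \<iota> H \<phi> u \<Longrightarrow>
           is_min_direction \<Omega> \<iota> H \<phi> (v \<phi>)"
  defines "L \<equiv> \<lambda>\<psi> \<phi>. aux_functional \<iota> F \<phi> (v \<phi>) \<psi>"
  shows "(\<exists>W. openin (top_of_set (mass_class \<Omega> \<iota> m)) W \<and> \<phi>s \<in> W \<and>
              (\<forall>\<psi>\<in>W. L \<phi>s \<phi>s \<le> L \<psi> \<phi>s)) \<and>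
         (\<exists>U. openin (top_of_set (mass_class \<Omega> \<iota> m)) U \<and> \<phi>s \<in> U \<and>
            (\<forall>\<phi>\<in>U. strictly_convex_on U (\<lambda>\<psi>. L \<psi> \<phi>) \<and>
                   (\<exists>!\<psi>. is_arg_min (\<lambda>\<psi>. L \<psi> \<phi>) (\<lambda>\<psi>. \<psi> \<in> U) \<psi>)) \<and>
            (\<forall>\<Phi>. (\<forall>\<phi>\<in>U. is_arg_min (\<lambda>\<psi>. L \<psi> \<phi>) (\<lambda>\<psi>. \<psi> \<in> U) (\<Phi> \<phi>)) \<longrightarrow>
               ((\<forall>\<phi>\<in>U. stationary \<Omega> \<iota> G m \<phi> \<longrightarrow> \<phi> = \<phi>s) \<longrightarrow> {\<phi> \<in> U. \<Phi> \<phi> = \<phi>} = {\<phi>s}) \<and>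
               \<Phi> differentiable (at \<phi>s within U) \<and>
               (\<forall>D. (\<Phi> has_derivative D) (at \<phi>s within U) \<longrightarrow>
                    (\<forall>u. proj \<Omega> \<iota> (D (proj \<Omega> \<iota> u)) = 0)) \<and>
               (H differentiable_on U \<longrightarrow>
                  \<Phi> differentiable_on U \<and>
                  (\<exists>C \<delta>. 0 < \<delta> \<and>
                     (\<forall>\<phi>0\<in>U. norm (\<phi>0 - \<phi>s) < \<delta> \<longrightarrow>
                        (\<lambda>k. (\<Phi> ^^ k) \<phi>0) \<longlonglongrightarrow> \<phi>s \<and>
                        (\<forall>k. norm ((\<Phi> ^^ Suc k) \<phi>0 - \<phi>s)
                               \<le> C * (norm ((\<Phi> ^^ k) \<phi>0 - \<phi>s))\<^sup>2))))))"
proof -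
  note \<Omega> = assms(1) and fs = assms(2)
  let ?p = "proj \<Omega> \<iota>" and ?Q = "l2_mean_zero_proj \<Omega>" and ?one = "l2_one \<Omega>"
  interpret E: constrained_embedding \<iota> ?p ?Q by (rule constrained_embedding_mean_zero[OF \<Omega> fs])
  have int: "l2_integral \<Omega> u = inner ?one u" for u
    by (rule l2_integral_inner[OF domain_fmeasurable[OF \<Omega>]])
  have F: "\<And>\<phi>. (F has_derivative (\<lambda>h. inner (G \<phi>) (\<iota> h))) (at \<phi>)"
    and G: "\<And>\<phi>. (G has_derivative blinfun_apply (H \<phi>)) (at \<phi>)" and GL2: "\<And>\<phi>. G \<phi> \<in> L2 \<Omega>"
    using assms(3) by (auto simp: variational_derivatives_def)
  have H_cont: "isCont H \<phi>" for \<phi> using assms(4) by (simp add: continuous_on_eq_continuous_at)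
  \<comment> \<open>\<open>G\<close> takes values in the fixed set of the restriction to \<open>\<Omega>\<close>, so its derivative does too.\<close>
  have HL2: "H \<phi> u \<in> L2 \<Omega>" for \<phi> u
  proof -
    have "((\<lambda>\<phi>. l2_cut \<Omega> (G \<phi>)) has_derivative (\<lambda>h. l2_cut \<Omega> (H \<phi> h))) (at \<phi>)"
      by (rule bounded_linear.has_derivative[OF bounded_linear_cut[OF \<Omega>] G])
    then have "(G has_derivative (\<lambda>h. l2_cut \<Omega> (H \<phi> h))) (at \<phi>)"
      by (simp add: l2_cut_ident[OF domain_sets[OF \<Omega>] GL2])
    then have "(\<lambda>h. l2_cut \<Omega> (H \<phi> h)) = blinfun_apply (H \<phi>)" using G by (rule has_derivative_unique)
    then show ?thesis using l2_cut_in_L2[of \<Omega> "H \<phi> u"] by metis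
  qed
  have PG: "?Q (G \<phi>) = l2_proj \<Omega> (G \<phi>)" for \<phi> by (rule mean_zero_proj_L2[OF \<Omega> GL2])
  have PH: "?Q (H \<phi> u) = l2_proj \<Omega> (H \<phi> u)" for \<phi> u by (rule mean_zero_proj_L2[OF \<Omega> HL2])
  have X0: "E.X0 = mass_class \<Omega> \<iota> 0"
  proof (intro set_eqI)
    fix u
    have "?one \<noteq> 0"
      using inner_l2_one[OF domain_fmeasurable[OF \<Omega>]] measure_domain_pos[OF \<Omega>]
      by (metis inner_zero_left less_irrefl)
    have e: "\<iota> (?p u) = \<iota> u - (inner ?one (\<iota> u) / measure lborel \<Omega>) *\<^sub>R ?one"
      by (simp only: embed_proj[OF fs] l2_proj_inner[OF \<Omega>])
    have "u \<in> E.X0 \<longleftrightarrow> \<iota> (?p u) = \<iota> u"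
      unfolding E.X0_def by (simp only: mem_Collect_eq inj_eq[OF E.inj_embed])
    also have "\<dots> \<longleftrightarrow> inner ?one (\<iota> u) / measure lborel \<Omega> = 0"
      unfolding e using \<open>?one \<noteq> 0\<close> by (simp only: diff_eq_eq add_cancel_left_right scaleR_eq_0_iff) simp
    also have "\<dots> \<longleftrightarrow> u \<in> mass_class \<Omega> \<iota> 0"
      unfolding mass_class_def int using measure_domain_pos[OF \<Omega>] by simp
    finally show "u \<in> E.X0 \<longleftrightarrow> u \<in> mass_class \<Omega> \<iota> 0" .
  qed
  have Y: "E.Y = mean_zero \<Omega>" unfolding E.Y_def mean_zero_fixed[OF \<Omega>] ..
  obtain \<nu> where stat: "stationary \<Omega> \<iota> G m \<phi>s" and \<nu>: "\<nu> < 0"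
    and dim1: "dim (eigenspace \<Omega> \<iota> (proj_hessian \<Omega> \<iota> H \<phi>s) \<nu>) = 1"
    and spectrum: "\<And>\<mu>. \<mu> \<notin> resolvent_set \<Omega> \<iota> (proj_hessian \<Omega> \<iota> H \<phi>s) \<Longrightarrow> \<mu> \<noteq> \<nu> \<Longrightarrow> 0 < \<mu>"
    using assms(5) unfolding index1_saddle_def by blast
  have hess: "proj_hessian \<Omega> \<iota> H \<phi> u = ?Q (H \<phi> (?p u))" for \<phi> u by (simp add: proj_hessian_def PH)
  have eig: "u \<in> eigenspace \<Omega> \<iota> (proj_hessian \<Omega> \<iota> H \<phi>s) \<nu> \<longleftrightarrow> u \<in> E.X0 \<and> ?Q (H \<phi>s u) = \<nu> *\<^sub>R \<iota> u" for u
    by (auto simp: eigenspace_def hess X0[symmetric])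
  obtain w where w: "w \<in> E.X0" "?Q (H \<phi>s w) = \<nu> *\<^sub>R \<iota> w" "w \<noteq> 0"
    and w_span: "\<And>u. u \<in> E.X0 \<Longrightarrow> ?Q (H \<phi>s u) = \<nu> *\<^sub>R \<iota> u \<Longrightarrow> \<exists>c. u = c *\<^sub>R w"
    using dim_one_generator[OF dim1] unfolding eig by metis
  have nw: "norm (\<iota> w) \<noteq> 0" using w(3) E.inj_embed by (metis E.embed.zero injD norm_eq_zero)
  define v0 where "v0 = w /\<^sub>R norm (\<iota> w)"
  have S: "saddle_problem \<iota> ?p ?Q F G H \<phi>s \<nu> v0"
  proof (intro saddle_problem.intro E.constrained_embedding_axioms saddle_problem_axioms.intro)
    show "inner (H \<phi> u) (\<iota> w) = inner (\<iota> u) (H \<phi> w)" for \<phi> u w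
      by (rule hessian_symmetric[OF F G E.bounded_linear_embed H_cont])
    show "?Q (G \<phi>s) = 0" using stat by (simp add: stationary_def PG)
    show "\<exists>C. E.iso_with C (\<lambda>u. ?Q (H \<phi>s u) - \<mu> *\<^sub>R \<iota> u)" if "\<mu> \<le> 0" "\<mu> \<noteq> \<nu>" for \<mu>
    proof -
      have "\<mu> \<in> resolvent_set \<Omega> \<iota> (proj_hessian \<Omega> \<iota> H \<phi>s)" using spectrum[of \<mu>] that by linarith
      then obtain C where bij: "bij_betw (\<lambda>u. ?Q (H \<phi>s (?p u)) - \<mu> *\<^sub>R \<iota> u) E.X0 E.Y"
        and C: "\<And>u. u \<in> E.X0 \<Longrightarrow> norm u \<le> C * norm (?Q (H \<phi>s (?p u)) - \<mu> *\<^sub>R \<iota> u)"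
        unfolding resolvent_set_def hess X0 Y by blast
      have "E.iso_with (max C 1) (\<lambda>u. ?Q (H \<phi>s u) - \<mu> *\<^sub>R \<iota> u)"
        unfolding E.iso_with_def
      proof (intro conjI ballI)
        show "0 < max C 1" by simp
        show "bounded_linear (\<lambda>u. ?Q (H \<phi>s u) - \<mu> *\<^sub>R \<iota> u)"
          by (intro bounded_linear_intros E.bounded_linear_embed
              bounded_linear_compose[OF E.bounded_linear_Q blinfun.bounded_linear_right])
        have "(\<lambda>u. ?Q (H \<phi>s u) - \<mu> *\<^sub>R \<iota> u) ` E.X0 = (\<lambda>u. ?Q (H \<phi>s (?p u)) - \<mu> *\<^sub>R \<iota> u) ` E.X0"
          by (intro image_cong) auto
        then show "(\<lambda>u. ?Q (H \<phi>s u) - \<mu> *\<^sub>R \<iota> u) ` E.X0 = E.Y" using bij by (simp add: bij_betw_def)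
        fix u assume u: "u \<in> E.X0"
        have "norm u \<le> C * norm (?Q (H \<phi>s u) - \<mu> *\<^sub>R \<iota> u)" using C[OF u] u by simp
        also have "\<dots> \<le> max C 1 * norm (?Q (H \<phi>s u) - \<mu> *\<^sub>R \<iota> u)" by (intro mult_right_mono) auto
        finally show "norm u \<le> max C 1 * norm (?Q (H \<phi>s u) - \<mu> *\<^sub>R \<iota> u)" .
      qed
      then show ?thesis by blast
    qed
    show "v0 \<in> E.X0" using w by (simp add: v0_def)
    show "?Q (H \<phi>s v0) = \<nu> *\<^sub>R \<iota> v0"
      using w(2) by (simp add: v0_def blinfun.scaleR_right E.Q.scaleR E.embed.scaleR)
    show "norm (\<iota> v0) = 1" using nw by (simp add: v0_def E.embed.scaleR)
    show "\<exists>c. u = c *\<^sub>R v0" if u: "u \<in> E.X0" "?Q (H \<phi>s u) = \<nu> *\<^sub>R \<iota> u" for u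
    proof -
      obtain c where "u = c *\<^sub>R w" using w_span[OF u] by blast
      then have "u = (c * norm (\<iota> w)) *\<^sub>R v0" using nw by (simp add: v0_def)
      then show ?thesis by blast
    qed
  qed (use F G H_cont \<nu> in auto)
  interpret S: saddle_problem \<iota> ?p ?Q F G H \<phi>s \<nu> v0 by (rule S)
  have V: "S.V = mass_class \<Omega> \<iota> m"
    using stat by (auto simp: S.V_def X0 mass_class_def stationary_def int E.embed.diff inner_diff_right)
  have min_dir: "S.min_dir \<phi> = is_min_direction \<Omega> \<iota> H \<phi>" for \<phi>
    by (simp add: S.min_dir_def is_min_direction_def hess X0)
  have L: "L = (\<lambda>\<psi> \<phi>. S.aux \<phi> (v \<phi>) \<psi>)"
    by (simp add: L_def fun_eq_iff S.aux_def aux_functional_def)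
  have L_app: "S.aux \<phi> (v \<phi>) \<psi> = L \<psi> \<phi>" for \<phi> \<psi> by (simp add: L)
  note S_thm = S.newton_map_theorem[of v, unfolded V min_dir L_app]
  show ?thesis
  proof (rule exE[OF S_thm], erule (1) assms(6), elim conjE)
    fix U assume openU: "openin (top_of_set (mass_class \<Omega> \<iota> m)) U" and s: "\<phi>s \<in> U"
    and min: "\<forall>\<psi>\<in>U. L \<phi>s \<phi>s \<le> L \<psi> \<phi>s"
    and conv: "\<forall>\<phi>\<in>U. strictly_convex_on U (\<lambda>\<psi>. L \<psi> \<phi>) \<and> (\<exists>!\<psi>. is_arg_min (\<lambda>\<psi>. L \<psi> \<phi>) (\<lambda>\<psi>. \<psi> \<in> U) \<psi>)"
    and map: "\<forall>\<Phi>. (\<forall>\<phi>\<in>U. is_arg_min (\<lambda>\<psi>. L \<psi> \<phi>) (\<lambda>\<psi>. \<psi> \<in> U) (\<Phi> \<phi>)) \<longrightarrow>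
               ((\<forall>\<phi>\<in>U. ?Q (G \<phi>) = 0 \<longrightarrow> \<phi> = \<phi>s) \<longrightarrow> {\<phi> \<in> U. \<Phi> \<phi> = \<phi>} = {\<phi>s}) \<and>
               \<Phi> differentiable (at \<phi>s within U) \<and>
               (\<forall>D. (\<Phi> has_derivative D) (at \<phi>s within U) \<longrightarrow> (\<forall>u. D (?p u) = 0)) \<and>
               (H differentiable_on U \<longrightarrow>
                  \<Phi> differentiable_on U \<and>
                  (\<exists>C \<delta>. 0 < \<delta> \<and>
                     (\<forall>\<phi>0\<in>U. norm (\<phi>0 - \<phi>s) < \<delta> \<longrightarrow>
                        (\<lambda>k. (\<Phi> ^^ k) \<phi>0) \<longlonglongrightarrow> \<phi>s \<and>
                        (\<forall>k. norm ((\<Phi> ^^ Suc k) \<phi>0 - \<phi>s)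
                               \<le> C * (norm ((\<Phi> ^^ k) \<phi>0 - \<phi>s))\<^sup>2))))"
    have UV: "U \<subseteq> mass_class \<Omega> \<iota> m" by (rule openin_imp_subset[OF openU])
    have "stationary \<Omega> \<iota> G m \<phi> \<longleftrightarrow> ?Q (G \<phi>) = 0" if "\<phi> \<in> U" for \<phi>
      using subsetD[OF UV that] by (simp add: stationary_def PG)
    then have stat_U: "(\<forall>\<phi>\<in>U. stationary \<Omega> \<iota> G m \<phi> \<longrightarrow> \<phi> = \<phi>s) \<longleftrightarrow> (\<forall>\<phi>\<in>U. ?Q (G \<phi>) = 0 \<longrightarrow> \<phi> = \<phi>s)"
      by simp
    have deriv: "\<forall>D. (\<Phi> has_derivative D) (at \<phi>s within U) \<longrightarrow> (\<forall>u. ?p (D (?p u)) = 0)"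
      if "\<forall>D. (\<Phi> has_derivative D) (at \<phi>s within U) \<longrightarrow> (\<forall>u. D (?p u) = 0)" for \<Phi>
      using that by (metis E.p.zero)
    have fixed: "(\<forall>\<phi>\<in>U. stationary \<Omega> \<iota> G m \<phi> \<longrightarrow> \<phi> = \<phi>s) \<longrightarrow> R"
      if "(\<forall>\<phi>\<in>U. ?Q (G \<phi>) = 0 \<longrightarrow> \<phi> = \<phi>s) \<longrightarrow> R" for R
      using that stat_U by blast
    show ?thesis
      by (rule conjI, rule exI[of _ U], rule conjI[OF openU], rule conjI[OF s], rule min,
          rule exI[of _ U], rule conjI[OF openU], rule conjI[OF s], rule conjI[OF conv],
          rule allI, rule impI, drule spec[OF map, THEN mp], elim conjE,
          rule conjI, erule fixed, rule conjI, assumption, rule conjI, erule deriv, assumption)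
  qed
qed

end
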